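(* Consider the adjoint functor pair $(-)(\omega)\colon\mathrm{sSet}^{\mathcal{I}}\rightleftarrows\mathrm{sSet}^{M}_{\mathrm{tame}}\colon(-)_\bullet$ (left adjoint $(-)(\omega)$) with unit $\eta_X\colon X\to X^{\flat}=(X(\omega))_\bullet$ and counit $\epsilon_W\colon (W_\bullet)(\omega)\to W$. (i) For every tame $M$-space $W$, the adjunction counit $\epsilon_W\colon (W_\bullet)(\omega)\to W$ is an isomorphism. (ii) For every $\mathcal{I}$-space $X$, the adjunction unit $\eta_X\colon X\to X^{\flat}$ is an $\mathcal{N}$-isomorphism. (iii) For every $\mathcal{I}$-space $X$, the adjunction unit $\eta_X\colon X\to X^{\flat}$ is an isomorphism if and only if $X$ is flat. (iv) The restrictions of $(-)(\omega)$ and $(-)_\bullet$ are equivalences of categories $(-)(\omega)\colon\mathrm{sSet}^{\mathcal{I}}_{\mathrm{flat}}\rightleftarrows\mathrm{sSet}^{M}_{\mathrm{tame}}\colon(-)_\bullet$ between the full subcategories of flat $\mathcal{I}$-spaces and tame $M$-spaces.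
   Context: Let $\omega=\{1,2,3,\dots\}$ and let $M$ be the monoid of injective maps $\omega\to\omega$ under composition. An $M$-set is a set with a left $M$-action. An element $x$ of an $M$-set is supported on $A\subseteq\omega$ if $fx=x$ for every $f\in M$ fixing $A$ elementwise; $\mathrm{supp}(x)$ is the intersection of all finite subsets on which $x$ is supported ($\mathrm{supp}(x)=\omega$ if there are none). An $M$-set is tame if each element is supported on a finite subset. An $M$-space is a simplicial set with left $M$-action, tame if the $M$-set of $k$-simplices is tame for every $k$; $\mathrm{sSet}^M_{\mathrm{tame}}$ is the category of tame $M$-spaces. $\mathcal{I}$ is the category of the sets $\mathbf{m}=\{1,\dots,m\}$, $m\ge0$, and all injective maps; $\mathcal{N}\subset\mathcal{I}$ is the subcategory with all objects and only the inclusions as morphisms. An $\mathcal{I}$-set (resp. $\mathcal{I}$-space) is a functor from $\mathcal{I}$ to sets (resp. simplicial sets). An $\mathcal{I}$-set $X$ is flat if every morphism of $\mathcal{I}$ induces an injective map and $X$ sends pullback squares in $\mathcal{I}$ to pullback squares of sets; an $\mathcal{I}$-space is flat if its $\mathcal{I}$-set of $q$-simplices is flat for every $q\ge0$. For an $\mathcal{I}$-space $X$, $X(\omega)=\mathrm{colim}_{\mathcal{N}}X$ with $M$-action $f[x]=[X(\tilde f)(x)]$ for $x\in X(\mathbf{m})$, where $\tilde f\colon\mathbf{m}\to\mathbf{n}$, $n=\max(f(\mathbf{m}))$, is the restriction of $f\in M$; this is a tame $M$-space. For an $M$-set $W$, $W_{\bullet}$ is the $\mathcal{I}$-set with $W_{\mathbf{m}}=\{x\in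 W:\mathrm{supp}(x)\subseteq\mathbf{m}\}$ and $\alpha_*(x)=\tilde\alpha x$ for $\alpha\colon\mathbf{m}\to\mathbf{n}$, with $\tilde\alpha\in M$ any extension of $\alpha$; for tame $M$-spaces this is applied in every simplicial degree. The unit $\eta_X$ is given by the canonical maps $X(\mathbf{m})\to X(\omega)_{\mathbf{m}}$, and the counit $\epsilon_W$ is induced by the inclusions $W_{\mathbf{m}}\subseteq W$. A morphism $f$ of $\mathcal{I}$-spaces is an $\mathcal{N}$-isomorphism if $f(\omega)$ is an isomorphism. *)

theory Defs
  imports Complex_Main "HOL-Library.FuncSet" "HOL-Library.Infinite_Typeclass"
begin

section \<open>Categories, functors, natural transformations\<close>

text \<open>Composition and identities are indexed by objects, so that arrows need not carry their
  domain and codomain: \<open>cmp C x y z g f\<close> is the composite of \<open>f : x \<rightarrow> y\<close> and \<open>g : y \<rightarrow> z\<close>.\<close>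

record ('o, 'a) cat_data =
  ob :: "'o set"
  hom :: "'o \<Rightarrow> 'o \<Rightarrow> 'a set"
  idn :: "'o \<Rightarrow> 'a"
  cmp :: "'o \<Rightarrow> 'o \<Rightarrow> 'o \<Rightarrow> 'a \<Rightarrow> 'a \<Rightarrow> 'a"

locale category =
  fixes C :: "('o, 'a) cat_data"
  assumes idn_hom: "x \<in> ob C \<Longrightarrow> idn C x \<in> hom C x x"
    and cmp_hom: "\<lbrakk>x \<in> ob C; y \<in> ob C; z \<in> ob C; f \<in> hom C x y; g \<in> hom C y z\<rbrakk>
      \<Longrightarrow> cmp C x y z g f \<in> hom C x z"
    and cmp_idn_left: "\<lbrakk>x \<in> ob C; y \<in> ob C; f \<in> hom C x y\<rbrakk> \<Longrightarrow> cmp C x y y (idn C y) f = f"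
    and cmp_idn_right: "\<lbrakk>x \<in> ob C; y \<in> ob C; f \<in> hom C x y\<rbrakk> \<Longrightarrow> cmp C x x y f (idn C x) = f"
    and cmp_assoc: "\<lbrakk>w \<in> ob C; x \<in> ob C; y \<in> ob C; z \<in> ob C;
        f \<in> hom C w x; g \<in> hom C x y; h \<in> hom C y z\<rbrakk>
      \<Longrightarrow> cmp C w y z h (cmp C w x y g f) = cmp C w x z (cmp C x y z h g) f"

definition is_iso :: "('o, 'a) cat_data \<Rightarrow> 'o \<Rightarrow> 'o \<Rightarrow> 'a \<Rightarrow> bool" where
  "is_iso C x y f \<longleftrightarrow> f \<in> hom C x y \<and>
     (\<exists>g \<in> hom C y x. cmp C x y x g f = idn C x \<and> cmp C y x y f g = idn C y)"

text \<open>The square with \<open>p : P \<rightarrow> A\<close>, \<open>q : P \<rightarrow> B\<close>, \<open>f : A \<rightarrow> D\<close>, \<open>g : B \<rightarrow> D\<close> is a pullback.\<close>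

definition is_pullback ::
    "('o, 'a) cat_data \<Rightarrow> 'o \<Rightarrow> 'o \<Rightarrow> 'o \<Rightarrow> 'o \<Rightarrow> 'a \<Rightarrow> 'a \<Rightarrow> 'a \<Rightarrow> 'a \<Rightarrow> bool" where
  "is_pullback C P A B D p q f g \<longleftrightarrow>
     {P, A, B, D} \<subseteq> ob C \<and>
     p \<in> hom C P A \<and> q \<in> hom C P B \<and> f \<in> hom C A D \<and> g \<in> hom C B D \<and>
     cmp C P A D f p = cmp C P B D g q \<and>
     (\<forall>T \<in> ob C. \<forall>a \<in> hom C T A. \<forall>b \<in> hom C T B. cmp C T A D f a = cmp C T B D g b \<longrightarrow>
        (\<exists>!u. u \<in> hom C T P \<and> cmp C T P A p u = a \<and> cmp C T P B q u = b))"

definition op_cat :: "('o, 'a) cat_data \<Rightarrow> ('o, 'a) cat_data" where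
  "op_cat C = \<lparr>ob = ob C, hom = (\<lambda>x y. hom C y x), idn = idn C,
               cmp = (\<lambda>x y z g f. cmp C z y x f g)\<rparr>"

definition full_subcat :: "('o, 'a) cat_data \<Rightarrow> ('o \<Rightarrow> bool) \<Rightarrow> ('o, 'a) cat_data" where
  "full_subcat C P = C\<lparr>ob := {x \<in> ob C. P x}\<rparr>"

record ('o, 'a, 'p, 'b) fun_data =
  fob :: "'o \<Rightarrow> 'p"
  farr :: "'o \<Rightarrow> 'o \<Rightarrow> 'a \<Rightarrow> 'b"

locale cat_functor = dom: category C + cod: category D
  for C :: "('o, 'a) cat_data" and D :: "('p, 'b) cat_data" +
  fixes F :: "('o, 'a, 'p, 'b) fun_data"
  assumes fob_ob: "x \<in> ob C \<Longrightarrow> fob F x \<in> ob D"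
    and farr_hom: "\<lbrakk>x \<in> ob C; y \<in> ob C; f \<in> hom C x y\<rbrakk>
      \<Longrightarrow> farr F x y f \<in> hom D (fob F x) (fob F y)"
    and farr_idn: "x \<in> ob C \<Longrightarrow> farr F x x (idn C x) = idn D (fob F x)"
    and farr_cmp: "\<lbrakk>x \<in> ob C; y \<in> ob C; z \<in> ob C; f \<in> hom C x y; g \<in> hom C y z\<rbrakk>
      \<Longrightarrow> farr F x z (cmp C x y z g f)
          = cmp D (fob F x) (fob F y) (fob F z) (farr F y z g) (farr F x y f)"

definition id_functor :: "('o, 'a, 'o, 'a) fun_data" where
  "id_functor = \<lparr>fob = (\<lambda>x. x), farr = (\<lambda>x y f. f)\<rparr>"

definition comp_functor ::
    "('p, 'b, 'q, 'c) fun_data \<Rightarrow> ('o, 'a, 'p, 'b) fun_data \<Rightarrow> ('o, 'a, 'q, 'c) fun_data" where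
  "comp_functor G F = \<lparr>fob = (\<lambda>x. fob G (fob F x)),
                       farr = (\<lambda>x y f. farr G (fob F x) (fob F y) (farr F x y f))\<rparr>"

locale nat_trans = source: cat_functor C D F + target: cat_functor C D G
  for C :: "('o, 'a) cat_data" and D :: "('p, 'b) cat_data"
    and F :: "('o, 'a, 'p, 'b) fun_data" and G :: "('o, 'a, 'p, 'b) fun_data" +
  fixes t :: "'o \<Rightarrow> 'b"
  assumes component: "x \<in> ob C \<Longrightarrow> t x \<in> hom D (fob F x) (fob G x)"
    and naturality: "\<lbrakk>x \<in> ob C; y \<in> ob C; f \<in> hom C x y\<rbrakk>
      \<Longrightarrow> cmp D (fob F x) (fob F y) (fob G y) (t y) (farr F x y f)
        = cmp D (fob F x) (fob G x) (fob G y) (farr G x y f) (t x)"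

definition nat_iso ::
    "('o, 'a) cat_data \<Rightarrow> ('p, 'b) cat_data \<Rightarrow> ('o, 'a, 'p, 'b) fun_data \<Rightarrow>
     ('o, 'a, 'p, 'b) fun_data \<Rightarrow> ('o \<Rightarrow> 'b) \<Rightarrow> bool" where
  "nat_iso C D F G t \<longleftrightarrow>
     nat_trans C D F G t \<and> (\<forall>x \<in> ob C. is_iso D (fob F x) (fob G x) (t x))"

text \<open>\<open>F : C \<rightarrow> D\<close> is left adjoint to \<open>G\<close> with unit \<open>\<eta>\<close> and counit \<open>\<epsilon>\<close>.\<close>

definition adjunction ::
    "('o, 'a) cat_data \<Rightarrow> ('p, 'b) cat_data \<Rightarrow> ('o, 'a, 'p, 'b) fun_data \<Rightarrow>
     ('p, 'b, 'o, 'a) fun_data \<Rightarrow> ('o \<Rightarrow> 'a) \<Rightarrow> ('p \<Rightarrow> 'b) \<Rightarrow> bool" where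
  "adjunction C D F G \<eta> \<epsilon> \<longleftrightarrow>
     cat_functor C D F \<and> cat_functor D C G \<and>
     nat_trans C C id_functor (comp_functor G F) \<eta> \<and>
     nat_trans D D (comp_functor F G) id_functor \<epsilon> \<and>
     (\<forall>x \<in> ob C. cmp D (fob F x) (fob F (fob G (fob F x))) (fob F x)
         (\<epsilon> (fob F x)) (farr F x (fob G (fob F x)) (\<eta> x)) = idn D (fob F x)) \<and>
     (\<forall>y \<in> ob D. cmp C (fob G y) (fob G (fob F (fob G y))) (fob G y)
         (farr G (fob F (fob G y)) y (\<epsilon> y)) (\<eta> (fob G y)) = idn C (fob G y))"

text \<open>\<open>F\<close> and \<open>G\<close> are mutually quasi-inverse; in particular each is an equivalence of categories.\<close>

definition inverse_equivalences ::
    "('o, 'a) cat_data \<Rightarrow> ('p, 'b) cat_data \<Rightarrow> ('o, 'a, 'p, 'b) fun_data \<Rightarrow>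
     ('p, 'b, 'o, 'a) fun_data \<Rightarrow> bool" where
  "inverse_equivalences C D F G \<longleftrightarrow>
     cat_functor C D F \<and> cat_functor D C G \<and>
     (\<exists>t. nat_iso C C id_functor (comp_functor G F) t) \<and>
     (\<exists>t. nat_iso D D (comp_functor F G) id_functor t)"

text \<open>Arrows of a functor category are required to be extensional, so that two natural
  transformations with the same components are equal.\<close>

definition functor_cat ::
    "('o, 'a) cat_data \<Rightarrow> ('p, 'b) cat_data \<Rightarrow> (('o, 'a, 'p, 'b) fun_data, 'o \<Rightarrow> 'b) cat_data" where
  "functor_cat C D =
    \<lparr>ob = {F. cat_functor C D F},
     hom = (\<lambda>F G. {t \<in> extensional (ob C). nat_trans C D F G t}),
     idn = (\<lambda>F. \<lambda>x \<in> ob C. idn D (fob F x)),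
     cmp = (\<lambda>F G H s t. \<lambda>x \<in> ob C. cmp D (fob F x) (fob G x) (fob H x) (s x) (t x))\<rparr>"

section \<open>Sets, simplicial sets, I-sets and I-spaces\<close>

text \<open>\<open>'u\<close> plays the role of the universe: sets are the sets of elements of \<open>'u\<close>. It will be
  assumed infinite, so that sets are closed under the countable colimits used below.\<close>

definition set_cat :: "('u set, 'u \<Rightarrow> 'u) cat_data" where
  "set_cat = \<lparr>ob = UNIV, hom = (\<lambda>A B. A \<rightarrow>\<^sub>E B), idn = (\<lambda>A. \<lambda>x \<in> A. x),
              cmp = (\<lambda>A B C g f. compose A g f)\<rparr>"

text \<open>The object \<open>n\<close> of the simplex category stands for the ordered set \<open>{0, \<dots>, n}\<close>.\<close>

definition simplex_cat :: "(nat, nat \<Rightarrow> nat) cat_data" where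
  "simplex_cat = \<lparr>ob = UNIV, hom = (\<lambda>m n. {\<theta> \<in> {0..m} \<rightarrow>\<^sub>E {0..n}. mono_on {0..m} \<theta>}),
                  idn = (\<lambda>n. \<lambda>i \<in> {0..n}. i), cmp = (\<lambda>l m n g f. compose {0..l} g f)\<rparr>"

text \<open>The object \<open>m\<close> of \<open>\<I>\<close> stands for the set \<open>{1, \<dots>, m}\<close>.\<close>

definition I_cat :: "(nat, nat \<Rightarrow> nat) cat_data" where
  "I_cat = \<lparr>ob = UNIV, hom = (\<lambda>m n. {\<alpha> \<in> {1..m} \<rightarrow>\<^sub>E {1..n}. inj_on \<alpha> {1..m}}),
            idn = (\<lambda>n. \<lambda>i \<in> {1..n}. i), cmp = (\<lambda>l m n g f. compose {1..l} g f)\<rparr>"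

type_synonym 'u sset = "(nat, nat \<Rightarrow> nat, 'u set, 'u \<Rightarrow> 'u) fun_data"
type_synonym 'u smap = "nat \<Rightarrow> 'u \<Rightarrow> 'u"
type_synonym 'u iset = "(nat, nat \<Rightarrow> nat, 'u set, 'u \<Rightarrow> 'u) fun_data"
type_synonym 'u ispace = "(nat, nat \<Rightarrow> nat, 'u sset, 'u smap) fun_data"
type_synonym 'u imap = "nat \<Rightarrow> 'u smap"

definition sset_cat :: "('u sset, 'u smap) cat_data" where
  "sset_cat = functor_cat (op_cat simplex_cat) set_cat"

definition iset_cat :: "('u iset, nat \<Rightarrow> 'u \<Rightarrow> 'u) cat_data" where
  "iset_cat = functor_cat I_cat set_cat"

definition ispace_cat :: "('u ispace, 'u imap) cat_data" where
  "ispace_cat = functor_cat I_cat sset_cat"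

definition iset_simplices :: "'u ispace \<Rightarrow> nat \<Rightarrow> 'u iset" where
  "iset_simplices X q = \<lparr>fob = (\<lambda>m. fob (fob X m) q), farr = (\<lambda>m n \<alpha>. farr X m n \<alpha> q)\<rparr>"

definition flat_iset :: "'u iset \<Rightarrow> bool" where
  "flat_iset Y \<longleftrightarrow> Y \<in> ob iset_cat \<and>
     (\<forall>m n. \<forall>\<alpha> \<in> hom I_cat m n. inj_on (farr Y m n \<alpha>) (fob Y m)) \<and>
     (\<forall>k a b d p q f g. is_pullback I_cat k a b d p q f g \<longrightarrow>
        is_pullback set_cat (fob Y k) (fob Y a) (fob Y b) (fob Y d)
          (farr Y k a p) (farr Y k b q) (farr Y a d f) (farr Y b d g))"

definition flat_ispace :: "'u ispace \<Rightarrow> bool" where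
  "flat_ispace X \<longleftrightarrow> (\<forall>q. flat_iset (iset_simplices X q))"

definition flat_ispace_cat :: "('u ispace, 'u imap) cat_data" where
  "flat_ispace_cat = full_subcat ispace_cat flat_ispace"

section \<open>M-sets and M-spaces\<close>

text \<open>The monoid \<open>M\<close> is \<open>M_set\<close> with multiplication \<open>compose omega\<close>; its elements are made
  extensional outside \<open>omega\<close>, hence the identity is \<open>\<lambda>i \<in> omega. i\<close>.\<close>

definition omega :: "nat set" where
  "omega = {1..}"

definition M_set :: "(nat \<Rightarrow> nat) set" where
  "M_set = {f \<in> omega \<rightarrow>\<^sub>E omega. inj_on f omega}"

record 'u mset_data =
  mcar :: "'u set"
  mact :: "(nat \<Rightarrow> nat) \<Rightarrow> 'u \<Rightarrow> 'u"

definition is_mset :: "'u mset_data \<Rightarrow> bool" where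
  "is_mset W \<longleftrightarrow>
     (\<forall>f \<in> M_set. \<forall>x \<in> mcar W. mact W f x \<in> mcar W) \<and>
     (\<forall>x \<in> mcar W. mact W (\<lambda>i \<in> omega. i) x = x) \<and>
     (\<forall>f \<in> M_set. \<forall>g \<in> M_set. \<forall>x \<in> mcar W.
        mact W (compose omega f g) x = mact W f (mact W g x))"

definition supported_on :: "'u mset_data \<Rightarrow> 'u \<Rightarrow> nat set \<Rightarrow> bool" where
  "supported_on W x A \<longleftrightarrow> (\<forall>f \<in> M_set. (\<forall>i \<in> A. f i = i) \<longrightarrow> mact W f x = x)"

definition supp :: "'u mset_data \<Rightarrow> 'u \<Rightarrow> nat set" where
  "supp W x =
     (if \<exists>A \<subseteq> omega. finite A \<and> supported_on W x A
      then \<Inter>{A. A \<subseteq> omega \<and> finite A \<and> supported_on W x A} else omega)"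

definition tame_mset :: "'u mset_data \<Rightarrow> bool" where
  "tame_mset W \<longleftrightarrow> is_mset W \<and>
     (\<forall>x \<in> mcar W. \<exists>A \<subseteq> omega. finite A \<and> supported_on W x A)"

record 'u mspace =
  msset :: "'u sset"
  mspact :: "(nat \<Rightarrow> nat) \<Rightarrow> 'u smap"

definition mset_simplices :: "'u mspace \<Rightarrow> nat \<Rightarrow> 'u mset_data" where
  "mset_simplices W q = \<lparr>mcar = fob (msset W) q, mact = (\<lambda>f. mspact W f q)\<rparr>"

definition is_mspace :: "'u mspace \<Rightarrow> bool" where
  "is_mspace W \<longleftrightarrow>
     msset W \<in> ob sset_cat \<and>
     (\<forall>f \<in> M_set. mspact W f \<in> hom sset_cat (msset W) (msset W)) \<and>
     mspact W (\<lambda>i \<in> omega. i) = idn sset_cat (msset W) \<and>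
     (\<forall>f \<in> M_set. \<forall>g \<in> M_set.
        mspact W (compose omega f g)
        = cmp sset_cat (msset W) (msset W) (msset W) (mspact W f) (mspact W g))"

definition mspace_cat :: "('u mspace, 'u smap) cat_data" where
  "mspace_cat =
    \<lparr>ob = {W. is_mspace W},
     hom = (\<lambda>V W. {\<phi> \<in> hom sset_cat (msset V) (msset W). \<forall>f \<in> M_set.
        cmp sset_cat (msset V) (msset V) (msset W) \<phi> (mspact V f)
        = cmp sset_cat (msset V) (msset W) (msset W) (mspact W f) \<phi>}),
     idn = (\<lambda>W. idn sset_cat (msset W)),
     cmp = (\<lambda>U V W. cmp sset_cat (msset U) (msset V) (msset W))\<rparr>"

definition tame_mspace :: "'u mspace \<Rightarrow> bool" where
  "tame_mspace W \<longleftrightarrow> (\<forall>q. tame_mset (mset_simplices W q))"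

definition tame_mspace_cat :: "('u mspace, 'u smap) cat_data" where
  "tame_mspace_cat = full_subcat mspace_cat tame_mspace"

section \<open>The functor from I-spaces to tame M-spaces\<close>

text \<open>The class of \<open>x \<in> Y(m)\<close> in the colimit of \<open>Y\<close> over the category of inclusions:
  \<open>(m, x)\<close> and \<open>(n, y)\<close> are identified iff they have the same image in some \<open>Y(p)\<close>, where
  \<open>m, n \<le> p\<close>; \<open>I_incl m\<close> is the inclusion of \<open>m\<close> into any such \<open>p\<close>. This is a set of pairs; in order to stay in the universe \<open>'u\<close>, it is named by the code
  of one of its members, which loses no information (\<open>germ_eq_iff\<close> below).\<close>

definition I_incl :: "nat \<Rightarrow> nat \<Rightarrow> nat" where
  "I_incl m = (\<lambda>i \<in> {1..m}. i)"

definition colim_class :: "'u iset \<Rightarrow> nat \<Rightarrow> 'u \<Rightarrow> (nat \<times> 'u) set" where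
  "colim_class Y m x =
     {(n, y). y \<in> fob Y n \<and>
        (\<exists>p. m \<le> p \<and> n \<le> p \<and> farr Y m p (I_incl m) x = farr Y n p (I_incl n) y)}"

definition pair_code :: "nat \<times> 'u::infinite \<Rightarrow> 'u" where
  "pair_code = (SOME c. inj c)"

definition germ :: "'u::infinite iset \<Rightarrow> nat \<Rightarrow> 'u \<Rightarrow> 'u" where
  "germ Y m x = pair_code (SOME p. p \<in> colim_class Y m x)"

definition colim_N :: "'u::infinite iset \<Rightarrow> 'u set" where
  "colim_N Y = {germ Y m x | m x. x \<in> fob Y m}"

text \<open>Maps out of the colimit are defined on a chosen representative; they do not depend on the
  choice when \<open>Y\<close> is a functor and the map is compatible with the inclusions.\<close>

definition colim_rep :: "'u::infinite iset \<Rightarrow> 'u \<Rightarrow> nat \<times> 'u" where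
  "colim_rep Y y = (SOME p. snd p \<in> fob Y (fst p) \<and> germ Y (fst p) (snd p) = y)"

definition colim_map ::
    "'u::infinite iset \<Rightarrow> 'u iset \<Rightarrow> (nat \<Rightarrow> 'u \<Rightarrow> 'u) \<Rightarrow> 'u \<Rightarrow> 'u" where
  "colim_map Y Z \<phi> = (\<lambda>y \<in> colim_N Y. let (m, x) = colim_rep Y y in germ Z m (\<phi> m x))"

text \<open>\<open>f[x] = [Y(f')(x)]\<close>, where \<open>f' : m \<rightarrow> n\<close> is the restriction of \<open>f\<close> and \<open>n\<close> is the maximum of
  \<open>f ` {1, \<dots>, m}\<close>, read as \<open>0\<close> for \<open>m = 0\<close>.\<close>

definition omega_act :: "'u::infinite iset \<Rightarrow> (nat \<Rightarrow> nat) \<Rightarrow> 'u \<Rightarrow> 'u" where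
  "omega_act Y f = (\<lambda>y \<in> colim_N Y.
     let (m, x) = colim_rep Y y; n = Max (insert 0 (f ` {1..m}))
     in germ Y n (farr Y m n (restrict f {1..m}) x))"

definition omega_ob :: "'u::infinite ispace \<Rightarrow> 'u mspace" where
  "omega_ob X =
    \<lparr>msset = \<lparr>fob = (\<lambda>q. colim_N (iset_simplices X q)),
              farr = (\<lambda>q p \<theta>. colim_map (iset_simplices X q) (iset_simplices X p)
                                (\<lambda>m. farr (fob X m) q p \<theta>))\<rparr>,
     mspact = (\<lambda>f q. omega_act (iset_simplices X q) f)\<rparr>"

definition omega_functor :: "('u::infinite ispace, 'u imap, 'u mspace, 'u smap) fun_data" where
  "omega_functor =
    \<lparr>fob = omega_ob,
     farr = (\<lambda>X Z \<phi> q. colim_map (iset_simplices X q) (iset_simplices Z q) (\<lambda>m. \<phi> m q))\<rparr>"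

definition N_isomorphism :: "'u::infinite ispace \<Rightarrow> 'u ispace \<Rightarrow> 'u imap \<Rightarrow> bool" where
  "N_isomorphism X Z \<phi> \<longleftrightarrow> \<phi> \<in> hom ispace_cat X Z \<and>
     is_iso tame_mspace_cat (fob omega_functor X) (fob omega_functor Z) (farr omega_functor X Z \<phi>)"

section \<open>The functor from tame M-spaces to I-spaces\<close>

definition M_extension :: "nat \<Rightarrow> (nat \<Rightarrow> nat) \<Rightarrow> nat \<Rightarrow> nat" where
  "M_extension m \<alpha> = (SOME f. f \<in> M_set \<and> (\<forall>i \<in> {1..m}. f i = \<alpha> i))"

definition bullet_iset :: "'u mset_data \<Rightarrow> 'u iset" where
  "bullet_iset W =
    \<lparr>fob = (\<lambda>m. {x \<in> mcar W. supp W x \<subseteq> {1..m}}),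
     farr = (\<lambda>m n \<alpha>. \<lambda>x \<in> {x \<in> mcar W. supp W x \<subseteq> {1..m}}. mact W (M_extension m \<alpha>) x)\<rparr>"

definition bullet_ob :: "'u mspace \<Rightarrow> 'u ispace" where
  "bullet_ob W =
    \<lparr>fob = (\<lambda>m. \<lparr>fob = (\<lambda>q. fob (bullet_iset (mset_simplices W q)) m),
                 farr = (\<lambda>q p \<theta>. restrict (farr (msset W) q p \<theta>)
                                   (fob (bullet_iset (mset_simplices W q)) m))\<rparr>),
     farr = (\<lambda>m n \<alpha> q. farr (bullet_iset (mset_simplices W q)) m n \<alpha>)\<rparr>"

definition bullet_functor :: "('u mspace, 'u smap, 'u ispace, 'u imap) fun_data" where
  "bullet_functor =
    \<lparr>fob = bullet_ob,
     farr = (\<lambda>V W \<phi> m q. restrict (\<phi> q) (fob (bullet_iset (mset_simplices V q)) m))\<rparr>"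

section \<open>Unit and counit\<close>

abbreviation ispace_flat :: "'u::infinite ispace \<Rightarrow> 'u ispace" where
  "ispace_flat X \<equiv> fob bullet_functor (fob omega_functor X)"

definition unit_map :: "'u::infinite ispace \<Rightarrow> 'u imap" where
  "unit_map X = (\<lambda>m q. \<lambda>x \<in> fob (fob X m) q. germ (iset_simplices X q) m x)"

text \<open>\<open>ispace_flat X\<close> is the I-space \<open>X\<^sup>\<flat>\<close>.
  On \<open>[x]\<close> with \<open>x \<in> W\<^sub>m\<close> the counit is \<open>x\<close>.\<close>

definition counit_map :: "'u::infinite mspace \<Rightarrow> 'u smap" where
  "counit_map W = (\<lambda>q. \<lambda>y \<in> colim_N (iset_simplices (fob bullet_functor W) q).
     snd (colim_rep (iset_simplices (fob bullet_functor W) q) y))"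

section \<open>The names of colimit elements are faithful\<close>

lemma inj_pair_code:
  includes cardinal_syntax
  shows "inj (pair_code :: nat \<times> 'u::infinite \<Rightarrow> 'u)"
proof -
  have inf: "infinite (UNIV :: 'u set)" by (rule infinite_UNIV)
  then have "|UNIV :: nat set| \<le>o |UNIV :: 'u set|"
    by (simp add: infinite_iff_card_of_nat)
  with inf have "|(UNIV :: nat set) \<times> (UNIV :: 'u set)| =o |UNIV :: 'u set|"
    by (intro card_of_Times_infinite[THEN conjunct2]) auto
  then have "|UNIV :: (nat \<times> 'u) set| \<le>o |UNIV :: 'u set|"
    by (simp add: ordIso_imp_ordLeq)
  then have "\<exists>c :: nat \<times> 'u \<Rightarrow> 'u. inj c"
    using card_of_ordLeq[of "UNIV :: (nat \<times> 'u) set" "UNIV :: 'u set"] by auto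
  then show ?thesis
    unfolding pair_code_def by (rule someI_ex)
qed

lemma germ_eq_iff:
  fixes Y :: "'u::infinite iset"
  assumes Y: "Y \<in> ob iset_cat" and x: "x \<in> fob Y m" and y: "y \<in> fob Y n"
  shows "germ Y m x = germ Y n y \<longleftrightarrow>
    (\<exists>p. m \<le> p \<and> n \<le> p \<and> farr Y m p (I_incl m) x = farr Y n p (I_incl n) y)"
proof -
  interpret Y: cat_functor I_cat set_cat Y
    using Y by (simp add: iset_cat_def functor_cat_def)
  define R where "R = (\<lambda>m x n y. \<exists>p. m \<le> p \<and> n \<le> p \<and>
    farr Y m p (I_incl m) x = farr Y n p (I_incl n) y)"
  have incl: "I_incl k \<in> hom I_cat k p" if "k \<le> p" for k p
    using that by (auto simp: I_cat_def I_incl_def inj_on_def)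
  have push: "farr Y k p (I_incl k) z = farr Y l p (I_incl l) (farr Y k l (I_incl k) z)"
    if "k \<le> l" "l \<le> p" "z \<in> fob Y k" for k l p z
  proof -
    have "cmp I_cat k l p (I_incl l) (I_incl k) = I_incl k"
      using that by (auto simp: I_cat_def I_incl_def compose_def restrict_def)
    with Y.farr_cmp[of k l p "I_incl k" "I_incl l"] incl that show ?thesis
      by (simp add: I_cat_def set_cat_def compose_def)
  qed
  have R_refl: "R k z k z" for k z by (auto simp: R_def)
  have R_sym: "R k z l w \<Longrightarrow> R l w k z" for k z l w by (auto simp: R_def)
  have R_trans: "R k z j v"
    if "R k z l w" "R l w j v" "z \<in> fob Y k" "w \<in> fob Y l" "v \<in> fob Y j" for k z l w j v
  proof -
    from that obtain p q where p: "k \<le> p" "l \<le> p" "farr Y k p (I_incl k) z = farr Y l p (I_incl l) w"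
      and q: "l \<le> q" "j \<le> q" "farr Y l q (I_incl l) w = farr Y j q (I_incl j) v"
      by (auto simp: R_def)
    have "farr Y k (max p q) (I_incl k) z = farr Y l (max p q) (I_incl l) w"
      using push[of k p "max p q" z] push[of l p "max p q" w] p that by simp
    also have "\<dots> = farr Y j (max p q) (I_incl j) v"
      using push[of l q "max p q" w] push[of j q "max p q" v] q that by simp
    finally show ?thesis
      using p q by (auto simp: R_def intro!: exI[of _ "max p q"])
  qed
  have cls: "colim_class Y k z = {(l, w). w \<in> fob Y l \<and> R k z l w}" for k z
    by (simp add: colim_class_def R_def)
  have some: "(SOME p. p \<in> colim_class Y k z) \<in> colim_class Y k z" if "z \<in> fob Y k" for k z
    by (rule someI[of _ "(k, z)"]) (use that R_refl in \<open>auto simp: cls\<close>)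
  have "germ Y m x = germ Y n y \<longleftrightarrow>
      (SOME p. p \<in> colim_class Y m x) = (SOME p. p \<in> colim_class Y n y)"
    unfolding germ_def by (rule inj_eq[OF inj_pair_code])
  also have "\<dots> \<longleftrightarrow> R m x n y"
  proof
    assume "(SOME p. p \<in> colim_class Y m x) = (SOME p. p \<in> colim_class Y n y)"
    then obtain l w where "(l, w) \<in> colim_class Y m x" "(l, w) \<in> colim_class Y n y"
      using some[OF x] some[OF y] by (metis surj_pair)
    then show "R m x n y"
      using R_trans R_sym x y unfolding cls by blast
  next
    assume R: "R m x n y"
    have "colim_class Y m x = colim_class Y n y"
      using R_trans[OF R] R_trans[OF R_sym[OF R]] x y unfolding cls by blast
    then show "(SOME p. p \<in> colim_class Y m x) = (SOME p. p \<in> colim_class Y n y)" by simp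
  qed
  finally show ?thesis by (simp add: R_def)
qed

end

theory Submission
  imports Defs "HOL-Library.Infinite_Set"
begin

text \<open>The heart of the matter is that in a tame \<open>M\<close>-set finite supports intersect: an injection fixing
  \<open>A \<inter> B\<close> can be moved, without changing its value on an element supported on \<open>A\<close> and on \<open>B\<close>, to
  one fixing \<open>A\<close>. Hence every element has a least finite support, injections agreeing there act
  alike, and \<open>supp (f x) = f (supp x)\<close>. So \<open>W\<^sub>\<bullet>\<close> is flat, and its colimit is the union of the
  \<open>W\<^sub>m\<close>, that is \<open>W\<close>: the counit is an isomorphism. The triangle identity then inverts
  \<open>\<eta>\<^sub>X(\<omega>)\<close>. For \<open>X\<close> flat, \<open>\<eta>\<^sub>X\<close> is injective because the structure maps are; it is surjective
  because a class supported on \<open>m\<close> and represented by \<open>x \<in> X(n)\<close> has the same image under the two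
  inclusions of \<open>n\<close> into two copies of \<open>n\<close> glued along \<open>m\<close>, so \<open>x\<close> comes from \<open>X(m)\<close>. All of this
  takes place in a fixed simplicial degree and is natural in it.\<close>

section \<open>Functor categories, elementwise\<close>

text \<open>Two obstacles shape the proof. First, \<open>M\<close> is only a monoid: a
  non-surjective injection has no left inverse in it, so \<open>f\<close> cannot be undone globally.
  But the value of \<open>f\<close> on an element of a tame set depends on \<open>f\<close> at
  finitely many points only, and on a finite set every injection agrees with a permutation of
  \<open>omega\<close>. Comparing two actions, cancelling an action and lifting along a pullback all
  go through such a permutation. Second, the constructions involve choices: a representative of a
  germ, an extension of \<alpha> to \<open>M\<close>, a bound for the image of \<open>f\<close>.
  Each choice is eliminated once, by \<open>colim_map_germ\<close>, \<open>omega_act_germ\<close>,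
  \<open>counit_mset_germ\<close> and \<open>farr_bullet\<close>; afterwards maps are evaluated on
  germs, or with any convenient extension of \<alpha>. The direction of (iii) that derives flatness
  is transport: the target of the unit is flat, and flatness passes along isomorphisms. An I-space
  is encoded as a functor from I to simplicial sets, whereas the argument wants an I-set for each
  simplicial degree; the elementwise criteria translate between the two readings.\<close>

lemma category_op_cat:
  assumes "category C" shows "category (op_cat C)"
proof -
  interpret category C by fact
  show ?thesis
    by unfold_locales (auto simp: op_cat_def idn_hom cmp_hom cmp_idn_left cmp_idn_right cmp_assoc)
qed

lemma category_full_subcat:
  assumes "category C" shows "category (full_subcat C P)"
proof -
  interpret category C by fact
  show ?thesis
    by unfold_locales (auto simp: full_subcat_def idn_hom cmp_hom cmp_idn_left cmp_idn_right cmp_assoc)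
qed

lemma compose_PiE: "f \<in> A \<rightarrow>\<^sub>E B \<Longrightarrow> g \<in> B \<rightarrow>\<^sub>E C \<Longrightarrow> compose A g f \<in> A \<rightarrow>\<^sub>E C"
  by (auto simp: compose_def)

lemma compose_PiE_Id: "f \<in> A \<rightarrow>\<^sub>E B \<Longrightarrow> compose A f (\<lambda>x\<in>A. x) = f"
  and compose_Id_PiE: "f \<in> A \<rightarrow>\<^sub>E B \<Longrightarrow> compose A (\<lambda>x\<in>B. x) f = f"
  by (auto simp: PiE_def intro: compose_Id Id_compose)

lemma compose_assoc_PiE:
  "f \<in> A \<rightarrow>\<^sub>E B \<Longrightarrow> compose A h (compose A g f) = compose A (compose B h g) f"
  by (rule compose_assoc) (simp add: PiE_def)

lemma inj_on_compose_PiE: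
  assumes "f \<in> A \<rightarrow>\<^sub>E B" "inj_on f A" "inj_on g B"
  shows "inj_on (compose A g f) A"
proof (rule inj_onI)
  fix i j assume ij: "i \<in> A" "j \<in> A" "compose A g f i = compose A g f j"
  then have "g (f i) = g (f j)" by (simp only: compose_eq)
  then have "f i = f j"
    using inj_onD[OF assms(3)] PiE_mem[OF assms(1)] ij(1,2) by blast
  then show "i = j"
    using inj_onD[OF assms(2)] ij(1,2) by blast
qed

lemma category_set_cat: "category set_cat"
  by (rule category.intro)
    (simp_all add: set_cat_def compose_PiE compose_PiE_Id compose_Id_PiE, rule compose_assoc_PiE)

lemma category_simplex_cat: "category simplex_cat"
proof
  fix x y z f g
  assume "f \<in> hom simplex_cat x y" "g \<in> hom simplex_cat y z"
  then have f: "f \<in> {0..x} \<rightarrow>\<^sub>E {0..y}" "mono_on {0..x} f"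
    and g: "g \<in> {0..y} \<rightarrow>\<^sub>E {0..z}" "mono_on {0..y} g"
    by (simp_all add: simplex_cat_def)
  have "mono_on {0..x} (compose {0..x} g f)"
    using f(2) PiE_mem[OF f(1)] g(2) by (simp add: compose_def mono_on_def)
  then show "cmp simplex_cat x y z g f \<in> hom simplex_cat x z"
    using f g by (simp add: simplex_cat_def compose_PiE)
next
  fix w x y z f g h
  assume "f \<in> hom simplex_cat w x"
  then show "cmp simplex_cat w y z h (cmp simplex_cat w x y g f) = cmp simplex_cat w x z (cmp simplex_cat x y z h g) f"
    by (auto simp: simplex_cat_def intro: compose_assoc_PiE)
qed (auto simp: simplex_cat_def compose_PiE_Id compose_Id_PiE intro: mono_onI)

lemma category_I_cat: "category I_cat"
proof
  fix x y z f g
  assume "f \<in> hom I_cat x y" "g \<in> hom I_cat y z"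
  then have f: "f \<in> {1..x} \<rightarrow>\<^sub>E {1..y}" "inj_on f {1..x}"
    and g: "g \<in> {1..y} \<rightarrow>\<^sub>E {1..z}" "inj_on g {1..y}"
    by (simp_all add: I_cat_def)
  have "inj_on (compose {1..x} g f) {1..x}"
    using f g by (intro inj_on_compose_PiE)
  then show "cmp I_cat x y z g f \<in> hom I_cat x z"
    using f g by (simp add: I_cat_def compose_PiE)
next
  fix w x y z f g h
  assume "f \<in> hom I_cat w x"
  then show "cmp I_cat w y z h (cmp I_cat w x y g f) = cmp I_cat w x z (cmp I_cat x y z h g) f"
    by (auto simp: I_cat_def intro: compose_assoc_PiE)
qed (auto simp: I_cat_def compose_PiE_Id compose_Id_PiE intro: inj_onI)

lemma category_functor_cat:
  assumes C: "category C" and D: "category D"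
  shows "category (functor_cat C D)"
proof -
  interpret C: category C by fact
  interpret D: category D by fact
  show ?thesis
  proof
    fix F assume "F \<in> ob (functor_cat C D)"
    then interpret F: cat_functor C D F by (simp add: functor_cat_def)
    have "nat_trans C D F F (\<lambda>x\<in>ob C. idn D (fob F x))"
      by unfold_locales
        (simp_all add: D.idn_hom F.fob_ob F.farr_hom D.cmp_idn_left D.cmp_idn_right)
    then show "idn (functor_cat C D) F \<in> hom (functor_cat C D) F F"
      by (simp add: functor_cat_def)
  next
    fix F G H s t
    assume s: "s \<in> hom (functor_cat C D) F G" and t: "t \<in> hom (functor_cat C D) G H"
    interpret s: nat_trans C D F G s using s by (simp add: functor_cat_def)
    interpret t: nat_trans C D G H t using t by (simp add: functor_cat_def)
    have "nat_trans C D F H (\<lambda>x\<in>ob C. cmp D (fob F x) (fob G x) (fob H x) (t x) (s x))"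
    proof unfold_locales
      fix x y f assume xy: "x \<in> ob C" "y \<in> ob C" "f \<in> hom C x y"
      note [simp] = xy s.source.fob_ob s.target.fob_ob t.target.fob_ob s.component t.component
        s.source.farr_hom s.target.farr_hom t.target.farr_hom
      have "cmp D (fob F x) (fob F y) (fob H y)
              (cmp D (fob F y) (fob G y) (fob H y) (t y) (s y)) (farr F x y f)
          = cmp D (fob F x) (fob G y) (fob H y) (t y)
              (cmp D (fob F x) (fob F y) (fob G y) (s y) (farr F x y f))"
        by (simp add: D.cmp_assoc)
      also have "\<dots> = cmp D (fob F x) (fob G x) (fob H y)
              (cmp D (fob G x) (fob G y) (fob H y) (t y) (farr G x y f)) (s x)"
        by (simp add: s.naturality D.cmp_assoc)
      also have "\<dots> = cmp D (fob F x) (fob H x) (fob H y) (farr H x y f)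
              (cmp D (fob F x) (fob G x) (fob H x) (t x) (s x))"
        by (simp add: t.naturality D.cmp_assoc)
      finally show "cmp D (fob F x) (fob F y) (fob H y)
           ((\<lambda>x\<in>ob C. cmp D (fob F x) (fob G x) (fob H x) (t x) (s x)) y) (farr F x y f) =
         cmp D (fob F x) (fob H x) (fob H y) (farr H x y f)
           ((\<lambda>x\<in>ob C. cmp D (fob F x) (fob G x) (fob H x) (t x) (s x)) x)"
        by simp
    qed (auto intro!: D.cmp_hom s.component t.component s.source.fob_ob t.target.fob_ob s.target.fob_ob)
    then show "cmp (functor_cat C D) F G H t s \<in> hom (functor_cat C D) F H"
      by (simp add: functor_cat_def)
  next
    fix F G s
    assume s: "s \<in> hom (functor_cat C D) F G"
    interpret s: nat_trans C D F G s using s by (simp add: functor_cat_def)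
    have "s \<in> extensional (ob C)" using s by (simp add: functor_cat_def)
    then show "cmp (functor_cat C D) F G G (idn (functor_cat C D) G) s = s"
      "cmp (functor_cat C D) F F G s (idn (functor_cat C D) F) = s"
      by (auto simp: functor_cat_def fun_eq_iff restrict_def extensional_def
          s.source.fob_ob s.target.fob_ob s.component D.cmp_idn_left D.cmp_idn_right)
  next
    fix F G H K r s t
    assume r: "r \<in> hom (functor_cat C D) F G" and s: "s \<in> hom (functor_cat C D) G H"
      and t: "t \<in> hom (functor_cat C D) H K"
    interpret r: nat_trans C D F G r using r by (simp add: functor_cat_def)
    interpret s: nat_trans C D G H s using s by (simp add: functor_cat_def)
    interpret t: nat_trans C D H K t using t by (simp add: functor_cat_def)
    show "cmp (functor_cat C D) F H K t (cmp (functor_cat C D) F G H s r)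
        = cmp (functor_cat C D) F G K (cmp (functor_cat C D) G H K t s) r"
      by (auto simp: functor_cat_def fun_eq_iff restrict_def D.cmp_assoc r.source.fob_ob
          r.target.fob_ob s.target.fob_ob t.target.fob_ob r.component s.component t.component)
  qed
qed

lemma cat_functor_comp:
  assumes "cat_functor C D F" "cat_functor D E G"
  shows "cat_functor C E (comp_functor G F)"
proof -
  interpret F: cat_functor C D F by fact
  interpret G: cat_functor D E G by fact
  show ?thesis
    by unfold_locales
      (simp_all add: comp_functor_def F.fob_ob G.fob_ob F.farr_hom G.farr_hom F.farr_idn G.farr_idn
        F.farr_cmp G.farr_cmp)
qed

lemma cat_functor_id: "category C \<Longrightarrow> cat_functor C C id_functor"
  by (simp add: cat_functor_def cat_functor_axioms_def id_functor_def)

text \<open>Multiplying the equation on the left by the inverse of \<open>f\<close> identifies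
  \<open>h\<close> with that inverse. With \<open>f\<close> the counit at X(\<omega>), the triangle
  identity is such an equation, and \<open>h\<close> is \<eta>_X(\<omega>).\<close>

lemma is_iso_right_inverse:
  assumes "category C" "x \<in> ob C" "y \<in> ob C" "is_iso C x y f" "h \<in> hom C y x"
    and fh: "cmp C y x y f h = idn C y"
  shows "is_iso C y x h"
proof -
  interpret category C by fact
  obtain g where f: "f \<in> hom C x y" and g: "g \<in> hom C y x"
    and gf: "cmp C x y x g f = idn C x" and fg: "cmp C y x y f g = idn C y"
    using assms(4) by (auto simp: is_iso_def)
  have "h = cmp C y x x (cmp C x y x g f) h"
    using assms by (simp add: gf cmp_idn_left)
  also have "\<dots> = g"
    using assms f g by (simp add: cmp_assoc[symmetric] fh cmp_idn_right)
  finally show ?thesis using f g gf fg by (auto simp: is_iso_def)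
qed

lemma is_iso_full_subcat [simp]: "is_iso (full_subcat C P) x y f = is_iso C x y f"
  by (simp add: is_iso_def full_subcat_def)

lemma hom_full_subcat [simp]: "hom (full_subcat C P) = hom C"
  and idn_full_subcat [simp]: "idn (full_subcat C P) = idn C"
  and cmp_full_subcat [simp]: "cmp (full_subcat C P) = cmp C"
  and ob_full_subcat [simp]: "ob (full_subcat C P) = {x \<in> ob C. P x}"
  by (simp_all add: full_subcat_def)

section \<open>The categories of simplicial sets, I-spaces and M-spaces\<close>

lemma category_sset_cat: "category sset_cat"
  unfolding sset_cat_def
  by (intro category_functor_cat category_op_cat category_simplex_cat category_set_cat)

lemma category_ispace_cat: "category ispace_cat"
  unfolding ispace_cat_def
  by (intro category_functor_cat category_I_cat category_sset_cat)

lemma category_mspace_cat: "category mspace_cat"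
proof -
  interpret S: category sset_cat by (rule category_sset_cat)
  have hom: "f \<in> hom sset_cat (msset V) (msset W)" if "f \<in> hom mspace_cat V W" for f V W
    using that by (simp add: mspace_cat_def)
  have act: "msset W \<in> ob sset_cat"
    "f \<in> M_set \<Longrightarrow> mspact W f \<in> hom sset_cat (msset W) (msset W)"
    if "W \<in> ob mspace_cat" for W f
    using that by (auto simp: mspace_cat_def is_mspace_def)
  have idn: "idn mspace_cat W = idn sset_cat (msset W)"
    and cmp: "cmp mspace_cat U V W = cmp sset_cat (msset U) (msset V) (msset W)" for U V W
    by (simp_all add: mspace_cat_def)
  show ?thesis
  proof
    fix W assume "W \<in> ob mspace_cat"
    then show "idn mspace_cat W \<in> hom mspace_cat W W"
      using act[of W]
      by (simp add: mspace_cat_def S.idn_hom S.cmp_idn_left S.cmp_idn_right)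
  next
    fix U V W f g
    assume obs: "U \<in> ob mspace_cat" "V \<in> ob mspace_cat" "W \<in> ob mspace_cat"
      and f: "f \<in> hom mspace_cat U V" and g: "g \<in> hom mspace_cat V W"
    note [simp] = obs[THEN act(1)] obs[THEN act(2)] hom[OF f] hom[OF g]
    have "cmp sset_cat (msset U) (msset U) (msset W)
        (cmp sset_cat (msset U) (msset V) (msset W) g f) (mspact U a) =
      cmp sset_cat (msset U) (msset W) (msset W) (mspact W a)
        (cmp sset_cat (msset U) (msset V) (msset W) g f)" if a: "a \<in> M_set" for a
    proof -
      have "cmp sset_cat (msset U) (msset U) (msset W)
          (cmp sset_cat (msset U) (msset V) (msset W) g f) (mspact U a) =
        cmp sset_cat (msset U) (msset V) (msset W) g
          (cmp sset_cat (msset U) (msset U) (msset V) f (mspact U a))"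
        using a by (simp add: S.cmp_assoc)
      also have "\<dots> = cmp sset_cat (msset U) (msset V) (msset W)
          (cmp sset_cat (msset V) (msset V) (msset W) g (mspact V a)) f"
        using f a by (simp add: mspace_cat_def S.cmp_assoc)
      also have "\<dots> = cmp sset_cat (msset U) (msset W) (msset W) (mspact W a)
        (cmp sset_cat (msset U) (msset V) (msset W) g f)"
        using g a by (simp add: mspace_cat_def S.cmp_assoc)
      finally show ?thesis .
    qed
    then show "cmp mspace_cat U V W g f \<in> hom mspace_cat U W"
      by (simp add: mspace_cat_def S.cmp_hom)
  qed (auto simp: idn cmp dest!: hom act(1) intro: S.cmp_idn_left S.cmp_idn_right S.cmp_assoc)
qed

section \<open>Objects and arrows described on elements\<close>

lemma extensional_eq_iff:
  "f \<in> extensional A \<Longrightarrow> g \<in> extensional A \<Longrightarrow> f = g \<longleftrightarrow> (\<forall>x\<in>A. f x = g x)"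
  by (auto intro: extensionalityI)

lemma compose_eq_compose_iff:
  "compose A g f = compose A k h \<longleftrightarrow> (\<forall>u\<in>A. g (f u) = k (h u))"
  by (auto simp: extensional_eq_iff[of _ A] compose_eq)

lemma fun_compose_eq_iff:
  "(\<lambda>q. compose (A q) (g q) (f q)) = (\<lambda>q. compose (A q) (k q) (h q)) \<longleftrightarrow>
    (\<forall>q. \<forall>u\<in>A q. g q (f q u) = k q (h q u))"
  unfolding compose_eq_compose_iff[symmetric] by (rule fun_eq_iff)

lemma I_cat_simps [simp]:
  "ob I_cat = UNIV" "idn I_cat m = (\<lambda>i\<in>{1..m}. i)" "cmp I_cat l m n g f = compose {1..l} g f"
  by (simp_all add: I_cat_def)

lemma op_simplex_cat_simps [simp]:
  "ob (op_cat simplex_cat) = UNIV" "hom (op_cat simplex_cat) q p = hom simplex_cat p q"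
  "idn (op_cat simplex_cat) q = idn simplex_cat q"
  "cmp (op_cat simplex_cat) q p r g f = cmp simplex_cat r p q f g"
  by (simp_all add: simplex_cat_def op_cat_def)

text \<open>Arrows of \<open>set_cat\<close> are extensional, so an equation between two of them is
  an equation at every element of the domain. For the opposite simplex category this describes
  simplicial sets, for \<open>I_cat\<close> it describes I-sets.\<close>

lemma ob_functor_set_iff:
  assumes "category C"
  shows "Y \<in> ob (functor_cat C set_cat) \<longleftrightarrow>
    (\<forall>x\<in>ob C. \<forall>y\<in>ob C. \<forall>f\<in>hom C x y. farr Y x y f \<in> fob Y x \<rightarrow>\<^sub>E fob Y y) \<and>
    (\<forall>x\<in>ob C. \<forall>u\<in>fob Y x. farr Y x x (idn C x) u = u) \<and>
    (\<forall>x\<in>ob C. \<forall>y\<in>ob C. \<forall>z\<in>ob C. \<forall>f\<in>hom C x y. \<forall>g\<in>hom C y z. \<forall>u\<in>fob Y x.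
       farr Y x z (cmp C x y z g f) u = farr Y y z g (farr Y x y f u))"
    (is "_ \<longleftrightarrow> ?arr \<and> ?idn \<and> ?cmp")
proof -
  interpret category C by fact
  have "Y \<in> ob (functor_cat C set_cat) \<longleftrightarrow> ?arr \<and>
    (\<forall>x\<in>ob C. farr Y x x (idn C x) = (\<lambda>u\<in>fob Y x. u)) \<and>
    (\<forall>x\<in>ob C. \<forall>y\<in>ob C. \<forall>z\<in>ob C. \<forall>f\<in>hom C x y. \<forall>g\<in>hom C y z.
       farr Y x z (cmp C x y z g f) = compose (fob Y x) (farr Y y z g) (farr Y x y f))"
    using assms category_set_cat
    by (auto simp: functor_cat_def cat_functor_def cat_functor_axioms_def set_cat_def)
  also have "\<dots> \<longleftrightarrow> ?arr \<and> ?idn \<and> ?cmp"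
  proof (intro conj_cong refl)
    \<comment> \<open>Typing comes first: it makes the values of \<open>farr Y\<close> extensional,
      without which pointwise equality would say less than equality of functions.\<close>
    assume arr: ?arr
    have "farr Y x x (idn C x) = (\<lambda>u\<in>fob Y x. u) \<longleftrightarrow> (\<forall>u\<in>fob Y x. farr Y x x (idn C x) u = u)"
      if "x \<in> ob C" for x
      using arr idn_hom[OF that] that
      by (auto intro!: PiE_ext[of "farr Y x x (idn C x)" "fob Y x" "\<lambda>_. fob Y x"])
    then show "(\<forall>x\<in>ob C. farr Y x x (idn C x) = (\<lambda>u\<in>fob Y x. u)) \<longleftrightarrow> ?idn" by simp
    have "farr Y x z (cmp C x y z g f) = compose (fob Y x) (farr Y y z g) (farr Y x y f) \<longleftrightarrow>
       (\<forall>u\<in>fob Y x. farr Y x z (cmp C x y z g f) u = farr Y y z g (farr Y x y f u))"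
      if *: "x \<in> ob C" "y \<in> ob C" "z \<in> ob C" "f \<in> hom C x y" "g \<in> hom C y z" for x y z f g
    proof -
      have "farr Y x z (cmp C x y z g f) \<in> fob Y x \<rightarrow>\<^sub>E fob Y z"
        using arr cmp_hom[OF *] * by blast
      moreover have "compose (fob Y x) (farr Y y z g) (farr Y x y f) \<in> fob Y x \<rightarrow>\<^sub>E fob Y z"
        using arr * by (intro compose_PiE[of _ _ "fob Y y"]) auto
      ultimately show ?thesis
        by (simp add: extensional_eq_iff[of _ "fob Y x"] PiE_iff compose_eq)
    qed
    then show "(\<forall>x\<in>ob C. \<forall>y\<in>ob C. \<forall>z\<in>ob C. \<forall>f\<in>hom C x y. \<forall>g\<in>hom C y z.
       farr Y x z (cmp C x y z g f) = compose (fob Y x) (farr Y y z g) (farr Y x y f)) \<longleftrightarrow> ?cmp"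
      by simp
  qed
  finally show ?thesis .
qed

lemma hom_functor_set_iff:
  assumes "category C"
  shows "t \<in> hom (functor_cat C set_cat) Y Z \<longleftrightarrow>
    Y \<in> ob (functor_cat C set_cat) \<and> Z \<in> ob (functor_cat C set_cat) \<and> t \<in> extensional (ob C) \<and>
    (\<forall>x\<in>ob C. t x \<in> fob Y x \<rightarrow>\<^sub>E fob Z x) \<and>
    (\<forall>x\<in>ob C. \<forall>y\<in>ob C. \<forall>f\<in>hom C x y. \<forall>u\<in>fob Y x.
       t y (farr Y x y f u) = farr Z x y f (t x u))"
proof -
  have "compose (fob Y x) (t y) (farr Y x y f) = compose (fob Y x) (farr Z x y f) (t x) \<longleftrightarrow>
      (\<forall>u\<in>fob Y x. t y (farr Y x y f u) = farr Z x y f (t x u))" for x y f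
    by (rule compose_eq_compose_iff)
  then have "nat_trans_axioms C set_cat Y Z t \<longleftrightarrow>
      (\<forall>x\<in>ob C. t x \<in> fob Y x \<rightarrow>\<^sub>E fob Z x) \<and>
      (\<forall>x\<in>ob C. \<forall>y\<in>ob C. \<forall>f\<in>hom C x y. \<forall>u\<in>fob Y x.
         t y (farr Y x y f u) = farr Z x y f (t x u))"
    by (auto simp: nat_trans_axioms_def set_cat_def)
  then show ?thesis
    by (auto simp: functor_cat_def nat_trans_def)
qed

lemma ob_sset_iff: "Y \<in> ob sset_cat \<longleftrightarrow>
    (\<forall>p q. \<forall>\<theta>\<in>hom simplex_cat p q. farr Y q p \<theta> \<in> fob Y q \<rightarrow>\<^sub>E fob Y p) \<and>
    (\<forall>q. \<forall>u\<in>fob Y q. farr Y q q (idn simplex_cat q) u = u) \<and>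
    (\<forall>p q r. \<forall>\<theta>\<in>hom simplex_cat p q. \<forall>\<chi>\<in>hom simplex_cat r p. \<forall>u\<in>fob Y q.
       farr Y q r (cmp simplex_cat r p q \<theta> \<chi>) u = farr Y p r \<chi> (farr Y q p \<theta> u))"
  unfolding sset_cat_def
  by (subst ob_functor_set_iff) (auto intro: category_op_cat category_simplex_cat)

lemma hom_sset_iff: "t \<in> hom sset_cat Y Z \<longleftrightarrow> Y \<in> ob sset_cat \<and> Z \<in> ob sset_cat \<and>
    (\<forall>q. t q \<in> fob Y q \<rightarrow>\<^sub>E fob Z q) \<and>
    (\<forall>p q. \<forall>\<theta>\<in>hom simplex_cat p q. \<forall>u\<in>fob Y q. t p (farr Y q p \<theta> u) = farr Z q p \<theta> (t q u))"
  unfolding sset_cat_def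
  by (subst hom_functor_set_iff) (auto intro: category_op_cat category_simplex_cat)

lemma idn_sset: "idn sset_cat Y = (\<lambda>q. \<lambda>u\<in>fob Y q. u)"
  and cmp_sset: "cmp sset_cat X Y Z s t = (\<lambda>q. compose (fob X q) (s q) (t q))"
  by (simp_all add: sset_cat_def functor_cat_def set_cat_def restrict_def)

lemma ob_iset_iff: "Y \<in> ob iset_cat \<longleftrightarrow>
    (\<forall>m n. \<forall>\<alpha>\<in>hom I_cat m n. farr Y m n \<alpha> \<in> fob Y m \<rightarrow>\<^sub>E fob Y n) \<and>
    (\<forall>m. \<forall>u\<in>fob Y m. farr Y m m (\<lambda>i\<in>{1..m}. i) u = u) \<and>
    (\<forall>l m n. \<forall>\<alpha>\<in>hom I_cat l m. \<forall>\<beta>\<in>hom I_cat m n. \<forall>u\<in>fob Y l.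
       farr Y l n (compose {1..l} \<beta> \<alpha>) u = farr Y m n \<beta> (farr Y l m \<alpha> u))"
  unfolding iset_cat_def by (subst ob_functor_set_iff) (auto intro: category_I_cat)

lemma hom_iset_iff: "t \<in> hom iset_cat Y Z \<longleftrightarrow> Y \<in> ob iset_cat \<and> Z \<in> ob iset_cat \<and>
    (\<forall>m. t m \<in> fob Y m \<rightarrow>\<^sub>E fob Z m) \<and>
    (\<forall>m n. \<forall>\<alpha>\<in>hom I_cat m n. \<forall>u\<in>fob Y m. t n (farr Y m n \<alpha> u) = farr Z m n \<alpha> (t m u))"
  unfolding iset_cat_def by (subst hom_functor_set_iff) (auto intro: category_I_cat)

lemma iset_simplices_simps [simp]:
  "fob (iset_simplices X q) m = fob (fob X m) q"
  "farr (iset_simplices X q) m n \<alpha> = farr X m n \<alpha> q"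
  by (simp_all add: iset_simplices_def)

text \<open>A functor from I to simplicial sets is a functor of two variables, which can be examined
  one variable at a time as long as the two kinds of structure maps commute. This is the passage to
  a fixed simplicial degree.\<close>

lemma ob_ispace_iff: "X \<in> ob ispace_cat \<longleftrightarrow>
    (\<forall>m. fob X m \<in> ob sset_cat) \<and> (\<forall>q. iset_simplices X q \<in> ob iset_cat) \<and>
    (\<forall>m n. \<forall>\<alpha>\<in>hom I_cat m n. \<forall>p q. \<forall>\<theta>\<in>hom simplex_cat p q. \<forall>u\<in>fob (fob X m) q.
       farr X m n \<alpha> p (farr (fob X m) q p \<theta> u) = farr (fob X n) q p \<theta> (farr X m n \<alpha> q u))"
    (is "_ \<longleftrightarrow> ?ob \<and> ?iset \<and> ?nat")
proof -
  \<comment> \<open>This typing clause comes out of the arrows being simplicial maps and reappears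
    as a clause of every I-set.\<close>
  let ?arr = "\<forall>m n. \<forall>\<alpha>\<in>hom I_cat m n. \<forall>q. farr X m n \<alpha> q \<in> fob (fob X m) q \<rightarrow>\<^sub>E fob (fob X n) q"
  have "X \<in> ob ispace_cat \<longleftrightarrow> ?ob \<and> (?arr \<and> ?nat) \<and>
      (\<forall>m. farr X m m (\<lambda>i\<in>{1..m}. i) = (\<lambda>q. \<lambda>u\<in>fob (fob X m) q. u)) \<and>
      (\<forall>l m n. \<forall>\<alpha>\<in>hom I_cat l m. \<forall>\<beta>\<in>hom I_cat m n.
        farr X l n (compose {1..l} \<beta> \<alpha>) =
          (\<lambda>q. compose (fob (fob X l) q) (farr X m n \<beta> q) (farr X l m \<alpha> q)))"
    using category_I_cat category_sset_cat
    by (auto simp: ispace_cat_def functor_cat_def cat_functor_def cat_functor_axioms_def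
        hom_sset_iff idn_sset cmp_sset del: PiE_I)
  also have "\<dots> \<longleftrightarrow> ?ob \<and> (?arr \<and> ?nat) \<and>
      (\<forall>q m. \<forall>u\<in>fob (fob X m) q. farr X m m (\<lambda>i\<in>{1..m}. i) q u = u) \<and>
      (\<forall>q l m n. \<forall>\<alpha>\<in>hom I_cat l m. \<forall>\<beta>\<in>hom I_cat m n. \<forall>u\<in>fob (fob X l) q.
        farr X l n (compose {1..l} \<beta> \<alpha>) q u = farr X m n \<beta> q (farr X l m \<alpha> q u))"
    (is "_ \<longleftrightarrow> ?ob \<and> (?arr \<and> ?nat) \<and> ?idn \<and> ?cmp")
  proof (intro conj_cong refl)
    assume arr: "?arr \<and> ?nat"
    have "farr X m m (\<lambda>i\<in>{1..m}. i) = (\<lambda>q. \<lambda>u\<in>fob (fob X m) q. u) \<longleftrightarrow>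
        (\<forall>q. \<forall>u\<in>fob (fob X m) q. farr X m m (\<lambda>i\<in>{1..m}. i) q u = u)" for m
    proof -
      have "(\<lambda>i\<in>{1..m}. i) \<in> hom I_cat m m"
        using category.idn_hom[OF category_I_cat, of m] by simp
      then have "farr X m m (\<lambda>i\<in>{1..m}. i) q \<in> extensional (fob (fob X m) q)" for q
        using arr by (auto simp: PiE_def)
      then show ?thesis by (fastforce simp: fun_eq_iff restrict_def extensional_def)
    qed
    then show "(\<forall>m. farr X m m (\<lambda>i\<in>{1..m}. i) = (\<lambda>q. \<lambda>u\<in>fob (fob X m) q. u)) \<longleftrightarrow> ?idn"
      by blast
    have "farr X l n (compose {1..l} \<beta> \<alpha>) =
          (\<lambda>q. compose (fob (fob X l) q) (farr X m n \<beta> q) (farr X l m \<alpha> q)) \<longleftrightarrow>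
        (\<forall>q. \<forall>u\<in>fob (fob X l) q.
          farr X l n (compose {1..l} \<beta> \<alpha>) q u = farr X m n \<beta> q (farr X l m \<alpha> q u))"
      if "\<alpha> \<in> hom I_cat l m" "\<beta> \<in> hom I_cat m n" for l m n \<alpha> \<beta>
    proof -
      have "compose {1..l} \<beta> \<alpha> \<in> hom I_cat l n"
        using category.cmp_hom[OF category_I_cat, of l m n \<alpha> \<beta>] that by simp
      then have "farr X l n (compose {1..l} \<beta> \<alpha>) q \<in> extensional (fob (fob X l) q)" for q
        using arr by (auto simp: PiE_def)
      then show ?thesis by (fastforce simp: fun_eq_iff compose_def restrict_def extensional_def)
    qed
    then show "(\<forall>l m n. \<forall>\<alpha>\<in>hom I_cat l m. \<forall>\<beta>\<in>hom I_cat m n.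
        farr X l n (compose {1..l} \<beta> \<alpha>) =
          (\<lambda>q. compose (fob (fob X l) q) (farr X m n \<beta> q) (farr X l m \<alpha> q))) \<longleftrightarrow> ?cmp"
      by blast
  qed
  also have "\<dots> \<longleftrightarrow> ?ob \<and> ?iset \<and> ?nat"
    unfolding ob_iset_iff iset_simplices_simps by (auto del: PiE_I)
  finally show ?thesis .
qed

text \<open>Naturality in \<theta> is part of \<open>\<phi> m\<close> being a simplicial map, and
  naturality in \<alpha> is that of the I-set maps in each degree; together they exhaust the
  conditions.\<close>

lemma hom_ispace_iff: "\<phi> \<in> hom ispace_cat X Z \<longleftrightarrow> X \<in> ob ispace_cat \<and> Z \<in> ob ispace_cat \<and>
    (\<forall>q. (\<lambda>m. \<phi> m q) \<in> hom iset_cat (iset_simplices X q) (iset_simplices Z q)) \<and>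
    (\<forall>m. \<phi> m \<in> hom sset_cat (fob X m) (fob Z m))"
    (is "_ \<longleftrightarrow> ?X \<and> ?Z \<and> ?iset \<and> ?sset")
proof -
  let ?nat = "\<forall>m n. \<forall>\<alpha>\<in>hom I_cat m n.
    (\<lambda>q. compose (fob (fob X m) q) (\<phi> n q) (farr X m n \<alpha> q)) =
    (\<lambda>q. compose (fob (fob X m) q) (farr Z m n \<alpha> q) (\<phi> m q))"
  have "\<phi> \<in> hom ispace_cat X Z \<longleftrightarrow> ?X \<and> ?Z \<and> ?sset \<and> ?nat"
    by (auto simp: ispace_cat_def functor_cat_def nat_trans_def nat_trans_axioms_def cmp_sset)
  also have "\<dots> \<longleftrightarrow> ?X \<and> ?Z \<and> ?iset \<and> ?sset"
  proof (rule conj_cong[OF refl], rule conj_cong[OF refl])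
    assume X: ?X and Z: ?Z
    have "?nat \<longleftrightarrow> (\<forall>q m n. \<forall>\<alpha>\<in>hom I_cat m n. \<forall>u\<in>fob (fob X m) q.
        \<phi> n q (farr X m n \<alpha> q u) = farr Z m n \<alpha> q (\<phi> m q u))"
      unfolding fun_compose_eq_iff by blast
    then show "?sset \<and> ?nat \<longleftrightarrow> ?iset \<and> ?sset"
      using X Z by (auto simp: hom_iset_iff hom_sset_iff ob_ispace_iff del: PiE_I)
  qed
  finally show ?thesis .
qed

lemma idn_ispace: "idn ispace_cat X = (\<lambda>m q. \<lambda>u\<in>fob (fob X m) q. u)"
  and cmp_ispace: "cmp ispace_cat X Y Z s t = (\<lambda>m q. compose (fob (fob X m) q) (s m q) (t m q))"
  by (simp_all add: ispace_cat_def functor_cat_def idn_sset cmp_sset restrict_def)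

lemma mset_simplices_simps [simp]:
  "mcar (mset_simplices W q) = fob (msset W) q"
  "mact (mset_simplices W q) f = mspact W f q"
  by (simp_all add: mset_simplices_def)

lemma M_set_idn: "(\<lambda>i\<in>omega. i) \<in> M_set"
  by (auto simp: M_set_def inj_on_def)

lemma M_set_compose:
  assumes "f \<in> M_set" "g \<in> M_set" shows "compose omega f g \<in> M_set"
proof -
  have "inj_on (compose omega f g) omega"
    using assms by (intro inj_on_compose_PiE[of _ _ omega]) (simp_all add: M_set_def)
  then show ?thesis
    using assms by (auto simp: M_set_def intro: compose_PiE del: PiE_I)
qed

text \<open>\<open>is_mset\<close> says nothing about values outside the carrier. The extensionality
  clause restores what \<open>hom sset_cat\<close> demands, so that equations between arrows become
  equations on simplices.\<close>

lemma ob_mspace_iff: "W \<in> ob mspace_cat \<longleftrightarrow>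
    msset W \<in> ob sset_cat \<and> (\<forall>q. is_mset (mset_simplices W q)) \<and>
    (\<forall>f\<in>M_set. \<forall>q. mspact W f q \<in> extensional (fob (msset W) q)) \<and>
    (\<forall>f\<in>M_set. \<forall>p q. \<forall>\<theta>\<in>hom simplex_cat p q. \<forall>u\<in>fob (msset W) q.
       mspact W f p (farr (msset W) q p \<theta> u) = farr (msset W) q p \<theta> (mspact W f q u))"
    (is "_ \<longleftrightarrow> ?ob \<and> ?mset \<and> ?ext \<and> ?nat")
proof -
  let ?map = "\<forall>f\<in>M_set. \<forall>q. \<forall>u\<in>fob (msset W) q. mspact W f q u \<in> fob (msset W) q"
  have "W \<in> ob mspace_cat \<longleftrightarrow> ?ob \<and> (?map \<and> ?ext \<and> ?nat) \<and>
      mspact W (\<lambda>i\<in>omega. i) = (\<lambda>q. \<lambda>u\<in>fob (msset W) q. u) \<and>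
      (\<forall>f\<in>M_set. \<forall>g\<in>M_set. mspact W (compose omega f g) =
         (\<lambda>q. compose (fob (msset W) q) (mspact W f q) (mspact W g q)))"
    by (auto simp: mspace_cat_def is_mspace_def hom_sset_iff PiE_def Pi_def idn_sset cmp_sset)
  also have "\<dots> \<longleftrightarrow> ?ob \<and> (?map \<and> ?ext \<and> ?nat) \<and>
      (\<forall>q. \<forall>u\<in>fob (msset W) q. mspact W (\<lambda>i\<in>omega. i) q u = u) \<and>
      (\<forall>q. \<forall>f\<in>M_set. \<forall>g\<in>M_set. \<forall>u\<in>fob (msset W) q.
         mspact W (compose omega f g) q u = mspact W f q (mspact W g q u))"
    (is "_ \<longleftrightarrow> _ \<and> _ \<and> ?idn \<and> ?cmp")
  proof (intro conj_cong refl)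
    assume arr: "?map \<and> ?ext \<and> ?nat"
    then have "mspact W (\<lambda>i\<in>omega. i) q \<in> extensional (fob (msset W) q)" for q
      using M_set_idn by blast
    then show "mspact W (\<lambda>i\<in>omega. i) = (\<lambda>q. \<lambda>u\<in>fob (msset W) q. u) \<longleftrightarrow> ?idn"
      by (fastforce simp: fun_eq_iff restrict_def extensional_def)
    have "mspact W (compose omega f g) =
         (\<lambda>q. compose (fob (msset W) q) (mspact W f q) (mspact W g q)) \<longleftrightarrow>
        (\<forall>q. \<forall>u\<in>fob (msset W) q.
           mspact W (compose omega f g) q u = mspact W f q (mspact W g q u))"
      if "f \<in> M_set" "g \<in> M_set" for f g
    proof -
      have "mspact W (compose omega f g) q \<in> extensional (fob (msset W) q)" for q
        using arr M_set_compose[OF that] by blast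
      then show ?thesis by (fastforce simp: fun_eq_iff compose_def restrict_def extensional_def)
    qed
    then show "(\<forall>f\<in>M_set. \<forall>g\<in>M_set. mspact W (compose omega f g) =
         (\<lambda>q. compose (fob (msset W) q) (mspact W f q) (mspact W g q))) \<longleftrightarrow> ?cmp"
      by blast
  qed
  also have "\<dots> \<longleftrightarrow> ?ob \<and> ?mset \<and> ?ext \<and> ?nat"
    unfolding is_mset_def mset_simplices_simps by blast
  finally show ?thesis .
qed

lemma hom_mspace_iff: "\<phi> \<in> hom mspace_cat V W \<longleftrightarrow> \<phi> \<in> hom sset_cat (msset V) (msset W) \<and>
    (\<forall>f\<in>M_set. \<forall>q. \<forall>u\<in>fob (msset V) q. \<phi> q (mspact V f q u) = mspact W f q (\<phi> q u))"
  by (auto simp: mspace_cat_def cmp_sset fun_compose_eq_iff)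

lemma idn_mspace: "idn mspace_cat W = (\<lambda>q. \<lambda>u\<in>fob (msset W) q. u)"
  and cmp_mspace:
    "cmp mspace_cat U V W s t = (\<lambda>q. compose (fob (msset U) q) (s q) (t q))"
  by (simp_all add: mspace_cat_def idn_sset cmp_sset)

section \<open>Supports in tame M-sets\<close>

lemma atLeastAtMost_subset_omega: "{1..m} \<subseteq> omega"
  by (auto simp: omega_def)

lemma finite_subset_omega_bounded:
  assumes "finite A" "A \<subseteq> omega"
  obtains m where "A \<subseteq> {1..m}"
proof
  \<comment> \<open>The inserted 0 takes care of the empty set, for which the bound becomes
    0.\<close>
  show "A \<subseteq> {1..Max (insert 0 A)}"
    using assms by (auto simp: omega_def)
qed

text \<open>The complements of \<open>A\<close> and of its image are infinite subsets of
  \<open>omega\<close>, hence in bijection, and any such bijection completes \<alpha> to a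
  permutation. This is the substitute for inverses in \<open>M\<close>: where \<open>f\<close> has
  to be undone, it is replaced by a permutation agreeing with it on a finite set.\<close>

lemma extend_to_M_unit:
  assumes "finite A" "A \<subseteq> omega" "\<alpha> ` A \<subseteq> omega" "inj_on \<alpha> A"
  obtains f g where "f \<in> M_set" "g \<in> M_set" "\<And>i. i \<in> A \<Longrightarrow> f i = \<alpha> i"
    "compose omega g f = (\<lambda>i\<in>omega. i)" "compose omega f g = (\<lambda>i\<in>omega. i)"
proof -
  have inf: "infinite omega" by (simp add: omega_def infinite_Ici)
  define B where "B = omega - A"
  define B' where "B' = omega - \<alpha> ` A"
  have "infinite B" "infinite B'"
    using inf assms by (auto simp: B_def B'_def Diff_infinite_finite)
  \<comment> \<open>An infinite set of naturals is enumerated by all of \<open>nat\<close>, so the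
    two complements can be matched through their enumerations.\<close>
  then obtain k where "bij_betw k B B'"
    using bij_betw_trans[OF bij_betw_inv_into] bij_enumerate by metis
  moreover have "bij_betw \<alpha> A (\<alpha> ` A)" using assms by (simp add: bij_betw_def)
  ultimately have "bij_betw (\<lambda>i. if i \<in> A then \<alpha> i else k i)
      (A \<union> B) (\<alpha> ` A \<union> B')"
    by (intro bij_betw_disjoint_Un) (auto simp: B_def B'_def)
  moreover have "A \<union> B = omega" "\<alpha> ` A \<union> B' = omega"
    using assms by (auto simp: B_def B'_def)
  ultimately obtain h where h: "bij_betw h omega omega" "\<And>i. i \<in> A \<Longrightarrow> h i = \<alpha> i"
    by (intro that[of "\<lambda>i. if i \<in> A then \<alpha> i else k i"]) simp_all
  define f where "f = restrict h omega"
  define g where "g = restrict (inv_into omega h) omega"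
  have h': "bij_betw (inv_into omega h) omega omega"
    by (rule bij_betw_inv_into[OF h(1)])
  show thesis
  proof
    show "f \<in> M_set" "g \<in> M_set"
      using h(1) h' by (auto simp: M_set_def f_def g_def bij_betw_def)
    show "f i = \<alpha> i" if "i \<in> A" for i
      using that h(2) assms(2) by (auto simp: f_def)
    show "compose omega g f = (\<lambda>i\<in>omega. i)"
      using h(1) bij_betw_apply[OF h(1)]
      by (auto simp: compose_def f_def g_def fun_eq_iff bij_betw_inv_into_left)
    show "compose omega f g = (\<lambda>i\<in>omega. i)"
      using h(1) bij_betw_apply[OF h']
      by (auto simp: compose_def f_def g_def fun_eq_iff bij_betw_inv_into_right)
  qed
qed

lemma M_set_mem: "f \<in> M_set \<Longrightarrow> i \<in> omega \<Longrightarrow> f i \<in> omega"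
  by (auto simp: M_set_def)

lemma M_set_inj: "f \<in> M_set \<Longrightarrow> i \<in> omega \<Longrightarrow> j \<in> omega \<Longrightarrow> f i = f j \<longleftrightarrow> i = j"
  by (auto simp: M_set_def inj_on_eq_iff)

lemma mact_mem: "is_mset W \<Longrightarrow> f \<in> M_set \<Longrightarrow> x \<in> mcar W \<Longrightarrow> mact W f x \<in> mcar W"
  and mact_idn: "is_mset W \<Longrightarrow> x \<in> mcar W \<Longrightarrow> mact W (\<lambda>i\<in>omega. i) x = x"
  and mact_compose: "is_mset W \<Longrightarrow> f \<in> M_set \<Longrightarrow> g \<in> M_set \<Longrightarrow> x \<in> mcar W \<Longrightarrow>
    mact W (compose omega f g) x = mact W f (mact W g x)"
  by (auto simp: is_mset_def)

text \<open>Support on \<open>A\<close> only concerns maps that fix \<open>A\<close>. To compare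
  \<open>f\<close> with \<open>g\<close>, take a permutation \<open>h\<close> with inverse
  \<open>h'\<close> that agrees with both on \<open>A\<close>. For \<open>k\<close> either of the
  two, the composite of \<open>h'\<close> after \<open>k\<close> fixes \<open>A\<close>, and
  composing it with \<open>h\<close> gives \<open>k\<close> back; so \<open>k\<close> acts on
  \<open>x\<close> as \<open>h\<close> does.\<close>

lemma mact_cong_supported:
  assumes W: "is_mset W" "x \<in> mcar W" and A: "finite A" "A \<subseteq> omega" "supported_on W x A"
    and f: "f \<in> M_set" and g: "g \<in> M_set" and eq: "\<And>i. i \<in> A \<Longrightarrow> f i = g i"
  shows "mact W f x = mact W g x"
proof -
  have "f ` A \<subseteq> omega" "inj_on f A"
    using f A(2) by (auto simp: M_set_def intro: inj_on_subset)
  then obtain h h' where h: "h \<in> M_set" "h' \<in> M_set" "\<And>i. i \<in> A \<Longrightarrow> h i = f i"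
    "compose omega h' h = (\<lambda>i\<in>omega. i)" "compose omega h h' = (\<lambda>i\<in>omega. i)"
    using extend_to_M_unit[of A f] A by metis
  have "mact W k x = mact W h x" if k: "k \<in> M_set" "\<And>i. i \<in> A \<Longrightarrow> k i = f i" for k
  proof -
    have "compose omega h' k i = i" if "i \<in> A" for i
    proof -
      have "i \<in> omega" using that A(2) by blast
      then show ?thesis
        using h(3)[OF that] k(2)[OF that] fun_cong[OF h(4), of i] by (simp add: compose_def)
    qed
    then have "mact W (compose omega h' k) x = x"
      using A(3) M_set_compose[OF h(2) k(1)] by (simp add: supported_on_def)
    then have "mact W h x = mact W (compose omega h (compose omega h' k)) x"
      using W h k by (simp add: mact_compose M_set_compose)
    also have "compose omega h (compose omega h' k) = compose omega (compose omega h h') k"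
      using k by (intro compose_assoc_PiE[of _ _ omega]) (simp add: M_set_def)
    also have "\<dots> = k"
      unfolding h(5) using k(1) by (intro compose_Id_PiE) (simp add: M_set_def)
    finally show ?thesis by simp
  qed
  from this[OF f] this[OF g] eq show ?thesis by simp
qed

lemma supported_on_Int:
  assumes W: "is_mset W" "x \<in> mcar W"
    and A: "finite A" "A \<subseteq> omega" "supported_on W x A"
    and B: "finite B" "B \<subseteq> omega" "supported_on W x B"
  shows "supported_on W x (A \<inter> B)"
  unfolding supported_on_def
proof (intro ballI impI)
  fix f assume f: "f \<in> M_set" and fix_AB: "\<forall>i\<in>A \<inter> B. f i = i"
  text \<open>Shift the complement of \<open>A\<close> so far that \<open>f\<close> maps it away from \<open>A\<close>. The result \<open>t\<close> fixes
    \<open>A\<close> and agrees on \<open>B\<close> with \<open>f \<circ> s\<close>, where the shift \<open>s\<close> fixes \<open>A\<close>.\<close>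
  have "finite {j \<in> omega. f j \<in> A}"
    using f A(1) by (intro finite_inverse_image_gen[of A f omega, unfolded]) (auto simp: M_set_def)
  then have "finite (A \<union> {j \<in> omega. f j \<in> A})" using A by simp
  then obtain N where N: "\<And>j. j \<in> A \<union> {j \<in> omega. f j \<in> A} \<Longrightarrow> j \<le> N"
    using finite_nat_set_iff_bounded_le by metis
  \<comment> \<open>Elements of \<open>omega\<close> are at least 1, so \<open>i + N\<close> exceeds
    \<open>N\<close> strictly and avoids both finite sets.\<close>
  have far: "i + N \<notin> A" "i + N \<in> omega" "f (i + N) \<notin> A" "f (i + N) \<in> omega" if "i \<in> omega" for i
    using N[of "i + N"] that M_set_mem[OF f, of "i + N"] by (auto simp: omega_def)
  define s where "s = (\<lambda>i\<in>omega. if i \<in> A then i else i + N)"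
  define t where "t = (\<lambda>i\<in>omega. if i \<in> A then i else f (i + N))"
  have s: "s \<in> M_set"
    using far A(2) by (auto simp: s_def M_set_def inj_on_def)
  have "inj_on t omega"
  proof (rule inj_onI)
    fix i j assume "i \<in> omega" "j \<in> omega" "t i = t j"
    then show "i = j"
      using far[of i] far[of j] M_set_inj[OF f, of "i + N" "j + N"]
      by (auto simp: t_def split: if_splits)
  qed
  then have t: "t \<in> M_set"
    using far by (auto simp: t_def M_set_def)
  have "\<forall>i\<in>A. s i = i" "\<forall>i\<in>A. t i = i"
    using A(2) by (auto simp: s_def t_def)
  then have sx: "mact W s x = x" and tx: "mact W t x = x"
    using A(3) s t by (auto simp: supported_on_def)
  have "mact W f x = mact W f (mact W s x)"
    by (simp only: sx)
  also have "\<dots> = mact W (compose omega f s) x"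
    using W f s by (simp add: mact_compose)
  \<comment> \<open>On \<open>A \<inter> B\<close> both maps are the identity, because
    \<open>f\<close> fixes these points; on \<open>B - A\<close> both send \<open>i\<close> to
    \<open>f (i + N)\<close>. They may differ on \<open>A - B\<close>, so it is the support on
    \<open>B\<close> that is used here.\<close>
  also have "\<dots> = mact W t x"
    using fix_AB B(2) A(2)
    by (intro mact_cong_supported[OF W B M_set_compose[OF f s] t]) (auto simp: compose_def s_def t_def)
  also note tx
  finally show "mact W f x = x" .
qed

lemma supp_subset: "A \<subseteq> omega \<Longrightarrow> finite A \<Longrightarrow> supported_on W x A \<Longrightarrow> supp W x \<subseteq> A"
  by (auto simp: supp_def)

text \<open>\<open>supp\<close> intersects infinitely many sets, while
  \<open>supported_on_Int\<close> handles two. A finite supporting set \<open>A\<close> of least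
  cardinality bridges the gap: \<open>A \<inter> B\<close> is again supporting and has no fewer
  elements, so \<open>A\<close> lies in every finite supporting \<open>B\<close>, and the
  intersection is attained at \<open>A\<close>.\<close>

lemma tame_supp:
  assumes "tame_mset W" "x \<in> mcar W"
  shows finite_supp: "finite (supp W x)" and supp_subset_omega: "supp W x \<subseteq> omega"
    and supported_on_supp: "supported_on W x (supp W x)"
proof -
  define S where "S = {A. A \<subseteq> omega \<and> finite A \<and> supported_on W x A}"
  have W: "is_mset W" and "S \<noteq> {}" using assms by (auto simp: tame_mset_def S_def)
  then obtain A where A: "A \<in> S" and min: "\<And>B. B \<in> S \<Longrightarrow> card A \<le> card B"
    using ex_has_least_nat[of "\<lambda>A. A \<in> S" _ card] by blast
  have "A \<subseteq> B" if B: "B \<in> S" for B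
  proof -
    have "A \<inter> B \<in> S"
      using A B supported_on_Int[OF W assms(2), of A B] by (auto simp: S_def)
    from min[OF this] have "A \<inter> B = A"
      using A by (intro card_seteq) (auto simp: S_def)
    then show ?thesis by blast
  qed
  then have "\<Inter>S = A" using A by blast
  then have "supp W x = A" using A by (auto simp: supp_def S_def)
  then show "finite (supp W x)" "supp W x \<subseteq> omega" "supported_on W x (supp W x)"
    using A by (auto simp: S_def)
qed

lemma mact_cong:
  assumes "tame_mset W" "x \<in> mcar W" "f \<in> M_set" "g \<in> M_set" "\<And>i. i \<in> supp W x \<Longrightarrow> f i = g i"
  shows "mact W f x = mact W g x"
  using assms tame_supp[OF assms(1,2)]
  by (intro mact_cong_supported[of W x "supp W x"]) (auto simp: tame_mset_def)

text \<open>If \<open>g\<close> fixes the image of the support under \<open>f\<close>, then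
  \<open>f\<close> and its composite with \<open>g\<close> agree on the support, so they act alike
  on \<open>x\<close>.\<close>

lemma supp_mact_subset:
  assumes W: "tame_mset W" "x \<in> mcar W" and f: "f \<in> M_set"
  shows "supp W (mact W f x) \<subseteq> f ` supp W x"
proof (rule supp_subset)
  note supp = tame_supp[OF W]
  show "f ` supp W x \<subseteq> omega" "finite (f ` supp W x)"
    using supp M_set_mem[OF f] by auto
  show "supported_on W (mact W f x) (f ` supp W x)"
    unfolding supported_on_def
  proof (intro ballI impI)
    fix g assume g: "g \<in> M_set" "\<forall>i\<in>f ` supp W x. g i = i"
    then have "mact W (compose omega g f) x = mact W f x"
      using supp by (intro mact_cong[OF W M_set_compose[OF g(1) f] f]) (auto simp: compose_def)
    then show "mact W g (mact W f x) = mact W f x"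
      using W f g by (simp add: mact_compose tame_mset_def)
  qed
qed

text \<open>A left inverse of \<open>f\<close> in \<open>M\<close> would be injective and
  surjective, so a non-surjective \<open>f\<close> has none. The map obtained here undoes
  \<open>f\<close> on a prescribed finite set only; \<open>A\<close> is left free so that two
  elements can be treated at once.\<close>

lemma mact_left_inverse:
  assumes W: "tame_mset W" "x \<in> mcar W" and f: "f \<in> M_set" and A: "finite A" "supp W x \<subseteq> A" "A \<subseteq> omega"
  obtains g where "g \<in> M_set" "mact W g (mact W f x) = x" "\<And>i. i \<in> A \<Longrightarrow> g (f i) = i"
proof -
  have "f ` A \<subseteq> omega" "inj_on f A"
    using f A by (auto simp: M_set_def intro: inj_on_subset)
  then obtain h g where h: "h \<in> M_set" "g \<in> M_set" "\<And>i. i \<in> A \<Longrightarrow> h i = f i"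
    "compose omega g h = (\<lambda>i\<in>omega. i)"
    using extend_to_M_unit[of A f] A by metis
  have "mact W f x = mact W h x"
    using h A(2) by (intro mact_cong[OF W f]) auto
  then have "mact W g (mact W f x) = mact W (compose omega g h) x"
    using W h(1,2) by (simp add: mact_compose tame_mset_def)
  also have "\<dots> = x"
    unfolding h(4) using W by (simp add: mact_idn tame_mset_def)
  finally have "mact W g (mact W f x) = x" .
  moreover have "g (f i) = i" if "i \<in> A" for i
  proof -
    have "i \<in> omega" using that A by blast
    then show ?thesis using fun_cong[OF h(4), of i] h(3)[OF that] by (simp add: compose_def)
  qed
  ultimately show ?thesis using h(2) that by blast
qed

lemma mact_inj:
  assumes W: "tame_mset W" "x \<in> mcar W" "y \<in> mcar W" and f: "f \<in> M_set"
    and eq: "mact W f x = mact W f y"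
  shows "x = y"
proof -
  \<comment> \<open>A single map undoing \<open>f\<close> on both supports recovers \<open>x\<close>
    and \<open>y\<close> simultaneously.\<close>
  define A where "A = supp W x \<union> supp W y"
  have A: "finite A" "A \<subseteq> omega"
    using tame_supp[OF W(1,2)] tame_supp[OF W(1,3)] by (auto simp: A_def)
  obtain g where g: "g \<in> M_set" "mact W g (mact W f x) = x" "\<And>i. i \<in> A \<Longrightarrow> g (f i) = i"
    using mact_left_inverse[OF W(1,2) f A(1) _ A(2)] by (auto simp: A_def)
  have "mact W (compose omega g f) y = mact W (\<lambda>i\<in>omega. i) y"
    using g A by (intro mact_cong[OF W(1,3) M_set_compose[OF g(1) f] M_set_idn])
      (auto simp: compose_def A_def)
  then have "mact W g (mact W f y) = y"
    using W f g by (simp add: mact_compose mact_idn tame_mset_def)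
  with g(2) eq show ?thesis by simp
qed

text \<open>For the reverse inclusion the upper bound is applied a second time, to a map
  \<open>g\<close> bringing the image of \<open>x\<close> back to \<open>x\<close>: every
  \<open>i\<close> in the support of \<open>x\<close> is \<open>g j\<close> with \<open>j\<close> in
  the support of the image, and injectivity of \<open>g\<close> identifies \<open>j\<close> with
  \<open>f i\<close>.\<close>

lemma supp_mact:
  assumes W: "tame_mset W" "x \<in> mcar W" and f: "f \<in> M_set"
  shows "supp W (mact W f x) = f ` supp W x"
proof
  show "supp W (mact W f x) \<subseteq> f ` supp W x" by (rule supp_mact_subset[OF assms])
  obtain g where g: "g \<in> M_set" "mact W g (mact W f x) = x" "\<And>i. i \<in> supp W x \<Longrightarrow> g (f i) = i"
    using mact_left_inverse[OF W f finite_supp[OF W] subset_refl supp_subset_omega[OF W]] by blast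
  have fx: "mact W f x \<in> mcar W" using W f by (simp add: mact_mem tame_mset_def)
  have "supp W x \<subseteq> g ` supp W (mact W f x)"
    using supp_mact_subset[OF W(1) fx g(1)] g(2) by simp
  show "f ` supp W x \<subseteq> supp W (mact W f x)"
  proof safe
    fix i assume i: "i \<in> supp W x"
    then obtain j where j: "j \<in> supp W (mact W f x)" "i = g j"
      using \<open>supp W x \<subseteq> g ` supp W (mact W f x)\<close> by blast
    have "j \<in> omega" "f i \<in> omega"
      using j supp_subset_omega[OF W(1) fx] supp_subset_omega[OF W] i M_set_mem[OF f] by auto
    then have "j = f i"
      using g(3)[OF i] j(2) M_set_inj[OF g(1), of j "f i"] by simp
    then show "f i \<in> supp W (mact W f x)" using j by simp
  qed
qed

text \<open>Covers the simplicial operators of an M-space, the components of a morphism, the maps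
  between colimits and the counit alike, each in one degree.\<close>

definition equivariant :: "'u mset_data \<Rightarrow> 'u mset_data \<Rightarrow> ('u \<Rightarrow> 'u) \<Rightarrow> bool" where
  "equivariant V W \<phi> \<longleftrightarrow> \<phi> \<in> mcar V \<rightarrow> mcar W \<and>
     (\<forall>f\<in>M_set. \<forall>x\<in>mcar V. \<phi> (mact V f x) = mact W f (\<phi> x))"

text \<open>A map acting trivially on \<open>x\<close> acts trivially on \<open>\<phi> x\<close>.
  Hence \<open>\<phi>\<close> restricts to the subsets of bounded support, which makes
  \<open>W\<^sub>\<bullet>\<close> functorial in \<open>W\<close>.\<close>

lemma supp_equivariant:
  assumes "tame_mset V" "equivariant V W \<phi>" "x \<in> mcar V"
  shows "supp W (\<phi> x) \<subseteq> supp V x"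
proof (rule supp_subset)
  note supp = tame_supp[OF assms(1,3)]
  show "supp V x \<subseteq> omega" "finite (supp V x)" using supp by auto
  show "supported_on W (\<phi> x) (supp V x)"
    using supp(3) assms(2,3) unfolding supported_on_def equivariant_def by metis
qed

lemma hom_I_iff: "\<alpha> \<in> hom I_cat m n \<longleftrightarrow> \<alpha> \<in> {1..m} \<rightarrow>\<^sub>E {1..n} \<and> inj_on \<alpha> {1..m}"
  by (simp add: I_cat_def)

lemma hom_I_mem: "\<alpha> \<in> hom I_cat m n \<Longrightarrow> i \<in> {1..m} \<Longrightarrow> \<alpha> i \<in> {1..n}"
  unfolding hom_I_iff by (blast dest: PiE_mem)

lemma I_incl_hom: "m \<le> n \<Longrightarrow> I_incl m \<in> hom I_cat m n"
  by (auto simp: hom_I_iff I_incl_def inj_on_def)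

lemma M_extension:
  assumes "\<alpha> \<in> hom I_cat m n"
  shows M_extension_mem: "M_extension m \<alpha> \<in> M_set"
    and M_extension_eq: "i \<in> {1..m} \<Longrightarrow> M_extension m \<alpha> i = \<alpha> i"
proof -
  have "\<alpha> ` {1..m} \<subseteq> omega" "inj_on \<alpha> {1..m}"
    using assms by (auto simp: hom_I_iff omega_def)
  then obtain f where "f \<in> M_set" "\<And>i. i \<in> {1..m} \<Longrightarrow> f i = \<alpha> i"
    using extend_to_M_unit[OF finite_atLeastAtMost atLeastAtMost_subset_omega] by metis
  then have "\<exists>f. f \<in> M_set \<and> (\<forall>i\<in>{1..m}. f i = \<alpha> i)" by blast
  then have "M_extension m \<alpha> \<in> M_set \<and> (\<forall>i\<in>{1..m}. M_extension m \<alpha> i = \<alpha> i)"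
    unfolding M_extension_def by (rule someI_ex)
  then show "M_extension m \<alpha> \<in> M_set" "i \<in> {1..m} \<Longrightarrow> M_extension m \<alpha> i = \<alpha> i"
    by blast+
qed

section \<open>The I-set of a tame M-set\<close>

lemma fob_bullet [simp]: "fob (bullet_iset W) m = {x \<in> mcar W. supp W x \<subseteq> {1..m}}"
  by (simp add: bullet_iset_def)

text \<open>Elements supported in {1..m} do not distinguish maps that agree there. So the chosen
  \<open>M_extension\<close> gives way to any extension of \<alpha>: to the identity of
  \<open>omega\<close> for an inclusion, to a composite of extensions for a composite.\<close>

lemma farr_bullet:
  assumes W: "tame_mset W" and \<alpha>: "\<alpha> \<in> hom I_cat m n" and f: "f \<in> M_set" "\<And>i. i \<in> {1..m} \<Longrightarrow> f i = \<alpha> i"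
    and x: "x \<in> fob (bullet_iset W) m"
  shows "farr (bullet_iset W) m n \<alpha> x = mact W f x"
proof -
  have "mact W (M_extension m \<alpha>) x = mact W f x"
  proof (rule mact_cong[OF W _ M_extension_mem[OF \<alpha>] f(1)])
    show "x \<in> mcar W" using x by simp
    fix i assume "i \<in> supp W x"
    then have "i \<in> {1..m}" using x by auto
    then show "M_extension m \<alpha> i = f i" using M_extension_eq[OF \<alpha>] f(2) by simp
  qed
  then show ?thesis using x by (simp add: bullet_iset_def)
qed

lemma mact_mem_bullet:
  assumes W: "tame_mset W" and f: "f \<in> M_set" "f ` {1..m} \<subseteq> {1..n}" and x: "x \<in> fob (bullet_iset W) m"
  shows "mact W f x \<in> fob (bullet_iset W) n"
proof -
  have x': "x \<in> mcar W" "supp W x \<subseteq> {1..m}" using x by auto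
  have "f ` supp W x \<subseteq> {1..n}" using x'(2) f(2) by blast
  then show ?thesis
    using W f x' by (simp add: supp_mact mact_mem tame_mset_def)
qed

lemma bullet_iset_ob:
  assumes W: "tame_mset W" shows "bullet_iset W \<in> ob iset_cat"
proof -
  have ext: "M_extension m \<alpha> ` {1..m} \<subseteq> {1..n}" if "\<alpha> \<in> hom I_cat m n" for m n \<alpha>
    using that M_extension_eq[OF that] by (auto simp: hom_I_iff)
  have arr: "farr (bullet_iset W) m n \<alpha> x \<in> fob (bullet_iset W) n"
    if "\<alpha> \<in> hom I_cat m n" "x \<in> fob (bullet_iset W) m" for m n \<alpha> x
    using mact_mem_bullet[OF W M_extension_mem ext] that by (simp add: bullet_iset_def)
  have "farr (bullet_iset W) m n \<alpha> \<in> extensional (fob (bullet_iset W) m)" for m n \<alpha>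
    by (simp add: bullet_iset_def)
  moreover have "farr (bullet_iset W) m m (\<lambda>i\<in>{1..m}. i) x = x"
    if x: "x \<in> fob (bullet_iset W) m" for m x
  proof -
    have "farr (bullet_iset W) m m (\<lambda>i\<in>{1..m}. i) x = mact W (\<lambda>i\<in>omega. i) x"
      by (rule farr_bullet[OF W _ M_set_idn _ x]) (auto simp: hom_I_iff inj_on_def omega_def)
    then show ?thesis using W x by (simp add: mact_idn tame_mset_def)
  qed
  moreover have "farr (bullet_iset W) l n (compose {1..l} \<beta> \<alpha>) x =
      farr (bullet_iset W) m n \<beta> (farr (bullet_iset W) l m \<alpha> x)"
    if \<alpha>: "\<alpha> \<in> hom I_cat l m" and \<beta>: "\<beta> \<in> hom I_cat m n" and x: "x \<in> fob (bullet_iset W) l"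
    for l m n \<alpha> \<beta> x
  proof -
    note ext\<alpha> = M_extension_mem[OF \<alpha>] M_extension_eq[OF \<alpha>]
    note ext\<beta> = M_extension_mem[OF \<beta>] M_extension_eq[OF \<beta>]
    have "compose {1..l} \<beta> \<alpha> \<in> hom I_cat l n"
      using category.cmp_hom[OF category_I_cat, of l m n \<alpha> \<beta>] \<alpha> \<beta> by simp
    \<comment> \<open>The extension chosen for a composite need not be the composite of the chosen
      extensions; agreement on {1..l} is enough for \<open>farr_bullet\<close>.\<close>
    moreover have "compose omega (M_extension m \<beta>) (M_extension l \<alpha>) i = compose {1..l} \<beta> \<alpha> i"
      if i: "i \<in> {1..l}" for i
    proof -
      have "\<alpha> i \<in> {1..m}" using \<alpha> i by (auto simp: hom_I_iff)
      then show ?thesis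
        using i ext\<alpha>(2)[OF i] ext\<beta>(2) atLeastAtMost_subset_omega[of l] by (auto simp: compose_def)
    qed
    ultimately have "farr (bullet_iset W) l n (compose {1..l} \<beta> \<alpha>) x =
        mact W (compose omega (M_extension m \<beta>) (M_extension l \<alpha>)) x"
      using ext\<alpha>(1) ext\<beta>(1) x by (intro farr_bullet[OF W] M_set_compose)
    also have "\<dots> = mact W (M_extension m \<beta>) (mact W (M_extension l \<alpha>) x)"
      using W x ext\<alpha> ext\<beta> by (simp add: mact_compose tame_mset_def)
    also have "\<dots> = farr (bullet_iset W) m n \<beta> (farr (bullet_iset W) l m \<alpha> x)"
      using farr_bullet[OF W \<alpha> ext\<alpha> x] farr_bullet[OF W \<beta> ext\<beta> arr[OF \<alpha> x]] by simp
    finally show ?thesis .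
  qed
  ultimately show ?thesis
    using arr unfolding ob_iset_iff PiE_iff by blast
qed

lemma restrict_equivariant_hom_bullet:
  assumes V: "tame_mset V" and W: "tame_mset W" and \<phi>: "equivariant V W \<phi>"
  shows "(\<lambda>m. restrict \<phi> (fob (bullet_iset V) m)) \<in> hom iset_cat (bullet_iset V) (bullet_iset W)"
proof -
  have mem: "\<phi> x \<in> fob (bullet_iset W) m" if "x \<in> fob (bullet_iset V) m" for x m
    using that supp_equivariant[OF V \<phi>, of x] \<phi> by (auto simp: equivariant_def)
  have "\<phi> (farr (bullet_iset V) m n \<alpha> x) = farr (bullet_iset W) m n \<alpha> (\<phi> x)"
    if \<alpha>: "\<alpha> \<in> hom I_cat m n" and x: "x \<in> fob (bullet_iset V) m" for m n \<alpha> x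
    using farr_bullet[OF V \<alpha> M_extension[OF \<alpha>] x] farr_bullet[OF W \<alpha> M_extension[OF \<alpha>] mem[OF x]]
      \<phi> x M_extension_mem[OF \<alpha>] by (simp add: equivariant_def)
  moreover have "farr (bullet_iset V) m n \<alpha> x \<in> fob (bullet_iset V) n"
    if "\<alpha> \<in> hom I_cat m n" "x \<in> fob (bullet_iset V) m" for m n \<alpha> x
    using bullet_iset_ob[OF V] that unfolding ob_iset_iff by (blast dest: PiE_mem)
  ultimately show ?thesis
    unfolding hom_iset_iff using bullet_iset_ob[OF V] bullet_iset_ob[OF W] mem
    by (simp del: fob_bullet add: restrict_PiE_iff)
qed

section \<open>Pullback squares in terms of elements, and flatness of
  \<open>W\<^sub>\<bullet>\<close>\<close>

lemma pullback_set_iff: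
  fixes A :: "'u set"
  shows "is_pullback set_cat P A B D p q f g \<longleftrightarrow>
    p \<in> P \<rightarrow>\<^sub>E A \<and> q \<in> P \<rightarrow>\<^sub>E B \<and> f \<in> A \<rightarrow>\<^sub>E D \<and> g \<in> B \<rightarrow>\<^sub>E D \<and> (\<forall>x\<in>P. f (p x) = g (q x)) \<and>
    (\<forall>a\<in>A. \<forall>b\<in>B. f a = g b \<longrightarrow> (\<exists>!x. x \<in> P \<and> p x = a \<and> q x = b))"
    (is "_ \<longleftrightarrow> ?p \<and> ?q \<and> ?f \<and> ?g \<and> ?comm \<and> ?elem")
proof -
  let ?univ = "\<forall>T::'u set. \<forall>a\<in>T \<rightarrow>\<^sub>E A. \<forall>b\<in>T \<rightarrow>\<^sub>E B. (\<forall>t\<in>T. f (a t) = g (b t)) \<longrightarrow>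
      (\<exists>!u. u \<in> T \<rightarrow>\<^sub>E P \<and> compose T p u = a \<and> compose T q u = b)"
  have univ_iff: "?univ \<longleftrightarrow> ?elem" if "?p" "?q"
  proof
    assume univ: ?univ
    show ?elem
    proof (intro ballI impI)
      fix a b assume ab: "a \<in> A" "b \<in> B" "f a = g b"
      \<comment> \<open>Testing the universal property on a one-element set turns maps into
        elements; \<open>undefined\<close> merely supplies an element of \<open>'u\<close>.\<close>
      have ex: "\<exists>!u. u \<in> {undefined :: 'u} \<rightarrow>\<^sub>E P \<and> compose {undefined} p u = (\<lambda>_\<in>{undefined}. a) \<and>
          compose {undefined} q u = (\<lambda>_\<in>{undefined}. b)"
      proof (rule mp[OF bspec[OF bspec[OF spec[OF univ]]]])
        show "(\<lambda>_\<in>{undefined}. a) \<in> {undefined} \<rightarrow>\<^sub>E A" "(\<lambda>_\<in>{undefined}. b) \<in> {undefined} \<rightarrow>\<^sub>E B"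
          using ab by auto
      qed (use ab in simp)
      have const_iff: "compose {undefined} h u = (\<lambda>_\<in>{undefined}. c) \<longleftrightarrow> h (u undefined) = c"
        for h u :: "'u \<Rightarrow> 'u" and c
        by (simp add: extensional_eq_iff[of _ "{undefined}"] compose_eq)
      note ex = ex[unfolded const_iff]
      define u where
        "u = (THE v. v \<in> {undefined :: 'u} \<rightarrow>\<^sub>E P \<and> p (v undefined) = a \<and> q (v undefined) = b)"
      have u: "u \<in> {undefined} \<rightarrow>\<^sub>E P \<and> p (u undefined) = a \<and> q (u undefined) = b"
        unfolding u_def by (rule theI'[OF ex])
      show "\<exists>!x. x \<in> P \<and> p x = a \<and> q x = b"
      proof (rule ex1I[of _ "u undefined"])
        show "u undefined \<in> P \<and> p (u undefined) = a \<and> q (u undefined) = b"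
          using u PiE_mem[OF conjunct1[OF u]] by simp
        fix x assume x: "x \<in> P \<and> p x = a \<and> q x = b"
        then have "u = (\<lambda>_\<in>{undefined}. x)"
          unfolding u_def by (intro the1_equality[OF ex]) simp
        then show "x = u undefined" by simp
      qed
    qed
  next
    assume elem: ?elem
    show ?univ
    proof (intro allI ballI impI)
      fix T a b
      assume a: "a \<in> T \<rightarrow>\<^sub>E A" and b: "b \<in> T \<rightarrow>\<^sub>E B" and ab: "\<forall>t\<in>T. f (a t) = g (b t)"
      have ex: "\<exists>!x. x \<in> P \<and> p x = a t \<and> q x = b t" if "t \<in> T" for t
        using elem a b ab that by (blast dest: PiE_mem)
      \<comment> \<open>Uniqueness of the element over each \<open>t\<close> both defines the
        mediating map and forces every other one to coincide with it.\<close>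
      define u where "u = (\<lambda>t\<in>T. THE x. x \<in> P \<and> p x = a t \<and> q x = b t)"
      have u: "u t \<in> P \<and> p (u t) = a t \<and> q (u t) = b t" if "t \<in> T" for t
        using theI'[OF ex[OF that]] that by (simp add: u_def)
      have comp_iff: "compose T p v = a \<longleftrightarrow> (\<forall>t\<in>T. p (v t) = a t)"
        "compose T q v = b \<longleftrightarrow> (\<forall>t\<in>T. q (v t) = b t)" for v
        using a b by (auto simp: PiE_def extensional_eq_iff[of _ T] compose_eq)
      show "\<exists>!u. u \<in> T \<rightarrow>\<^sub>E P \<and> compose T p u = a \<and> compose T q u = b"
      proof (rule ex1I[of _ u])
        show "u \<in> T \<rightarrow>\<^sub>E P \<and> compose T p u = a \<and> compose T q u = b"
          using u by (auto simp: comp_iff) (auto simp: u_def)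
      next
        fix v assume v: "v \<in> T \<rightarrow>\<^sub>E P \<and> compose T p v = a \<and> compose T q v = b"
        show "v = u"
        proof (rule extensionalityI)
          show "v \<in> extensional T" "u \<in> extensional T" using v by (auto simp: PiE_def u_def)
          fix t assume t: "t \<in> T"
          with v have "v t \<in> P \<and> p (v t) = a t \<and> q (v t) = b t"
            unfolding comp_iff by (auto dest: PiE_mem)
          then show "v t = u t" using ex[OF t] u[OF t] by blast
        qed
      qed
    qed
  qed
  have "is_pullback set_cat P A B D p q f g \<longleftrightarrow> ?p \<and> ?q \<and> ?f \<and> ?g \<and> ?comm \<and> ?univ"
    by (simp add: is_pullback_def set_cat_def compose_eq_compose_iff)
  also have "\<dots> \<longleftrightarrow> ?p \<and> ?q \<and> ?f \<and> ?g \<and> ?comm \<and> ?elem"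
    using univ_iff by (intro conj_cong refl)
  finally show ?thesis .
qed

text \<open>The object 1 represents elements: a map from a one-element set is always injective, so a
  point of {1..a} is an arrow from 1 to a. Testing the universal property on this object yields the
  common preimage.\<close>

lemma I_pullback_mem:
  assumes pb: "is_pullback I_cat k a b d p q f g"
    and ij: "i \<in> {1..a}" "j \<in> {1..b}" "f i = g j"
  obtains l where "l \<in> {1..k}" "p l = i" "q l = j"
proof -
  have "(\<lambda>_\<in>{1..1}. i) \<in> hom I_cat 1 a" "(\<lambda>_\<in>{1..1}. j) \<in> hom I_cat 1 b"
    using ij by (auto simp: hom_I_iff inj_on_def)
  moreover have "compose {1..1} f (\<lambda>_\<in>{1..1}. i) = compose {1..1} g (\<lambda>_\<in>{1..1::nat}. j)"
    using ij by (simp add: compose_eq_compose_iff)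
  ultimately obtain u where u: "u \<in> hom I_cat 1 k"
    "compose {1..1} p u = (\<lambda>_\<in>{1..1}. i)" "compose {1..1} q u = (\<lambda>_\<in>{1..1}. j)"
    using pb unfolding is_pullback_def I_cat_simps by blast
  show thesis
  proof
    show "u 1 \<in> {1..k}" using hom_I_mem[OF u(1), of 1] by simp
    show "p (u 1) = i" "q (u 1) = j"
      using fun_cong[OF u(2), of 1] fun_cong[OF u(3), of 1] by (simp_all add: compose_def)
  qed
qed

text \<open>Two copies of \<open>{1, \<dots>, n}\<close> amalgamated along \<open>{1, \<dots>, m}\<close>; \<open>shift_above m n\<close> is the inclusion
  of the second copy.\<close>

definition shift_above :: "nat \<Rightarrow> nat \<Rightarrow> nat \<Rightarrow> nat" where
  "shift_above m n = (\<lambda>i\<in>{1..n}. if i \<le> m then i else i + (n - m))"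

text \<open>For m \<le> n the amalgam has m common points and twice n - m others, which gives the
  size n + (n - m). The shifted values fill the interval from n + 1 to its end.\<close>

lemma shift_above_hom: "shift_above m n \<in> hom I_cat n (n + (n - m))"
  by (auto simp: hom_I_iff shift_above_def inj_on_def split: if_splits)

lemma shift_above_pullback:
  assumes "m \<le> n"
  shows "is_pullback I_cat m n n (n + (n - m)) (I_incl m) (I_incl m) (I_incl n) (shift_above m n)"
proof -
  have hom: "I_incl m \<in> hom I_cat m n" "I_incl n \<in> hom I_cat n (n + (n - m))"
    using assms by (auto intro: I_incl_hom)
  have "compose {1..m} (I_incl n) (I_incl m) = compose {1..m} (shift_above m n) (I_incl m)"
    using assms by (simp add: compose_eq_compose_iff I_incl_def shift_above_def)
  moreover have "\<exists>!u. u \<in> hom I_cat T m \<and> compose {1..T} (I_incl m) u = a \<and>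
      compose {1..T} (I_incl m) u = b"
    if a: "a \<in> hom I_cat T n" and b: "b \<in> hom I_cat T n"
      and ab: "compose {1..T} (I_incl n) a = compose {1..T} (shift_above m n) b" for T a b
  proof -
    \<comment> \<open>A shifted value exceeds \<open>n\<close>, so the first inclusion never attains
      it. Hence \<open>b i\<close> is at most \<open>m\<close>, where the shift is the identity, and
      \<open>a i = b i\<close>.\<close>
    have ab': "a i = b i \<and> a i \<in> {1..m}" if i: "i \<in> {1..T}" for i
    proof -
      have "a i \<in> {1..n}" "b i \<in> {1..n}"
        using a b i unfolding hom_I_iff by (blast dest: PiE_mem)+
      moreover have "I_incl n (a i) = shift_above m n (b i)"
        using ab i by (simp add: compose_eq_compose_iff)
      ultimately show ?thesis
        using assms by (auto simp: I_incl_def shift_above_def split: if_splits)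
    qed
    have "a = b"
      using a b ab' by (intro extensionalityI[of _ "{1..T}"]) (auto simp: hom_I_iff PiE_def)
    have incl: "compose {1..T} (I_incl m) u = u" if "u \<in> hom I_cat T m" for u
      using that unfolding I_incl_def hom_I_iff by (intro compose_Id_PiE) blast
    have "a \<in> hom I_cat T m"
      using a ab' unfolding hom_I_iff PiE_iff by blast
    then show ?thesis using incl \<open>a = b\<close> by metis
  qed
  ultimately show ?thesis
    using hom shift_above_hom by (simp add: is_pullback_def)
qed

text \<open>If \<open>y\<close> and \<open>z\<close> have the same image, then \<open>f\<close> and
  \<open>g\<close> carry their supports to the same set, and the pullback property in I puts the
  support of \<open>y\<close> inside the image of \<open>p\<close>. The inverse of a permutation
  extending \<open>p\<close> then brings \<open>y\<close> back to an element supported in {1..k}.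
  Uniqueness is injectivity of the map induced by \<open>p\<close>.\<close>

lemma flat_bullet_iset:
  assumes W: "tame_mset W" shows "flat_iset (bullet_iset W)"
proof -
  let ?Y = "bullet_iset W"
  have Y: "?Y \<in> ob iset_cat" by (rule bullet_iset_ob[OF W])
  have arr: "farr ?Y m n \<alpha> \<in> fob ?Y m \<rightarrow>\<^sub>E fob ?Y n" if "\<alpha> \<in> hom I_cat m n" for m n \<alpha>
    using Y that unfolding ob_iset_iff by blast
  have farr: "farr ?Y m n \<alpha> x = mact W (M_extension m \<alpha>) x"
    if "\<alpha> \<in> hom I_cat m n" "x \<in> fob ?Y m" for m n \<alpha> x
    by (rule farr_bullet[OF W that(1) M_extension[OF that(1)] that(2)])
  have inj: "inj_on (farr ?Y m n \<alpha>) (fob ?Y m)" if \<alpha>: "\<alpha> \<in> hom I_cat m n" for m n \<alpha>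
  proof (rule inj_onI)
    fix x y assume xy: "x \<in> fob ?Y m" "y \<in> fob ?Y m" "farr ?Y m n \<alpha> x = farr ?Y m n \<alpha> y"
    then have "mact W (M_extension m \<alpha>) x = mact W (M_extension m \<alpha>) y"
      by (simp only: farr[OF \<alpha>])
    then show "x = y"
      using xy(1,2) mact_inj[OF W _ _ M_extension_mem[OF \<alpha>]] by simp
  qed
  have supp_farr: "supp W (farr ?Y m n \<alpha> x) = \<alpha> ` supp W x"
    if \<alpha>: "\<alpha> \<in> hom I_cat m n" and x: "x \<in> fob ?Y m" for m n \<alpha> x
  proof -
    have "supp W (farr ?Y m n \<alpha> x) = M_extension m \<alpha> ` supp W x"
      using x farr[OF \<alpha> x] by (simp add: supp_mact[OF W _ M_extension_mem[OF \<alpha>]])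
    also have "\<dots> = \<alpha> ` supp W x"
      using x by (intro image_cong M_extension_eq[OF \<alpha>]) auto
    finally show ?thesis .
  qed
  have "is_pullback set_cat (fob ?Y k) (fob ?Y a) (fob ?Y b) (fob ?Y d)
      (farr ?Y k a p) (farr ?Y k b q) (farr ?Y a d f) (farr ?Y b d g)"
    if pb: "is_pullback I_cat k a b d p q f g" for k a b d p q f g
  proof -
    have p: "p \<in> hom I_cat k a" and q: "q \<in> hom I_cat k b" and f: "f \<in> hom I_cat a d"
      and g: "g \<in> hom I_cat b d" and comm: "compose {1..k} f p = compose {1..k} g q"
      using pb by (simp_all add: is_pullback_def)
    have comm': "farr ?Y a d f (farr ?Y k a p x) = farr ?Y b d g (farr ?Y k b q x)"
      if "x \<in> fob ?Y k" for x
      using Y p q f g comm that unfolding ob_iset_iff by metis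
    have "\<exists>!x. x \<in> fob ?Y k \<and> farr ?Y k a p x = y \<and> farr ?Y k b q x = z"
      if y: "y \<in> fob ?Y a" and z: "z \<in> fob ?Y b" and yz: "farr ?Y a d f y = farr ?Y b d g z" for y z
    proof (rule ex_ex1I)
      have supp: "supp W y \<subseteq> p ` {1..k}"
      proof
        fix i assume i: "i \<in> supp W y"
        then have "f i \<in> g ` supp W z"
          using supp_farr[OF f y] supp_farr[OF g z] yz by auto
        then obtain j where j: "j \<in> supp W z" "f i = g j" by blast
        then have "i \<in> {1..a}" "j \<in> {1..b}" using i y z by auto
        then obtain l where "l \<in> {1..k}" "p l = i" using I_pullback_mem[OF pb _ _ j(2)] by metis
        then show "i \<in> p ` {1..k}" by blast
      qed
      have "p ` {1..k} \<subseteq> omega" "inj_on p {1..k}"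
        using p by (auto simp: hom_I_iff omega_def)
      then obtain h h' where h: "h \<in> M_set" "h' \<in> M_set" "\<And>i. i \<in> {1..k} \<Longrightarrow> h i = p i"
        "compose omega h' h = (\<lambda>i\<in>omega. i)" "compose omega h h' = (\<lambda>i\<in>omega. i)"
        using extend_to_M_unit[OF finite_atLeastAtMost atLeastAtMost_subset_omega] by metis
      have y': "y \<in> mcar W" using y by simp
      \<comment> \<open>\<open>h'\<close> sends \<open>p l\<close> back to \<open>l\<close>, so the
        support of this element lies in {1..k}.\<close>
      define x where "x = mact W h' y"
      have hx: "mact W h x = y"
        using W h(1,2) y' mact_compose[of W h h' y] by (simp add: x_def h(5) mact_idn tame_mset_def)
      have "h' ` supp W y \<subseteq> {1..k}"
      proof
        fix l assume "l \<in> h' ` supp W y"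
        then obtain i where i: "i \<in> {1..k}" "l = h' (p i)" using supp by auto
        then have "i \<in> omega" by (simp add: omega_def)
        then show "l \<in> {1..k}"
          using i h(3)[OF i(1)] fun_cong[OF h(4), of i] by (simp add: compose_def)
      qed
      then have x: "x \<in> fob ?Y k"
        using W y' h(2) by (simp add: x_def supp_mact mact_mem tame_mset_def)
      have px: "farr ?Y k a p x = y"
        using farr_bullet[OF W p h(1,3) x] hx by simp
      \<comment> \<open>Only \<open>y\<close> was lifted. For \<open>z\<close> it suffices to
        compare after the injective map induced by \<open>g\<close>, where both sides become the
        image of \<open>y\<close> under \<open>f\<close>.\<close>
      have "farr ?Y k b q x = z"
        using inj_onD[OF inj[OF g], of "farr ?Y k b q x" z] comm'[OF x] px yz z
          PiE_mem[OF arr[OF q] x] by simp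
      with x px show "\<exists>x. x \<in> fob ?Y k \<and> farr ?Y k a p x = y \<and> farr ?Y k b q x = z" by blast
    qed (use inj_onD[OF inj[OF p]] in blast)
    then show ?thesis
      unfolding pullback_set_iff using comm'
      by (intro conjI ballI impI arr[OF p] arr[OF q] arr[OF f] arr[OF g])
  qed
  then show ?thesis
    using Y inj by (simp add: flat_iset_def)
qed

section \<open>The tame M-set of an I-set\<close>

lemma iset_arr: "Y \<in> ob iset_cat \<Longrightarrow> \<alpha> \<in> hom I_cat m n \<Longrightarrow> x \<in> fob Y m \<Longrightarrow> farr Y m n \<alpha> x \<in> fob Y n"
  unfolding ob_iset_iff by (blast dest: PiE_mem)

lemma iset_idn: "Y \<in> ob iset_cat \<Longrightarrow> x \<in> fob Y m \<Longrightarrow> farr Y m m (\<lambda>i\<in>{1..m}. i) x = x"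
  unfolding ob_iset_iff by blast

lemma iset_cmp:
  "Y \<in> ob iset_cat \<Longrightarrow> \<alpha> \<in> hom I_cat l m \<Longrightarrow> \<beta> \<in> hom I_cat m n \<Longrightarrow> x \<in> fob Y l \<Longrightarrow>
    farr Y m n \<beta> (farr Y l m \<alpha> x) = farr Y l n (compose {1..l} \<beta> \<alpha>) x"
  unfolding ob_iset_iff by metis

lemma I_incl_compose: "\<alpha> \<in> hom I_cat l m \<Longrightarrow> compose {1..l} (I_incl m) \<alpha> = \<alpha>"
  unfolding hom_I_iff I_incl_def by (rule compose_Id_PiE) blast

lemma iset_hom_mem: "t \<in> hom iset_cat Y Z \<Longrightarrow> x \<in> fob Y m \<Longrightarrow> t m x \<in> fob Z m"
  unfolding hom_iset_iff by (blast dest: PiE_mem)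

lemma iset_hom_natural:
  "t \<in> hom iset_cat Y Z \<Longrightarrow> \<alpha> \<in> hom I_cat m n \<Longrightarrow> x \<in> fob Y m \<Longrightarrow>
    t n (farr Y m n \<alpha> x) = farr Z m n \<alpha> (t m x)"
  unfolding hom_iset_iff by blast

lemma germ_mem: "x \<in> fob Y m \<Longrightarrow> germ Y m x \<in> colim_N Y"
  by (auto simp: colim_N_def)

lemma colim_N_cases:
  assumes "y \<in> colim_N Y" obtains m x where "x \<in> fob Y m" "y = germ Y m x"
  using assms by (auto simp: colim_N_def)

lemma germ_incl:
  assumes "Y \<in> ob iset_cat" "m \<le> n" "x \<in> fob Y m"
  shows "germ Y n (farr Y m n (I_incl m) x) = germ Y m x"
proof -
  have "farr Y n n (I_incl n) (farr Y m n (I_incl m) x) = farr Y m n (I_incl m) x"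
    by (simp only: iset_cmp[OF assms(1) I_incl_hom I_incl_hom assms(3)] I_incl_compose[OF I_incl_hom]
        assms(2) order_refl)
  then show ?thesis
    using assms by (subst germ_eq_iff) (auto intro: iset_arr I_incl_hom)
qed

lemma colim_rep:
  assumes "y \<in> colim_N Y" "colim_rep Y y = (m, x)"
  shows "x \<in> fob Y m" "germ Y m x = y"
proof -
  have "\<exists>p. snd p \<in> fob Y (fst p) \<and> germ Y (fst p) (snd p) = y"
    using assms(1) by (auto simp: colim_N_def)
  from someI_ex[OF this] show "x \<in> fob Y m" "germ Y m x = y"
    using assms(2) by (simp_all add: colim_rep_def)
qed

text \<open>The representative chosen by \<open>colim_rep\<close> and the given one agree at some
  stage \<open>p\<close>, and naturality along the inclusions into \<open>p\<close> carries this
  over to \<open>Z\<close>. Maps induced on colimits can henceforth be evaluated on any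
  representative.\<close>

lemma colim_map_germ:
  assumes t: "t \<in> hom iset_cat Y Z" and x: "x \<in> fob Y m"
  shows "colim_map Y Z t (germ Y m x) = germ Z m (t m x)"
proof -
  have Y: "Y \<in> ob iset_cat" and Z: "Z \<in> ob iset_cat" using t by (simp_all add: hom_iset_iff)
  obtain k z where kz: "colim_rep Y (germ Y m x) = (k, z)" by fastforce
  note z = colim_rep[OF germ_mem[OF x] kz]
  obtain p where p: "k \<le> p" "m \<le> p" "farr Y k p (I_incl k) z = farr Y m p (I_incl m) x"
    using germ_eq_iff[OF Y z(1) x] z(2) by blast
  have push: "germ Z l (t l w) = germ Z p (t p (farr Y l p (I_incl l) w))"
    if "l \<le> p" "w \<in> fob Y l" for l w
    using germ_incl[OF Z that(1) iset_hom_mem[OF t that(2)]]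
      iset_hom_natural[OF t I_incl_hom[OF that(1)] that(2)] by simp
  have "germ Z k (t k z) = germ Z m (t m x)"
    using push[OF p(1) z(1)] push[OF p(2) x] p(3) by simp
  then show ?thesis
    using kz germ_mem[OF x] by (simp add: colim_map_def)
qed

lemma colim_map_PiE:
  assumes t: "t \<in> hom iset_cat Y Z"
  shows "colim_map Y Z t \<in> colim_N Y \<rightarrow>\<^sub>E colim_N Z"
  unfolding PiE_iff
proof
  show "\<forall>y\<in>colim_N Y. colim_map Y Z t y \<in> colim_N Z"
    using colim_map_germ[OF t] germ_mem[OF iset_hom_mem[OF t]] by (metis colim_N_cases)
  show "colim_map Y Z t \<in> extensional (colim_N Y)"
    by (simp add: colim_map_def)
qed

lemma M_set_restrict_hom:
  "f \<in> M_set \<Longrightarrow> f ` {1..m} \<subseteq> {1..n} \<Longrightarrow> restrict f {1..m} \<in> hom I_cat m n"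
  using atLeastAtMost_subset_omega[of m]
  by (auto simp: hom_I_iff M_set_def restrict_PiE_iff inj_on_restrict_eq intro: inj_on_subset)

lemma M_set_image_bounded:
  assumes "f \<in> M_set" shows "f ` {1..m} \<subseteq> {1..Max (insert 0 (f ` {1..m}))}"
  using M_set_mem[OF assms] by (auto simp: omega_def)

text \<open>Enlarging the codomain composes the restriction of \<open>f\<close> with an inclusion,
  and inclusions do not change germs. So the maximum in \<open>omega_act\<close> may be replaced by
  any bound.\<close>

lemma germ_act_indep:
  assumes Y: "Y \<in> ob iset_cat" and f: "f \<in> M_set" and "f ` {1..m} \<subseteq> {1..n}" "f ` {1..m} \<subseteq> {1..n'}"
    and x: "x \<in> fob Y m"
  shows "germ Y n (farr Y m n (restrict f {1..m}) x) = germ Y n' (farr Y m n' (restrict f {1..m}) x)"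
proof -
  have "germ Y k (farr Y m k (restrict f {1..m}) x) =
      germ Y (max n n') (farr Y m (max n n') (restrict f {1..m}) x)"
    if k: "f ` {1..m} \<subseteq> {1..k}" "k \<le> max n n'" for k
  proof -
    note h = M_set_restrict_hom[OF f k(1)]
    show ?thesis
      using germ_incl[OF Y k(2) iset_arr[OF Y h x]]
      by (simp only: iset_cmp[OF Y h I_incl_hom[OF k(2)] x] I_incl_compose[OF h])
  qed
  from this[of n] this[of n'] assms(3,4) show ?thesis by simp
qed

text \<open>Two representatives agree at some stage \<open>p\<close>, and a bound \<open>N\<close>
  for \<open>f\<close> on {1..p} serves every smaller stage too, so all results can be compared at
  stage \<open>N\<close>. This removes both choices made in \<open>omega_act\<close>, the
  representative and the target stage.\<close>

lemma omega_act_germ: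
  assumes Y: "Y \<in> ob iset_cat" and f: "f \<in> M_set" "f ` {1..m} \<subseteq> {1..n}" and x: "x \<in> fob Y m"
  shows "omega_act Y f (germ Y m x) = germ Y n (farr Y m n (restrict f {1..m}) x)"
proof -
  obtain k z where kz: "colim_rep Y (germ Y m x) = (k, z)" by fastforce
  note z = colim_rep[OF germ_mem[OF x] kz]
  obtain p where p: "k \<le> p" "m \<le> p" "farr Y k p (I_incl k) z = farr Y m p (I_incl m) x"
    using germ_eq_iff[OF Y z(1) x] z(2) by blast
  define N where "N = Max (insert 0 (f ` {1..p}))"
  have N: "f ` {1..p} \<subseteq> {1..N}" unfolding N_def by (rule M_set_image_bounded[OF f(1)])
  have push: "germ Y i (farr Y l i (restrict f {1..l}) w) =
      germ Y N (farr Y p N (restrict f {1..p}) (farr Y l p (I_incl l) w))"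
    if l: "l \<le> p" "f ` {1..l} \<subseteq> {1..i}" "w \<in> fob Y l" for i l w
  proof -
    have "f ` {1..l} \<subseteq> f ` {1..p}" using l(1) by (intro image_mono) auto
    then have "f ` {1..l} \<subseteq> {1..N}" using N by blast
    then have "germ Y i (farr Y l i (restrict f {1..l}) w) = germ Y N (farr Y l N (restrict f {1..l}) w)"
      using l by (intro germ_act_indep[OF Y f(1)])
    moreover have "compose {1..l} (restrict f {1..p}) (I_incl l) = restrict f {1..l}"
      using l(1) by (auto simp: compose_def I_incl_def fun_eq_iff)
    ultimately show ?thesis
      by (simp only: iset_cmp[OF Y I_incl_hom[OF l(1)] M_set_restrict_hom[OF f(1) N] l(3)])
  qed
  have "omega_act Y f (germ Y m x) =
      germ Y (Max (insert 0 (f ` {1..k}))) (farr Y k (Max (insert 0 (f ` {1..k}))) (restrict f {1..k}) z)"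
    using kz germ_mem[OF x] by (simp add: omega_act_def Let_def)
  also have "\<dots> = germ Y n (farr Y m n (restrict f {1..m}) x)"
    using push[OF p(1) M_set_image_bounded[OF f(1)] z(1)] push[OF p(2) f(2) x] p(3) by simp
  finally show ?thesis .
qed

text \<open>This is X(\<omega>) in one simplicial degree, split off so that the theory of M-sets
  applies to it directly.\<close>

definition colim_mset :: "'u::infinite iset \<Rightarrow> 'u mset_data" where
  "colim_mset Y = \<lparr>mcar = colim_N Y, mact = omega_act Y\<rparr>"

lemma colim_mset_simps [simp]: "mcar (colim_mset Y) = colim_N Y" "mact (colim_mset Y) = omega_act Y"
  by (simp_all add: colim_mset_def)

lemma omega_act_mem:
  assumes "Y \<in> ob iset_cat" "f \<in> M_set" "y \<in> colim_N Y"
  shows "omega_act Y f y \<in> colim_N Y"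
proof -
  from assms(3) obtain m x where x: "x \<in> fob Y m" "y = germ Y m x" by (rule colim_N_cases)
  note bound = M_set_image_bounded[OF assms(2), of m]
  show ?thesis
    unfolding x(2) omega_act_germ[OF assms(1,2) bound x(1)]
    by (intro germ_mem iset_arr[OF assms(1) M_set_restrict_hom[OF assms(2) bound] x(1)])
qed

text \<open>The restriction of \<open>f\<close> is the identity of the object m, and m itself is an
  admissible bound. The unit law, tameness and the bound on the support of a germ rest on
  this.\<close>

lemma omega_act_fixed:
  assumes Y: "Y \<in> ob iset_cat" and f: "f \<in> M_set" "\<forall>i\<in>{1..m}. f i = i" and x: "x \<in> fob Y m"
  shows "omega_act Y f (germ Y m x) = germ Y m x"
proof -
  have "restrict f {1..m} = (\<lambda>i\<in>{1..m}. i)"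
    using f(2) by (intro restrict_ext) blast
  moreover have "f ` {1..m} \<subseteq> {1..m}" using f(2) by auto
  ultimately show ?thesis
    using omega_act_germ[OF Y f(1) _ x, of m] iset_idn[OF Y x] by simp
qed

lemma tame_colim_mset:
  assumes Y: "Y \<in> ob iset_cat" shows "tame_mset (colim_mset Y)"
proof -
  have "omega_act Y (\<lambda>i\<in>omega. i) y = y" if y: "y \<in> colim_N Y" for y
  proof -
    from y obtain m x where "x \<in> fob Y m" "y = germ Y m x" by (rule colim_N_cases)
    then show ?thesis
      using omega_act_fixed[OF Y M_set_idn] by (simp add: omega_def)
  qed
  moreover have "omega_act Y (compose omega f g) y = omega_act Y f (omega_act Y g y)"
    if f: "f \<in> M_set" and g: "g \<in> M_set" and y: "y \<in> colim_N Y" for f g y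
  proof -
    from y obtain m x where x: "x \<in> fob Y m" "y = germ Y m x" by (rule colim_N_cases)
    \<comment> \<open>\<open>n\<close> bounds \<open>g\<close> on {1..m} and \<open>N\<close> bounds
      \<open>f\<close> on {1..n}, so \<open>N\<close> bounds the composite as well, and all three
      actions become structure maps between the stages m, n and N.\<close>
    define n where "n = Max (insert 0 (g ` {1..m}))"
    define N where "N = Max (insert 0 (f ` {1..n}))"
    have n: "g ` {1..m} \<subseteq> {1..n}" and N: "f ` {1..n} \<subseteq> {1..N}"
      unfolding n_def N_def by (intro M_set_image_bounded f g)+
    have fg: "compose omega f g i = f (g i)" if "i \<in> {1..m}" for i
      using that by (auto simp: compose_def omega_def)
    then have "compose omega f g ` {1..m} = f ` g ` {1..m}" by (auto simp: image_iff)
    also have "\<dots> \<subseteq> {1..N}" using n N by blast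
    finally have nN: "compose omega f g ` {1..m} \<subseteq> {1..N}" .
    have "restrict (compose omega f g) {1..m} = compose {1..m} (restrict f {1..n}) (restrict g {1..m})"
    proof (rule extensionalityI[of _ "{1..m}"])
      fix i assume i: "i \<in> {1..m}"
      then have "g i \<in> {1..n}" using n by blast
      then show "restrict (compose omega f g) {1..m} i =
          compose {1..m} (restrict f {1..n}) (restrict g {1..m}) i"
        using i fg[OF i] by (simp add: compose_eq)
    qed auto
    then have "omega_act Y (compose omega f g) y =
        germ Y N (farr Y n N (restrict f {1..n}) (farr Y m n (restrict g {1..m}) x))"
      unfolding x(2) omega_act_germ[OF Y M_set_compose[OF f g] nN x(1)]
        iset_cmp[OF Y M_set_restrict_hom[OF g n] M_set_restrict_hom[OF f N] x(1)] by simp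
    also have "\<dots> = omega_act Y f (omega_act Y g y)"
      unfolding x(2) omega_act_germ[OF Y g n x(1)]
      by (rule omega_act_germ[OF Y f N iset_arr[OF Y M_set_restrict_hom[OF g n] x(1)], symmetric])
    finally show ?thesis .
  qed
  ultimately have "is_mset (colim_mset Y)"
    using omega_act_mem[OF Y] by (simp add: is_mset_def)
  moreover have "\<exists>A\<subseteq>omega. finite A \<and> supported_on (colim_mset Y) y A" if y: "y \<in> colim_N Y" for y
  proof -
    from y obtain m x where x: "x \<in> fob Y m" "y = germ Y m x" by (rule colim_N_cases)
    have "supported_on (colim_mset Y) y {1..m}"
      using omega_act_fixed[OF Y _ _ x(1)] by (auto simp: supported_on_def x(2))
    then show ?thesis using atLeastAtMost_subset_omega[of m] by blast
  qed
  ultimately show ?thesis by (simp add: tame_mset_def)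
qed

lemma supp_germ:
  assumes Y: "Y \<in> ob iset_cat" and x: "x \<in> fob Y m"
  shows "supp (colim_mset Y) (germ Y m x) \<subseteq> {1..m}"
proof (rule supp_subset)
  show "supported_on (colim_mset Y) (germ Y m x) {1..m}"
    using omega_act_fixed[OF Y _ _ x] by (simp add: supported_on_def)
qed (simp_all add: atLeastAtMost_subset_omega[simplified])

lemma equivariant_colim_map:
  assumes t: "t \<in> hom iset_cat Y Z"
  shows "equivariant (colim_mset Y) (colim_mset Z) (colim_map Y Z t)"
proof -
  have Y: "Y \<in> ob iset_cat" and Z: "Z \<in> ob iset_cat" using t by (simp_all add: hom_iset_iff)
  have "colim_map Y Z t (omega_act Y f y) = omega_act Z f (colim_map Y Z t y)"
    if f: "f \<in> M_set" and y: "y \<in> colim_N Y" for f y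
  proof -
    from y obtain m x where x: "x \<in> fob Y m" "y = germ Y m x" by (rule colim_N_cases)
    note bound = M_set_image_bounded[OF f, of m]
    note h = M_set_restrict_hom[OF f bound]
    show ?thesis
      unfolding x(2) omega_act_germ[OF Y f bound x(1)] colim_map_germ[OF t x(1)]
        omega_act_germ[OF Z f bound iset_hom_mem[OF t x(1)]] colim_map_germ[OF t iset_arr[OF Y h x(1)]]
        iset_hom_natural[OF t h x(1)] ..
  qed
  then show ?thesis
    using colim_map_PiE[OF t] by (auto simp: equivariant_def)
qed

section \<open>Unit and counit in one simplicial degree\<close>

definition unit_iset :: "'u::infinite iset \<Rightarrow> nat \<Rightarrow> 'u \<Rightarrow> 'u" where
  "unit_iset Y = (\<lambda>m. \<lambda>x\<in>fob Y m. germ Y m x)"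

definition counit_mset :: "'u::infinite mset_data \<Rightarrow> 'u \<Rightarrow> 'u" where
  "counit_mset W = (\<lambda>y\<in>colim_N (bullet_iset W). snd (colim_rep (bullet_iset W) y))"

lemma unit_iset_hom:
  assumes Y: "Y \<in> ob iset_cat"
  shows "unit_iset Y \<in> hom iset_cat Y (bullet_iset (colim_mset Y))"
proof -
  let ?K = "colim_mset Y"
  have K: "tame_mset ?K" by (rule tame_colim_mset[OF Y])
  have mem: "germ Y m x \<in> fob (bullet_iset ?K) m" if "x \<in> fob Y m" for m x
    using germ_mem[OF that] supp_germ[OF Y that] by simp
  have "unit_iset Y n (farr Y m n \<alpha> x) = farr (bullet_iset ?K) m n \<alpha> (unit_iset Y m x)"
    if \<alpha>: "\<alpha> \<in> hom I_cat m n" and x: "x \<in> fob Y m" for m n \<alpha> x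
  proof -
    note ext = M_extension_mem[OF \<alpha>] M_extension_eq[OF \<alpha>]
    have bound: "M_extension m \<alpha> ` {1..m} \<subseteq> {1..n}"
      using ext(2) hom_I_mem[OF \<alpha>] by (metis image_subsetI)
    \<comment> \<open>To act on a germ, the extension is restricted back to {1..m}, which returns
      \<alpha>; so the action of \<alpha> on germs is the structure map of \<open>Y\<close>.\<close>
    have res: "restrict (M_extension m \<alpha>) {1..m} = \<alpha>"
      using \<alpha> ext(2) by (intro extensionalityI[of _ "{1..m}"]) (simp_all add: hom_I_iff PiE_def)
    have "farr (bullet_iset ?K) m n \<alpha> (unit_iset Y m x) = omega_act Y (M_extension m \<alpha>) (germ Y m x)"
      using farr_bullet[OF K \<alpha> ext mem[OF x]] x by (simp add: unit_iset_def)
    also have "\<dots> = germ Y n (farr Y m n \<alpha> x)"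
      using omega_act_germ[OF Y ext(1) bound x] by (simp only: res)
    finally show ?thesis using iset_arr[OF Y \<alpha> x] by (simp add: unit_iset_def)
  qed
  then show ?thesis
    unfolding hom_iset_iff using Y bullet_iset_ob[OF K] mem
    by (simp del: fob_bullet add: unit_iset_def restrict_PiE_iff)
qed

text \<open>The identity of \<open>omega\<close> extends every inclusion, so along inclusions the
  structure maps of \<open>W\<^sub>\<bullet>\<close> are literally inclusions of subsets of
  \<open>W\<close>; identification in the colimit is then equality in \<open>W\<close>.\<close>

lemma germ_bullet_eq_iff:
  assumes W: "tame_mset W" and x: "x \<in> fob (bullet_iset W) m" and y: "y \<in> fob (bullet_iset W) n"
  shows "germ (bullet_iset W) m x = germ (bullet_iset W) n y \<longleftrightarrow> x = y"
proof -
  have incl: "farr (bullet_iset W) k p (I_incl k) z = z"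
    if "k \<le> p" "z \<in> fob (bullet_iset W) k" for k p z
  proof -
    have "farr (bullet_iset W) k p (I_incl k) z = mact W (\<lambda>i\<in>omega. i) z"
      by (rule farr_bullet[OF W I_incl_hom[OF that(1)] M_set_idn _ that(2)])
        (auto simp: I_incl_def omega_def)
    then show ?thesis using that W by (simp add: mact_idn tame_mset_def)
  qed
  have "germ (bullet_iset W) m x = germ (bullet_iset W) n y \<longleftrightarrow> (\<exists>p. m \<le> p \<and> n \<le> p \<and> x = y)"
    unfolding germ_eq_iff[OF bullet_iset_ob[OF W] x y] using incl x y by metis
  then show ?thesis by (metis max.cobounded1 max.cobounded2)
qed

lemma counit_mset_germ:
  assumes W: "tame_mset W" and x: "x \<in> fob (bullet_iset W) m"
  shows "counit_mset W (germ (bullet_iset W) m x) = x"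
proof -
  obtain k z where kz: "colim_rep (bullet_iset W) (germ (bullet_iset W) m x) = (k, z)" by fastforce
  note z = colim_rep[OF germ_mem[OF x] kz]
  have "z = x" using germ_bullet_eq_iff[OF W z(1) x] z(2) by blast
  then show ?thesis using kz germ_mem[OF x] by (simp add: counit_mset_def)
qed

lemma equivariant_counit_mset:
  assumes W: "tame_mset W"
  shows "equivariant (colim_mset (bullet_iset W)) W (counit_mset W)"
proof -
  have B: "bullet_iset W \<in> ob iset_cat" by (rule bullet_iset_ob[OF W])
  have "counit_mset W y \<in> mcar W" if y: "y \<in> colim_N (bullet_iset W)" for y
  proof -
    from y obtain m x where "x \<in> fob (bullet_iset W) m" "y = germ (bullet_iset W) m x"
      by (rule colim_N_cases)
    then show ?thesis using counit_mset_germ[OF W] by simp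
  qed
  moreover have "counit_mset W (omega_act (bullet_iset W) f y) = mact W f (counit_mset W y)"
    if f: "f \<in> M_set" and y: "y \<in> colim_N (bullet_iset W)" for f y
  proof -
    from y obtain m x where x: "x \<in> fob (bullet_iset W) m" "y = germ (bullet_iset W) m x"
      by (rule colim_N_cases)
    note bound = M_set_image_bounded[OF f, of m]
    note h = M_set_restrict_hom[OF f bound]
    have "farr (bullet_iset W) m (Max (insert 0 (f ` {1..m}))) (restrict f {1..m}) x = mact W f x"
      by (rule farr_bullet[OF W h f _ x(1)]) simp
    then show ?thesis
      using counit_mset_germ[OF W iset_arr[OF B h x(1)]]
      unfolding x(2) omega_act_germ[OF B f bound x(1)] counit_mset_germ[OF W x(1)] by simp
  qed
  ultimately show ?thesis by (simp add: equivariant_def)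
qed

lemma bij_betw_counit_mset:
  assumes W: "tame_mset W"
  shows "bij_betw (counit_mset W) (colim_N (bullet_iset W)) (mcar W)"
proof (rule bij_betw_imageI)
  show "inj_on (counit_mset W) (colim_N (bullet_iset W))"
  proof (rule inj_onI)
    fix y z assume y: "y \<in> colim_N (bullet_iset W)" and z: "z \<in> colim_N (bullet_iset W)"
      and eq: "counit_mset W y = counit_mset W z"
    from y obtain m x where x: "x \<in> fob (bullet_iset W) m" "y = germ (bullet_iset W) m x"
      by (rule colim_N_cases)
    from z obtain n w where w: "w \<in> fob (bullet_iset W) n" "z = germ (bullet_iset W) n w"
      by (rule colim_N_cases)
    show "y = z"
      using eq germ_bullet_eq_iff[OF W x(1) w(1)]
      unfolding x(2) w(2) counit_mset_germ[OF W x(1)] counit_mset_germ[OF W w(1)] by simp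
  qed
  show "counit_mset W ` colim_N (bullet_iset W) = mcar W"
  proof
    show "counit_mset W ` colim_N (bullet_iset W) \<subseteq> mcar W"
      using equivariant_counit_mset[OF W] by (auto simp: equivariant_def)
    show "mcar W \<subseteq> counit_mset W ` colim_N (bullet_iset W)"
    proof
      fix x assume x: "x \<in> mcar W"
      \<comment> \<open>Surjectivity is where finiteness of the support is decisive: every element
        occurs at some finite stage.\<close>
      then obtain m where "supp W x \<subseteq> {1..m}"
        using finite_subset_omega_bounded tame_supp[OF W] by metis
      then have "x \<in> fob (bullet_iset W) m" using x by simp
      then show "x \<in> counit_mset W ` colim_N (bullet_iset W)"
        using counit_mset_germ[OF W] germ_mem by (metis image_eqI)
    qed
  qed
qed

text \<open>Both conditions of flatness are tested on elements, which a natural bijection carries to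
  \<open>Z\<close> and back. With \<open>Z\<close> the flat I-set obtained from the colimit of
  \<open>Y\<close>, bijectivity of the unit thus gives flatness of \<open>Y\<close>.\<close>

lemma flat_iset_bij:
  assumes t: "t \<in> hom iset_cat Y Z" and bij: "\<And>m. bij_betw (t m) (fob Y m) (fob Z m)" and Z: "flat_iset Z"
  shows "flat_iset Y"
proof -
  have Y: "Y \<in> ob iset_cat" using t by (simp add: hom_iset_iff)
  note nat = iset_hom_natural[OF t] and mem = iset_hom_mem[OF t]
  have arr: "farr Y m n \<alpha> \<in> fob Y m \<rightarrow>\<^sub>E fob Y n" if "\<alpha> \<in> hom I_cat m n" for m n \<alpha>
    using Y that unfolding ob_iset_iff by blast
  have t_inj: "x = y" if "t m x = t m y" "x \<in> fob Y m" "y \<in> fob Y m" for m x y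
    using bij_betw_imp_inj_on[OF bij] that by (rule inj_onD)
  have inj: "inj_on (farr Y m n \<alpha>) (fob Y m)" if \<alpha>: "\<alpha> \<in> hom I_cat m n" for m n \<alpha>
  proof (rule inj_onI)
    fix x y assume xy: "x \<in> fob Y m" "y \<in> fob Y m" "farr Y m n \<alpha> x = farr Y m n \<alpha> y"
    have "inj_on (farr Z m n \<alpha>) (fob Z m)" using Z \<alpha> by (simp add: flat_iset_def)
    moreover have "farr Z m n \<alpha> (t m x) = farr Z m n \<alpha> (t m y)"
      using nat[OF \<alpha> xy(1)] nat[OF \<alpha> xy(2)] xy(3) by simp
    ultimately have "t m x = t m y"
      using mem xy(1,2) by (blast dest: inj_onD)
    then show "x = y" using xy t_inj by blast
  qed
  have "is_pullback set_cat (fob Y k) (fob Y a) (fob Y b) (fob Y d)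
      (farr Y k a p) (farr Y k b q) (farr Y a d f) (farr Y b d g)"
    if pb: "is_pullback I_cat k a b d p q f g" for k a b d p q f g
  proof -
    have p: "p \<in> hom I_cat k a" and q: "q \<in> hom I_cat k b" and f: "f \<in> hom I_cat a d"
      and g: "g \<in> hom I_cat b d" and comm: "compose {1..k} f p = compose {1..k} g q"
      using pb by (simp_all add: is_pullback_def)
    have comm': "farr Y a d f (farr Y k a p x) = farr Y b d g (farr Y k b q x)"
      if "x \<in> fob Y k" for x
      using iset_cmp[OF Y p f that] iset_cmp[OF Y q g that] comm by simp
    have "is_pullback set_cat (fob Z k) (fob Z a) (fob Z b) (fob Z d)
        (farr Z k a p) (farr Z k b q) (farr Z a d f) (farr Z b d g)"
      using Z pb unfolding flat_iset_def by blast
    then have elem: "\<exists>!x. x \<in> fob Z k \<and> farr Z k a p x = y \<and> farr Z k b q x = z"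
      if "y \<in> fob Z a" "z \<in> fob Z b" "farr Z a d f y = farr Z b d g z" for y z
      unfolding pullback_set_iff using that by blast
    have "\<exists>!x. x \<in> fob Y k \<and> farr Y k a p x = y \<and> farr Y k b q x = z"
      if y: "y \<in> fob Y a" and z: "z \<in> fob Y b" and yz: "farr Y a d f y = farr Y b d g z" for y z
    proof (rule ex_ex1I)
      have "farr Z a d f (t a y) = farr Z b d g (t b z)"
        using nat[OF f y] nat[OF g z] yz by simp
      then obtain w where w: "w \<in> fob Z k" "farr Z k a p w = t a y" "farr Z k b q w = t b z"
        using elem[OF mem[OF y] mem[OF z]] by blast
      then obtain x where x: "x \<in> fob Y k" "w = t k x"
        using bij_betw_imp_surj_on[OF bij[of k]] by blast
      have "t a (farr Y k a p x) = t a y" "t b (farr Y k b q x) = t b z"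
        using w x nat[OF p x(1)] nat[OF q x(1)] by simp_all
      then have "farr Y k a p x = y" "farr Y k b q x = z"
        using t_inj iset_arr[OF Y p x(1)] iset_arr[OF Y q x(1)] y z by blast+
      with x(1) show "\<exists>x. x \<in> fob Y k \<and> farr Y k a p x = y \<and> farr Y k b q x = z" by blast
    qed (use inj_onD[OF inj[OF p]] in metis)
    then show ?thesis
      unfolding pullback_set_iff using comm'
      by (intro conjI ballI impI arr[OF p] arr[OF q] arr[OF f] arr[OF g])
  qed
  then show ?thesis
    using Y inj by (simp add: flat_iset_def)
qed

lemma bij_betw_unit_iset:
  assumes flat: "flat_iset Y"
  shows "bij_betw (unit_iset Y m) (fob Y m) (fob (bullet_iset (colim_mset Y)) m)"
proof (rule bij_betw_imageI)
  let ?K = "colim_mset Y"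
  have Y: "Y \<in> ob iset_cat" using flat by (simp add: flat_iset_def)
  have inj: "inj_on (farr Y k n \<alpha>) (fob Y k)" if "\<alpha> \<in> hom I_cat k n" for k n \<alpha>
    using flat that by (simp add: flat_iset_def)
  \<comment> \<open>Equality of germs only gives agreement at some later stage \<open>r\<close>;
    injectivity of the structure maps cancels that stage.\<close>
  have germ_eq: "farr Y k p (I_incl k) x = y" if *: "germ Y k x = germ Y p y" "k \<le> p" "x \<in> fob Y k" "y \<in> fob Y p"
    for k p x y
  proof -
    have "germ Y p (farr Y k p (I_incl k) x) = germ Y p y"
      using germ_incl[OF Y *(2,3)] *(1) by simp
    then obtain r where r: "p \<le> r" "farr Y p r (I_incl p) (farr Y k p (I_incl k) x) = farr Y p r (I_incl p) y"
      using germ_eq_iff[OF Y iset_arr[OF Y I_incl_hom[OF *(2)] *(3)] *(4)] by blast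
    show ?thesis
      using inj_onD[OF inj[OF I_incl_hom[OF r(1)]] r(2)] iset_arr[OF Y I_incl_hom[OF *(2)] *(3)] *(4)
      by blast
  qed
  show "inj_on (unit_iset Y m) (fob Y m)"
  proof (rule inj_onI)
    fix x y assume xy: "x \<in> fob Y m" "y \<in> fob Y m" "unit_iset Y m x = unit_iset Y m y"
    then have "germ Y m x = germ Y m y" by (simp add: unit_iset_def)
    then have "farr Y m m (I_incl m) x = y" using germ_eq xy(1,2) by blast
    then show "x = y" using iset_idn[OF Y xy(1)] by (simp add: I_incl_def)
  qed
  show "unit_iset Y m ` fob Y m = fob (bullet_iset ?K) m"
  proof
    show "unit_iset Y m ` fob Y m \<subseteq> fob (bullet_iset ?K) m"
      using iset_hom_mem[OF unit_iset_hom[OF Y]] by blast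
    show "fob (bullet_iset ?K) m \<subseteq> unit_iset Y m ` fob Y m"
    proof
      fix y assume y: "y \<in> fob (bullet_iset ?K) m"
      then obtain n0 x0 where "x0 \<in> fob Y n0" "y = germ Y n0 x0"
        by (auto elim: colim_N_cases)
      \<comment> \<open>The representative is moved to a stage above \<open>m\<close>, since the
        amalgam along {1..m} requires m \<le> n.\<close>
      then obtain n x where n: "m \<le> n" and x: "x \<in> fob Y n" "y = germ Y n x"
        using germ_incl[OF Y, of n0 "max m n0" x0] iset_arr[OF Y I_incl_hom, of n0 "max m n0" x0]
        by (metis max.cobounded1 max.cobounded2)
      text \<open>An extension of \<open>shift_above m n\<close> to \<open>M\<close> fixes \<open>{1, \<dots>, m}\<close>, hence also \<open>y\<close>, so the two
        inclusions into the amalgam agree on \<open>x\<close>.\<close>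
      let ?p = "n + (n - m)"
      let ?s = "shift_above m n"
      note s = shift_above_hom[of m n]
      note f = M_extension_mem[OF s] M_extension_eq[OF s]
      have "omega_act Y (M_extension n ?s) y = omega_act Y (\<lambda>i\<in>omega. i) y"
      proof -
        have y': "y \<in> mcar ?K" "supp ?K y \<subseteq> {1..m}" using y by auto
        have "M_extension n ?s i = (\<lambda>i\<in>omega. i) i" if "i \<in> supp ?K y" for i
        proof -
          have "i \<in> {1..m}" "i \<in> {1..n}" using that y'(2) n by auto
          then show ?thesis using f(2) by (simp add: shift_above_def omega_def)
        qed
        then show ?thesis
          using mact_cong[OF tame_colim_mset[OF Y] y'(1) f(1) M_set_idn] by simp
      qed
      also have "\<dots> = y"
        using omega_act_fixed[OF Y M_set_idn _ x(1)] x(2) by (simp add: omega_def)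
      finally have fixed: "omega_act Y (M_extension n ?s) y = y" .
      have bound: "M_extension n ?s ` {1..n} \<subseteq> {1..?p}"
        using f(2) hom_I_mem[OF s] by (metis image_subsetI)
      have "restrict (M_extension n ?s) {1..n} = ?s"
        using s f(2) by (intro extensionalityI[of _ "{1..n}"]) (simp_all add: hom_I_iff PiE_def)
      then have "germ Y n x = germ Y ?p (farr Y n ?p ?s x)"
        using omega_act_germ[OF Y f(1) bound x(1)] fixed x(2) by simp
      then have "farr Y n ?p (I_incl n) x = farr Y n ?p ?s x"
        using x(1) iset_arr[OF Y s x(1)] by (intro germ_eq) auto
      \<comment> \<open>Flatness turns the amalgam square into a pullback of sets, in which (x, x)
        is a compatible pair. Its preimage at stage \<open>m\<close> represents
        \<open>y\<close>.\<close>
      moreover have "is_pullback set_cat (fob Y m) (fob Y n) (fob Y n) (fob Y ?p)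
          (farr Y m n (I_incl m)) (farr Y m n (I_incl m)) (farr Y n ?p (I_incl n)) (farr Y n ?p ?s)"
        using flat shift_above_pullback[OF n] unfolding flat_iset_def by blast
      ultimately obtain z where z: "z \<in> fob Y m" "farr Y m n (I_incl m) z = x"
        unfolding pullback_set_iff using x(1) by blast
      have "germ Y m z = y" using germ_incl[OF Y n z(1)] z(2) x(2) by simp
      then show "y \<in> unit_iset Y m ` fob Y m" using z(1) by (auto simp: unit_iset_def)
    qed
  qed
qed

section \<open>I-spaces and tame M-spaces\<close>

lemma inv_hom_functor_set:
  assumes C: "category C" "ob C = UNIV" and t: "t \<in> hom (functor_cat C set_cat) Y Z"
    and bij: "\<And>x. bij_betw (t x) (fob Y x) (fob Z x)"
  shows "(\<lambda>x. restrict (inv_into (fob Y x) (t x)) (fob Z x)) \<in> hom (functor_cat C set_cat) Z Y"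
proof -
  have inv: "inv_into (fob Y x) (t x) v \<in> fob Y x" "t x (inv_into (fob Y x) (t x) v) = v"
    if "v \<in> fob Z x" for x v
    using bij_betw_apply[OF bij_betw_inv_into[OF bij] that] bij_betw_inv_into_right[OF bij that] .
  have inv_t: "inv_into (fob Y x) (t x) (t x u) = u" if "u \<in> fob Y x" for x u
    using bij_betw_inv_into_left[OF bij that] .
  have Y: "Y \<in> ob (functor_cat C set_cat)" and Z: "Z \<in> ob (functor_cat C set_cat)"
    and nat: "\<And>x y f u. f \<in> hom C x y \<Longrightarrow> u \<in> fob Y x \<Longrightarrow> t y (farr Y x y f u) = farr Z x y f (t x u)"
    using t C by (simp_all add: hom_functor_set_iff)
  have mem: "farr Y x y f u \<in> fob Y y" if "f \<in> hom C x y" "u \<in> fob Y x" for x y f u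
    using Y that C unfolding ob_functor_set_iff[OF C(1)] by (blast dest: PiE_mem)
  have memZ: "farr Z x y f v \<in> fob Z y" if "f \<in> hom C x y" "v \<in> fob Z x" for x y f v
    using Z that C unfolding ob_functor_set_iff[OF C(1)] by (blast dest: PiE_mem)
  have "inv_into (fob Y y) (t y) (farr Z x y f v) = farr Y x y f (inv_into (fob Y x) (t x) v)"
    if f: "f \<in> hom C x y" and v: "v \<in> fob Z x" for x y f v
    using inv_t[OF mem[OF f inv(1)[OF v]]] nat[OF f inv(1)[OF v]] inv(2)[OF v] by simp
  then show ?thesis
    using C(2) Y Z inv(1) memZ by (simp add: hom_functor_set_iff[OF C(1)])
qed

lemma inv_hom_sset:
  assumes "t \<in> hom sset_cat Y Z" "\<And>q. bij_betw (t q) (fob Y q) (fob Z q)"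
  shows "(\<lambda>q. restrict (inv_into (fob Y q) (t q)) (fob Z q)) \<in> hom sset_cat Z Y"
  using assms unfolding sset_cat_def
  by (intro inv_hom_functor_set category_op_cat category_simplex_cat) auto

lemma inv_hom_iset:
  assumes "t \<in> hom iset_cat Y Z" "\<And>m. bij_betw (t m) (fob Y m) (fob Z m)"
  shows "(\<lambda>m. restrict (inv_into (fob Y m) (t m)) (fob Z m)) \<in> hom iset_cat Z Y"
  using assms unfolding iset_cat_def
  by (intro inv_hom_functor_set category_I_cat) auto

lemma compose_restrict_inv_into:
  assumes "bij_betw f A B"
  shows "compose A (restrict (inv_into A f) B) f = (\<lambda>x\<in>A. x)"
    "compose B f (restrict (inv_into A f) B) = (\<lambda>x\<in>B. x)"
  using assms bij_betw_apply[OF assms]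
  by (auto simp: compose_def fun_eq_iff bij_betw_inv_into_left bij_betw_inv_into_right)

lemma bij_betw_compose_inverse:
  assumes "f \<in> A \<rightarrow>\<^sub>E B" "g \<in> B \<rightarrow>\<^sub>E A" "compose A g f = (\<lambda>x\<in>A. x)" "compose B f g = (\<lambda>x\<in>B. x)"
  shows "bij_betw f A B"
proof (rule bij_betw_byWitness)
  show "\<forall>x\<in>A. g (f x) = x" using assms(3) by (metis compose_eq restrict_apply')
  show "\<forall>x\<in>B. f (g x) = x" using assms(4) by (metis compose_eq restrict_apply')
qed (use assms in \<open>auto dest: PiE_mem\<close>)

lemma is_iso_mspaceI:
  assumes \<phi>: "\<phi> \<in> hom mspace_cat V W" and V: "V \<in> ob mspace_cat"
    and bij: "\<And>q. bij_betw (\<phi> q) (fob (msset V) q) (fob (msset W) q)"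
  shows "is_iso mspace_cat V W \<phi>"
proof -
  define \<psi> where "\<psi> = (\<lambda>q. restrict (inv_into (fob (msset V) q) (\<phi> q)) (fob (msset W) q))"
  have "\<psi> \<in> hom sset_cat (msset W) (msset V)"
    unfolding \<psi>_def using \<phi> bij by (intro inv_hom_sset) (auto simp: hom_mspace_iff)
  moreover have "\<psi> q (mspact W f q v) = mspact V f q (\<psi> q v)"
    if f: "f \<in> M_set" and v: "v \<in> fob (msset W) q" for f q v
  proof -
    obtain u where u: "u \<in> fob (msset V) q" "v = \<phi> q u"
      using bij_betw_imp_surj_on[OF bij[of q]] v by blast
    have "is_mset (mset_simplices V q)" using V by (simp add: ob_mspace_iff)
    then have fu: "mspact V f q u \<in> fob (msset V) q"
      using mact_mem[of "mset_simplices V q" f u] f u by simp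
    have inv: "\<psi> q (\<phi> q w) = w" if "w \<in> fob (msset V) q" for w
      using that bij_betw_inv_into_left[OF bij that] bij_betw_apply[OF bij that] by (simp add: \<psi>_def)
    have "\<phi> q (mspact V f q u) = mspact W f q (\<phi> q u)"
      using \<phi> f u by (simp add: hom_mspace_iff)
    then show ?thesis using inv[OF fu] inv[OF u(1)] u(2) by simp
  qed
  ultimately have "\<psi> \<in> hom mspace_cat W V"
    by (simp add: hom_mspace_iff)
  moreover have "cmp mspace_cat V W V \<psi> \<phi> = idn mspace_cat V" "cmp mspace_cat W V W \<phi> \<psi> = idn mspace_cat W"
    using compose_restrict_inv_into[OF bij]
    by (simp_all add: cmp_mspace idn_mspace \<psi>_def)
  ultimately show ?thesis
    unfolding is_iso_def using \<phi> by blast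
qed

text \<open>Naturality of a degreewise inverse is automatic, in the simplicial variable and in I.
  Both directions serve (iii): a flat X has a degreewise bijective unit, and an isomorphism yields
  the bijections along which flatness is transported.\<close>

lemma is_iso_ispace_iff:
  "is_iso ispace_cat X Z \<phi> \<longleftrightarrow> \<phi> \<in> hom ispace_cat X Z \<and>
    (\<forall>m q. bij_betw (\<phi> m q) (fob (fob X m) q) (fob (fob Z m) q))"
proof safe
  assume iso: "is_iso ispace_cat X Z \<phi>"
  then show \<phi>: "\<phi> \<in> hom ispace_cat X Z" by (simp add: is_iso_def)
  fix m q
  obtain \<psi> where \<psi>: "\<psi> \<in> hom ispace_cat Z X" "cmp ispace_cat X Z X \<psi> \<phi> = idn ispace_cat X"
    "cmp ispace_cat Z X Z \<phi> \<psi> = idn ispace_cat Z"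
    using iso by (auto simp: is_iso_def)
  show "bij_betw (\<phi> m q) (fob (fob X m) q) (fob (fob Z m) q)"
  proof (rule bij_betw_compose_inverse)
    show "\<phi> m q \<in> fob (fob X m) q \<rightarrow>\<^sub>E fob (fob Z m) q" "\<psi> m q \<in> fob (fob Z m) q \<rightarrow>\<^sub>E fob (fob X m) q"
      using \<phi> \<psi>(1) unfolding hom_ispace_iff hom_sset_iff by blast+
    show "compose (fob (fob X m) q) (\<psi> m q) (\<phi> m q) = (\<lambda>x\<in>fob (fob X m) q. x)"
      "compose (fob (fob Z m) q) (\<phi> m q) (\<psi> m q) = (\<lambda>x\<in>fob (fob Z m) q. x)"
      using \<psi>(2,3)[THEN fun_cong, THEN fun_cong, of m q] by (simp_all add: cmp_ispace idn_ispace)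
  qed
next
  assume \<phi>: "\<phi> \<in> hom ispace_cat X Z"
    and bij: "\<forall>m q. bij_betw (\<phi> m q) (fob (fob X m) q) (fob (fob Z m) q)"
  define \<psi> where "\<psi> = (\<lambda>m q. restrict (inv_into (fob (fob X m) q) (\<phi> m q)) (fob (fob Z m) q))"
  have "\<psi> m \<in> hom sset_cat (fob Z m) (fob X m)" for m
    unfolding \<psi>_def using \<phi> bij by (intro inv_hom_sset) (auto simp: hom_ispace_iff)
  moreover have "(\<lambda>m. \<psi> m q) \<in> hom iset_cat (iset_simplices Z q) (iset_simplices X q)" for q
    using inv_hom_iset[of "\<lambda>m. \<phi> m q" "iset_simplices X q" "iset_simplices Z q"] \<phi> bij
    by (simp add: hom_ispace_iff \<psi>_def)
  ultimately have "\<psi> \<in> hom ispace_cat Z X"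
    using \<phi> by (simp add: hom_ispace_iff)
  moreover have "cmp ispace_cat X Z X \<psi> \<phi> = idn ispace_cat X" "cmp ispace_cat Z X Z \<phi> \<psi> = idn ispace_cat Z"
    using compose_restrict_inv_into[OF bij[rule_format]]
    by (simp_all add: cmp_ispace idn_ispace \<psi>_def)
  ultimately show "is_iso ispace_cat X Z \<phi>"
    unfolding is_iso_def using \<phi> by blast
qed

text \<open>Every element of the colimit is a germ; functor laws and the triangle identity on
  X(\<omega>) thereby reduce to computations with \<open>colim_map_germ\<close>.\<close>

lemma colim_N_extensionalityI:
  assumes "f \<in> extensional (colim_N Y)" "g \<in> extensional (colim_N Y)"
    and "\<And>m x. x \<in> fob Y m \<Longrightarrow> f (germ Y m x) = g (germ Y m x)"
  shows "f = g"
  using assms(3) by (intro extensionalityI[OF assms(1,2)]) (metis colim_N_cases)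

lemma colim_map_extensional: "colim_map Y Z t \<in> extensional (colim_N Y)"
  by (simp add: colim_map_def)

lemma colim_map_idn:
  assumes "(\<lambda>m. \<lambda>x\<in>fob Y m. x) \<in> hom iset_cat Y Y"
  shows "colim_map Y Y (\<lambda>m. \<lambda>x\<in>fob Y m. x) = (\<lambda>y\<in>colim_N Y. y)"
  by (rule colim_N_extensionalityI[of _ Y])
    (simp_all add: colim_map_extensional colim_map_germ[OF assms] germ_mem)

lemma colim_map_cmp:
  assumes "s \<in> hom iset_cat X Y" "t \<in> hom iset_cat Y Z" "(\<lambda>m. compose (fob X m) (t m) (s m)) \<in> hom iset_cat X Z"
  shows "colim_map X Z (\<lambda>m. compose (fob X m) (t m) (s m)) =
    compose (colim_N X) (colim_map Y Z t) (colim_map X Y s)"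
  by (rule colim_N_extensionalityI[of _ X])
    (simp_all add: colim_map_extensional colim_map_germ[OF assms(1)] colim_map_germ[OF assms(2)]
      colim_map_germ[OF assms(3)] germ_mem compose_eq iset_hom_mem[OF assms(1)])

lemma ispace_iset: "X \<in> ob ispace_cat \<Longrightarrow> iset_simplices X q \<in> ob iset_cat"
  by (simp add: ob_ispace_iff)

lemma ispace_sset: "X \<in> ob ispace_cat \<Longrightarrow> fob X m \<in> ob sset_cat"
  by (simp add: ob_ispace_iff)

text \<open>The commutation clause of \<open>ob_ispace_iff\<close> is read here for a fixed
  \<theta>; this makes \<open>colim_map\<close> applicable to the simplicial operators.\<close>

lemma ispace_simplicial_hom:
  assumes X: "X \<in> ob ispace_cat" and \<theta>: "\<theta> \<in> hom simplex_cat p q"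
  shows "(\<lambda>m. farr (fob X m) q p \<theta>) \<in> hom iset_cat (iset_simplices X q) (iset_simplices X p)"
proof -
  have "farr (fob X m) q p \<theta> \<in> fob (fob X m) q \<rightarrow>\<^sub>E fob (fob X m) p" for m
    using ispace_sset[OF X, of m] \<theta> unfolding ob_sset_iff by blast
  then show ?thesis
    using X \<theta> unfolding hom_iset_iff by (simp add: ob_ispace_iff)
qed

lemma ispace_hom_iset:
  "\<phi> \<in> hom ispace_cat X Z \<Longrightarrow> (\<lambda>m. \<phi> m q) \<in> hom iset_cat (iset_simplices X q) (iset_simplices Z q)"
  by (simp add: hom_ispace_iff)

text \<open>Simplicial operators do not enlarge supports, so in the passage to
  \<open>W\<^sub>\<bullet>\<close> they may be restricted to each \<open>W\<^sub>m\<close>.\<close>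

lemma mspace_equivariant_simplicial:
  assumes "W \<in> ob mspace_cat" "\<theta> \<in> hom simplex_cat p q"
  shows "equivariant (mset_simplices W q) (mset_simplices W p) (farr (msset W) q p \<theta>)"
proof -
  have "farr (msset W) q p \<theta> \<in> fob (msset W) q \<rightarrow>\<^sub>E fob (msset W) p"
    using assms unfolding ob_mspace_iff ob_sset_iff by blast
  then show ?thesis
    using assms unfolding equivariant_def ob_mspace_iff by (auto simp: PiE_def)
qed

lemma mspace_hom_equivariant:
  assumes "\<phi> \<in> hom mspace_cat V W"
  shows "equivariant (mset_simplices V q) (mset_simplices W q) (\<phi> q)"
proof -
  have "\<phi> q \<in> fob (msset V) q \<rightarrow>\<^sub>E fob (msset W) q"
    using assms unfolding hom_mspace_iff hom_sset_iff by blast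
  then show ?thesis
    using assms unfolding equivariant_def hom_mspace_iff by (auto simp: PiE_def)
qed

section \<open>X(\<omega>) as a functor of X\<close>

lemma omega_ob_simps [simp]:
  "mset_simplices (omega_ob X) q = colim_mset (iset_simplices X q)"
  "fob (msset (omega_ob X)) q = colim_N (iset_simplices X q)"
  "farr (msset (omega_ob X)) q p \<theta> =
    colim_map (iset_simplices X q) (iset_simplices X p) (\<lambda>m. farr (fob X m) q p \<theta>)"
  "mspact (omega_ob X) f q = omega_act (iset_simplices X q) f"
  by (simp_all add: omega_ob_def mset_simplices_def colim_mset_def)

lemma omega_functor_simps [simp]:
  "fob omega_functor X = omega_ob X"
  "farr omega_functor X Z \<phi> = (\<lambda>q. colim_map (iset_simplices X q) (iset_simplices Z q) (\<lambda>m. \<phi> m q))"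
  by (simp_all add: omega_functor_def)

lemma omega_ob_mspace:
  assumes X: "X \<in> ob ispace_cat" shows "omega_ob X \<in> ob tame_mspace_cat"
proof -
  let ?X = "iset_simplices X" and ?F = "\<lambda>q p \<theta> m. farr (fob X m) q p \<theta>"
  note hom = ispace_simplicial_hom[OF X]
  have idn: "idn simplex_cat q \<in> hom simplex_cat q q" for q
    using category.idn_hom[OF category_simplex_cat, of q] by (simp add: simplex_cat_def)
  have cmp: "cmp simplex_cat r p q \<theta> \<chi> \<in> hom simplex_cat r q"
    if "\<theta> \<in> hom simplex_cat p q" "\<chi> \<in> hom simplex_cat r p" for p q r \<theta> \<chi>
    using category.cmp_hom[OF category_simplex_cat _ _ _ that(2,1)] by (simp add: simplex_cat_def)
  have "colim_map (?X q) (?X q) (?F q q (idn simplex_cat q)) y = y" if y: "y \<in> colim_N (?X q)" for q y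
  proof -
    from y obtain m x where x: "x \<in> fob (?X q) m" "y = germ (?X q) m x" by (rule colim_N_cases)
    show ?thesis
      unfolding x(2) colim_map_germ[OF hom[OF idn] x(1)]
      using ispace_sset[OF X, of m] x(1) by (simp add: ob_sset_iff)
  qed
  moreover have "colim_map (?X q) (?X r) (?F q r (cmp simplex_cat r p q \<theta> \<chi>)) y =
      colim_map (?X p) (?X r) (?F p r \<chi>) (colim_map (?X q) (?X p) (?F q p \<theta>) y)"
    if \<theta>: "\<theta> \<in> hom simplex_cat p q" and \<chi>: "\<chi> \<in> hom simplex_cat r p" and y: "y \<in> colim_N (?X q)"
    for p q r \<theta> \<chi> y
  proof -
    from y obtain m x where x: "x \<in> fob (?X q) m" "y = germ (?X q) m x" by (rule colim_N_cases)
    show ?thesis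
      unfolding x(2) colim_map_germ[OF hom[OF cmp[OF \<theta> \<chi>]] x(1)] colim_map_germ[OF hom[OF \<theta>] x(1)]
        colim_map_germ[OF hom[OF \<chi>] iset_hom_mem[OF hom[OF \<theta>] x(1)]]
      using ispace_sset[OF X, of m] x(1) \<theta> \<chi> by (simp add: ob_sset_iff)
  qed
  ultimately have "msset (omega_ob X) \<in> ob sset_cat"
    unfolding ob_sset_iff omega_ob_simps using colim_map_PiE[OF hom] by blast
  moreover have "omega_act (?X p) f (colim_map (?X q) (?X p) (?F q p \<theta>) y) =
      colim_map (?X q) (?X p) (?F q p \<theta>) (omega_act (?X q) f y)"
    if "f \<in> M_set" "\<theta> \<in> hom simplex_cat p q" "y \<in> colim_N (?X q)" for f p q \<theta> y
    using equivariant_colim_map[OF hom[OF that(2)]] that by (simp add: equivariant_def)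
  moreover have "omega_act (?X q) f \<in> extensional (colim_N (?X q))" for f q
    by (simp add: omega_act_def)
  moreover note tame = tame_colim_mset[OF ispace_iset[OF X]]
  ultimately have "omega_ob X \<in> ob mspace_cat"
    unfolding ob_mspace_iff by (simp add: tame_mset_def)
  then show ?thesis
    using tame by (simp add: tame_mspace_cat_def tame_mspace_def)
qed

lemma tame_mspace_cat_simps [simp]:
  "hom tame_mspace_cat = hom mspace_cat" "idn tame_mspace_cat = idn mspace_cat"
  "cmp tame_mspace_cat = cmp mspace_cat" "is_iso tame_mspace_cat = is_iso mspace_cat"
  by (simp_all add: tame_mspace_cat_def fun_eq_iff)

lemma ob_tame_mspaceD:
  assumes "W \<in> ob tame_mspace_cat"
  shows "W \<in> ob mspace_cat" "tame_mset (mset_simplices W q)" "msset W \<in> ob sset_cat"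
  using assms by (auto simp: tame_mspace_cat_def tame_mspace_def ob_mspace_iff)

lemma omega_hom:
  assumes \<phi>: "\<phi> \<in> hom ispace_cat X Z"
  shows "farr omega_functor X Z \<phi> \<in> hom mspace_cat (omega_ob X) (omega_ob Z)"
proof -
  have X: "X \<in> ob ispace_cat" and Z: "Z \<in> ob ispace_cat" using \<phi> by (simp_all add: hom_ispace_iff)
  let ?X = "iset_simplices X" and ?Z = "iset_simplices Z"
  note hom = ispace_hom_iset[OF \<phi>]
  have "colim_map (?X p) (?Z p) (\<lambda>m. \<phi> m p) (colim_map (?X q) (?X p) (\<lambda>m. farr (fob X m) q p \<theta>) y) =
      colim_map (?Z q) (?Z p) (\<lambda>m. farr (fob Z m) q p \<theta>) (colim_map (?X q) (?Z q) (\<lambda>m. \<phi> m q) y)"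
    if \<theta>: "\<theta> \<in> hom simplex_cat p q" and y: "y \<in> colim_N (?X q)" for p q \<theta> y
  proof -
    from y obtain m x where x: "x \<in> fob (?X q) m" "y = germ (?X q) m x" by (rule colim_N_cases)
    note hX = ispace_simplicial_hom[OF X \<theta>] and hZ = ispace_simplicial_hom[OF Z \<theta>]
    have "\<phi> m p (farr (fob X m) q p \<theta> x) = farr (fob Z m) q p \<theta> (\<phi> m q x)"
      using \<phi> x(1) \<theta> by (simp add: hom_ispace_iff hom_sset_iff)
    then show ?thesis
      unfolding x(2) colim_map_germ[OF hX x(1)] colim_map_germ[OF hom x(1)]
        colim_map_germ[OF hom iset_hom_mem[OF hX x(1)]] colim_map_germ[OF hZ iset_hom_mem[OF hom x(1)]]
      by simp
  qed
  moreover have "colim_map (?X q) (?Z q) (\<lambda>m. \<phi> m q) (omega_act (?X q) f y) =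
      omega_act (?Z q) f (colim_map (?X q) (?Z q) (\<lambda>m. \<phi> m q) y)"
    if "f \<in> M_set" "y \<in> colim_N (?X q)" for f q y
    using equivariant_colim_map[OF hom] that by (simp add: equivariant_def)
  ultimately show ?thesis
    using omega_ob_mspace[OF X, THEN ob_tame_mspaceD(3)] omega_ob_mspace[OF Z, THEN ob_tame_mspaceD(3)]
      colim_map_PiE[OF hom]
    unfolding hom_mspace_iff hom_sset_iff omega_functor_simps omega_ob_simps by blast
qed

lemma category_tame_mspace_cat: "category tame_mspace_cat"
  unfolding tame_mspace_cat_def by (intro category_full_subcat category_mspace_cat)

lemma idn_ispace_hom: "X \<in> ob ispace_cat \<Longrightarrow> idn ispace_cat X \<in> hom ispace_cat X X"
  by (rule category.idn_hom[OF category_ispace_cat])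

lemma cmp_ispace_hom:
  assumes "\<phi> \<in> hom ispace_cat X Y" "\<psi> \<in> hom ispace_cat Y Z"
  shows "cmp ispace_cat X Y Z \<psi> \<phi> \<in> hom ispace_cat X Z"
  using assms by (intro category.cmp_hom[OF category_ispace_cat]) (simp_all add: hom_ispace_iff)

lemma cat_functor_omega: "cat_functor ispace_cat tame_mspace_cat omega_functor"
proof (intro cat_functor.intro cat_functor_axioms.intro category_ispace_cat category_tame_mspace_cat)
  fix X :: "'a ispace" assume X: "X \<in> ob ispace_cat"
  then show "fob omega_functor X \<in> ob tame_mspace_cat" by (simp add: omega_ob_mspace)
  show "farr omega_functor X X (idn ispace_cat X) = idn tame_mspace_cat (fob omega_functor X)"
    using colim_map_idn[of "iset_simplices X q" for q] ispace_hom_iset[OF idn_ispace_hom[OF X]]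
    by (simp add: idn_ispace idn_mspace)
next
  fix X Y :: "'a ispace" and \<phi> assume "\<phi> \<in> hom ispace_cat X Y"
  then show "farr omega_functor X Y \<phi> \<in> hom tame_mspace_cat (fob omega_functor X) (fob omega_functor Y)"
    using omega_hom by simp
next
  fix X Y Z :: "'a ispace" and \<phi> \<psi> assume \<phi>: "\<phi> \<in> hom ispace_cat X Y" and \<psi>: "\<psi> \<in> hom ispace_cat Y Z"
  have "colim_map (iset_simplices X q) (iset_simplices Z q)
      (\<lambda>m. compose (fob (fob X m) q) (\<psi> m q) (\<phi> m q)) =
    compose (colim_N (iset_simplices X q)) (colim_map (iset_simplices Y q) (iset_simplices Z q) (\<lambda>m. \<psi> m q))
      (colim_map (iset_simplices X q) (iset_simplices Y q) (\<lambda>m. \<phi> m q))" for q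
    using colim_map_cmp[OF ispace_hom_iset[OF \<phi>, of q] ispace_hom_iset[OF \<psi>, of q]]
      ispace_hom_iset[OF cmp_ispace_hom[OF \<phi> \<psi>], of q]
    by (simp add: cmp_ispace)
  then show "farr omega_functor X Z (cmp ispace_cat X Y Z \<psi> \<phi>) =
      cmp tame_mspace_cat (fob omega_functor X) (fob omega_functor Y) (fob omega_functor Z)
        (farr omega_functor Y Z \<psi>) (farr omega_functor X Y \<phi>)"
    by (simp add: cmp_ispace cmp_mspace)
qed

section \<open>\<open>W\<^sub>\<bullet>\<close> as a functor of \<open>W\<close>\<close>

lemma bullet_ob_simps [simp]:
  "iset_simplices (bullet_ob W) q = bullet_iset (mset_simplices W q)"
  "fob (fob (bullet_ob W) m) q = fob (bullet_iset (mset_simplices W q)) m"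
  "farr (fob (bullet_ob W) m) q p \<theta> =
    restrict (farr (msset W) q p \<theta>) (fob (bullet_iset (mset_simplices W q)) m)"
  "farr (bullet_ob W) m n \<alpha> q = farr (bullet_iset (mset_simplices W q)) m n \<alpha>"
  by (simp_all add: bullet_ob_def iset_simplices_def bullet_iset_def)

lemma bullet_functor_simps [simp]:
  "fob bullet_functor W = bullet_ob W"
  "farr bullet_functor V W \<phi> = (\<lambda>m q. restrict (\<phi> q) (fob (bullet_iset (mset_simplices V q)) m))"
  by (simp_all add: bullet_functor_def)

lemma bullet_ob_ispace:
  assumes W: "W \<in> ob tame_mspace_cat" shows "bullet_ob W \<in> ob ispace_cat"
proof -
  note W' = ob_tame_mspaceD[OF W]
  let ?B = "\<lambda>q. bullet_iset (mset_simplices W q)"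
  let ?r = "\<lambda>q p \<theta> m. restrict (farr (msset W) q p \<theta>) (fob (?B q) m)"
  have hom: "?r q p \<theta> \<in> hom iset_cat (?B q) (?B p)" if "\<theta> \<in> hom simplex_cat p q" for p q \<theta>
    by (rule restrict_equivariant_hom_bullet[OF W'(2,2) mspace_equivariant_simplicial[OF W'(1) that]])
  have arr: "?r q p \<theta> m \<in> fob (?B q) m \<rightarrow>\<^sub>E fob (?B p) m" if "\<theta> \<in> hom simplex_cat p q" for p q \<theta> m
    using hom[OF that] unfolding hom_iset_iff by blast
  have nat: "farr (?B p) m n \<alpha> (?r q p \<theta> m x) = ?r q p \<theta> n (farr (?B q) m n \<alpha> x)"
    if "\<alpha> \<in> hom I_cat m n" "\<theta> \<in> hom simplex_cat p q" "x \<in> fob (?B q) m" for m n \<alpha> p q \<theta> x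
    using iset_hom_natural[OF hom[OF that(2)] that(1,3)] by simp
  have "?r q q (idn simplex_cat q) m x = x" if "x \<in> fob (?B q) m" for q m x
    using W'(3) that by (simp add: ob_sset_iff)
  moreover have "?r q r (cmp simplex_cat r p q \<theta> \<chi>) m x = ?r p r \<chi> m (?r q p \<theta> m x)"
    if \<theta>: "\<theta> \<in> hom simplex_cat p q" and \<chi>: "\<chi> \<in> hom simplex_cat r p" and x: "x \<in> fob (?B q) m"
    for p q r \<theta> \<chi> m x
  proof -
    \<comment> \<open>The two restricted operators compose correctly because the inner one stays
      within the bounded supports; outside them the outer restriction would return
      \<open>undefined\<close>.\<close>
    have "farr (msset W) q p \<theta> x \<in> fob (?B p) m" using PiE_mem[OF arr[OF \<theta>] x] x by simp
    then show ?thesis using W'(3) x \<theta> \<chi> by (simp add: ob_sset_iff)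
  qed
  ultimately have "fob (bullet_ob W) m \<in> ob sset_cat" for m
    unfolding ob_sset_iff bullet_ob_simps using arr by blast
  then show ?thesis
    unfolding ob_ispace_iff bullet_ob_simps using bullet_iset_ob[OF W'(2)] nat by metis
qed

lemma bullet_hom:
  assumes V: "V \<in> ob tame_mspace_cat" and W: "W \<in> ob tame_mspace_cat" and \<phi>: "\<phi> \<in> hom mspace_cat V W"
  shows "farr bullet_functor V W \<phi> \<in> hom ispace_cat (bullet_ob V) (bullet_ob W)"
proof -
  note V' = ob_tame_mspaceD[OF V] and W' = ob_tame_mspaceD[OF W]
  let ?V = "\<lambda>q. bullet_iset (mset_simplices V q)" and ?W = "\<lambda>q. bullet_iset (mset_simplices W q)"
  have hom: "(\<lambda>m. restrict (\<phi> q) (fob (?V q) m)) \<in> hom iset_cat (?V q) (?W q)" for q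
    by (rule restrict_equivariant_hom_bullet[OF V'(2) W'(2) mspace_hom_equivariant[OF \<phi>]])
  have arr: "restrict (\<phi> q) (fob (?V q) m) \<in> fob (?V q) m \<rightarrow>\<^sub>E fob (?W q) m" for q m
    using hom[of q] unfolding hom_iset_iff by blast
  have "restrict (\<phi> p) (fob (?V p) m) (restrict (farr (msset V) q p \<theta>) (fob (?V q) m) x) =
      restrict (farr (msset W) q p \<theta>) (fob (?W q) m) (restrict (\<phi> q) (fob (?V q) m) x)"
    if \<theta>: "\<theta> \<in> hom simplex_cat p q" and x: "x \<in> fob (?V q) m" for p q \<theta> m x
  proof -
    have "\<phi> q x \<in> fob (?W q) m" using PiE_mem[OF arr x] x by simp
    moreover have "farr (msset V) q p \<theta> x \<in> fob (?V p) m"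
      using iset_hom_mem[OF ispace_simplicial_hom[OF bullet_ob_ispace[OF V] \<theta>], of x m] x by simp
    moreover have "x \<in> fob (msset V) q" using x by simp
    then have "\<phi> p (farr (msset V) q p \<theta> x) = farr (msset W) q p \<theta> (\<phi> q x)"
      using \<phi> \<theta> by (simp add: hom_mspace_iff hom_sset_iff)
    ultimately show ?thesis using x by simp
  qed
  then have "farr bullet_functor V W \<phi> m \<in> hom sset_cat (fob (bullet_ob V) m) (fob (bullet_ob W) m)" for m
    using ispace_sset[OF bullet_ob_ispace[OF V]] ispace_sset[OF bullet_ob_ispace[OF W]] arr
    unfolding hom_sset_iff bullet_functor_simps bullet_ob_simps by blast
  then show ?thesis
    using bullet_ob_ispace[OF V] bullet_ob_ispace[OF W] hom
    unfolding hom_ispace_iff bullet_functor_simps bullet_ob_simps by blast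
qed

lemma cat_functor_bullet: "cat_functor tame_mspace_cat ispace_cat bullet_functor"
proof (intro cat_functor.intro cat_functor_axioms.intro category_ispace_cat category_tame_mspace_cat)
  fix W :: "'a mspace" assume W: "W \<in> ob tame_mspace_cat"
  then show "fob bullet_functor W \<in> ob ispace_cat" by (simp add: bullet_ob_ispace)
  show "farr bullet_functor W W (idn tame_mspace_cat W) = idn ispace_cat (fob bullet_functor W)"
    by (auto simp: idn_ispace idn_mspace fun_eq_iff)
next
  fix V W :: "'a mspace" and \<phi>
  assume "V \<in> ob tame_mspace_cat" "W \<in> ob tame_mspace_cat" "\<phi> \<in> hom tame_mspace_cat V W"
  then show "farr bullet_functor V W \<phi> \<in> hom ispace_cat (fob bullet_functor V) (fob bullet_functor W)"
    using bullet_hom[of V W \<phi>] by simp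
next
  fix U V W :: "'a mspace" and \<phi> \<psi> :: "'a smap"
  assume U: "U \<in> ob tame_mspace_cat" and V: "V \<in> ob tame_mspace_cat"
    and \<phi>: "\<phi> \<in> hom tame_mspace_cat U V"
  \<comment> \<open>\<open>\<phi>\<close> preserves the bound on supports, so the restriction of
    \<open>\<psi>\<close> is evaluated inside its domain.\<close>
  have mem: "\<phi> q x \<in> fob (bullet_iset (mset_simplices V q)) m"
    if x: "x \<in> fob (bullet_iset (mset_simplices U q)) m" for q m x
    using iset_hom_mem[OF ispace_hom_iset[OF bullet_hom[OF U V]], of \<phi> x q m] \<phi> x by simp
  have "restrict (compose (fob (msset U) q) (\<psi> q) (\<phi> q)) (fob (bullet_iset (mset_simplices U q)) m) =
      compose (fob (bullet_iset (mset_simplices U q)) m)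
        (restrict (\<psi> q) (fob (bullet_iset (mset_simplices V q)) m))
        (restrict (\<phi> q) (fob (bullet_iset (mset_simplices U q)) m))" for q m
    by (rule extensionalityI[of _ "fob (bullet_iset (mset_simplices U q)) m"])
      (use mem[of _ q m] in \<open>auto simp: compose_def extensional_def\<close>)
  then show "farr bullet_functor U W (cmp tame_mspace_cat U V W \<psi> \<phi>) =
      cmp ispace_cat (fob bullet_functor U) (fob bullet_functor V) (fob bullet_functor W)
        (farr bullet_functor V W \<psi>) (farr bullet_functor U V \<phi>)"
    by (simp add: cmp_ispace cmp_mspace del: fob_bullet)
qed

section \<open>The adjunction\<close>

lemma unit_map_eq: "unit_map X = (\<lambda>m q. unit_iset (iset_simplices X q) m)"
  by (simp add: unit_map_def unit_iset_def)

lemma counit_map_eq: "counit_map W = (\<lambda>q. counit_mset (mset_simplices W q))"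
  by (simp add: counit_map_def counit_mset_def)

lemma unit_map_hom:
  assumes X: "X \<in> ob ispace_cat"
  shows "unit_map X \<in> hom ispace_cat X (ispace_flat X)"
proof -
  have flat: "ispace_flat X \<in> ob ispace_cat"
    using bullet_ob_ispace[OF omega_ob_mspace[OF X]] by simp
  note hom = unit_iset_hom[OF ispace_iset[OF X]]
  have arr: "unit_map X m q \<in> fob (fob X m) q \<rightarrow>\<^sub>E fob (fob (ispace_flat X) m) q" for m q
    using hom[of q] unfolding hom_iset_iff by (simp add: unit_map_eq)
  have "unit_map X m p (farr (fob X m) q p \<theta> x) = farr (fob (ispace_flat X) m) q p \<theta> (unit_map X m q x)"
    if \<theta>: "\<theta> \<in> hom simplex_cat p q" and x: "x \<in> fob (fob X m) q" for p q \<theta> m x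
  proof -
    note h = ispace_simplicial_hom[OF X \<theta>]
    have "farr (fob X m) q p \<theta> x \<in> fob (fob X m) p" using iset_hom_mem[OF h, of x m] x by simp
    moreover have "germ (iset_simplices X q) m x \<in> fob (bullet_iset (colim_mset (iset_simplices X q))) m"
      using germ_mem[of x "iset_simplices X q" m] supp_germ[OF ispace_iset[OF X], of x q m] x by simp
    ultimately show ?thesis
      using x colim_map_germ[OF h, of x m] by (simp add: unit_map_def del: fob_bullet)
  qed
  then have "unit_map X m \<in> hom sset_cat (fob X m) (fob (ispace_flat X) m)" for m
    using ispace_sset[OF X] ispace_sset[OF flat] arr unfolding hom_sset_iff by blast
  then show ?thesis
    unfolding hom_ispace_iff using X flat hom by (simp add: unit_map_eq)
qed

lemma counit_map_hom:
  assumes W: "W \<in> ob tame_mspace_cat"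
  shows "counit_map W \<in> hom mspace_cat (omega_ob (bullet_ob W)) W"
proof -
  note W' = ob_tame_mspaceD[OF W]
  note B = bullet_ob_ispace[OF W]
  let ?B = "\<lambda>q. bullet_iset (mset_simplices W q)"
  note eq = equivariant_counit_mset[OF W'(2)]
  have arr: "counit_map W q \<in> colim_N (?B q) \<rightarrow>\<^sub>E fob (msset W) q" for q
  proof -
    have "counit_mset (mset_simplices W q) \<in> extensional (colim_N (?B q))"
      by (simp add: counit_mset_def)
    then show ?thesis using eq[of q] by (auto simp: equivariant_def counit_map_eq PiE_iff)
  qed
  have "counit_map W p (farr (msset (omega_ob (bullet_ob W))) q p \<theta> y) =
      farr (msset W) q p \<theta> (counit_map W q y)"
    if \<theta>: "\<theta> \<in> hom simplex_cat p q" and y: "y \<in> colim_N (?B q)" for p q \<theta> y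
  proof -
    from y obtain m x where x: "x \<in> fob (?B q) m" "y = germ (?B q) m x" by (rule colim_N_cases)
    note h = ispace_simplicial_hom[OF B \<theta>, unfolded bullet_ob_simps]
    show ?thesis
      unfolding x(2) omega_ob_simps bullet_ob_simps colim_map_germ[OF h x(1)] counit_map_eq
        counit_mset_germ[OF W'(2) iset_hom_mem[OF h x(1)]] counit_mset_germ[OF W'(2) x(1)]
      using x(1) by simp
  qed
  moreover have "counit_map W q (omega_act (?B q) f y) = mspact W f q (counit_map W q y)"
    if "f \<in> M_set" "y \<in> colim_N (?B q)" for f q y
    using eq[of q] that by (simp add: equivariant_def counit_map_eq)
  ultimately show ?thesis
    using W'(3) omega_ob_mspace[OF B, THEN ob_tame_mspaceD(3)] arr
    unfolding hom_mspace_iff hom_sset_iff omega_ob_simps bullet_ob_simps by blast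
qed

lemma counit_map_iso:
  assumes W: "W \<in> ob tame_mspace_cat"
  shows "is_iso mspace_cat (omega_ob (bullet_ob W)) W (counit_map W)"
  using counit_map_hom[OF W] omega_ob_mspace[OF bullet_ob_ispace[OF W], THEN ob_tame_mspaceD(1)]
    bij_betw_counit_mset[OF ob_tame_mspaceD(2)[OF W]]
  by (intro is_iso_mspaceI) (simp_all add: counit_map_eq)

text \<open>At \<open>x\<close> both composites give the germ of
  \<open>\<phi> m q x\<close>.\<close>

lemma unit_map_natural:
  assumes \<phi>: "\<phi> \<in> hom ispace_cat X Z"
  shows "cmp ispace_cat X Z (ispace_flat Z) (unit_map Z) \<phi> =
    cmp ispace_cat X (ispace_flat X) (ispace_flat Z)
      (farr bullet_functor (omega_ob X) (omega_ob Z) (farr omega_functor X Z \<phi>)) (unit_map X)"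
proof -
  have X: "X \<in> ob ispace_cat" using \<phi> by (simp add: hom_ispace_iff)
  have "unit_map Z m q (\<phi> m q x) =
      farr bullet_functor (omega_ob X) (omega_ob Z) (farr omega_functor X Z \<phi>) m q (unit_map X m q x)"
    if x: "x \<in> fob (fob X m) q" for m q x
  proof -
    have "germ (iset_simplices X q) m x \<in> fob (bullet_iset (colim_mset (iset_simplices X q))) m"
      using germ_mem[of x "iset_simplices X q" m] supp_germ[OF ispace_iset[OF X], of x q m] x by simp
    then show ?thesis
      using x colim_map_germ[OF ispace_hom_iset[OF \<phi>], of x q m] iset_hom_mem[OF ispace_hom_iset[OF \<phi>], of x q m]
      by (simp add: unit_map_def del: fob_bullet)
  qed
  then have "compose (fob (fob X m) q) (unit_map Z m q) (\<phi> m q) = compose (fob (fob X m) q)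
      (farr bullet_functor (omega_ob X) (omega_ob Z) (farr omega_functor X Z \<phi>) m q) (unit_map X m q)" for m q
    unfolding compose_eq_compose_iff by blast
  then show ?thesis
    unfolding cmp_ispace by (simp only:)
qed

text \<open>On the germ of \<open>x\<close> both composites give \<open>\<phi> q x\<close>.\<close>

lemma counit_map_natural:
  assumes V: "V \<in> ob tame_mspace_cat" and W: "W \<in> ob tame_mspace_cat" and \<phi>: "\<phi> \<in> hom mspace_cat V W"
  shows "cmp mspace_cat (omega_ob (bullet_ob V)) (omega_ob (bullet_ob W)) W (counit_map W)
      (farr omega_functor (bullet_ob V) (bullet_ob W) (farr bullet_functor V W \<phi>)) =
    cmp mspace_cat (omega_ob (bullet_ob V)) V W \<phi> (counit_map V)"
proof -
  let ?V = "\<lambda>q. bullet_iset (mset_simplices V q)"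
  note V' = ob_tame_mspaceD[OF V] and W' = ob_tame_mspaceD[OF W]
  have "counit_map W q (farr omega_functor (bullet_ob V) (bullet_ob W) (farr bullet_functor V W \<phi>) q y) =
      \<phi> q (counit_map V q y)" if y: "y \<in> colim_N (?V q)" for q y
  proof -
    from y obtain m x where x: "x \<in> fob (?V q) m" "y = germ (?V q) m x" by (rule colim_N_cases)
    note h = ispace_hom_iset[OF bullet_hom[OF V W \<phi>], unfolded bullet_ob_simps bullet_functor_simps]
    show ?thesis
      unfolding x(2) omega_functor_simps bullet_ob_simps bullet_functor_simps colim_map_germ[OF h x(1)]
        counit_map_eq counit_mset_germ[OF W'(2) iset_hom_mem[OF h x(1)]] counit_mset_germ[OF V'(2) x(1)]
      using x(1) by simp
  qed
  then show ?thesis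
    unfolding cmp_mspace fun_compose_eq_iff omega_ob_simps bullet_ob_simps by blast
qed

lemma nat_trans_unit_map:
  "nat_trans ispace_cat ispace_cat id_functor (comp_functor bullet_functor omega_functor) unit_map"
proof (intro nat_trans.intro nat_trans_axioms.intro cat_functor_id category_ispace_cat
    cat_functor_comp[OF cat_functor_omega cat_functor_bullet])
  fix X :: "'a ispace" assume "X \<in> ob ispace_cat"
  then show "unit_map X \<in> hom ispace_cat (fob id_functor X) (fob (comp_functor bullet_functor omega_functor) X)"
    using unit_map_hom[of X] by (simp add: id_functor_def comp_functor_def)
next
  fix X Z :: "'a ispace" and \<phi> assume "\<phi> \<in> hom ispace_cat X Z"
  from unit_map_natural[OF this]
  show "cmp ispace_cat (fob id_functor X) (fob id_functor Z) (fob (comp_functor bullet_functor omega_functor) Z)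
      (unit_map Z) (farr id_functor X Z \<phi>) =
    cmp ispace_cat (fob id_functor X) (fob (comp_functor bullet_functor omega_functor) X)
      (fob (comp_functor bullet_functor omega_functor) Z)
      (farr (comp_functor bullet_functor omega_functor) X Z \<phi>) (unit_map X)"
    by (simp add: id_functor_def comp_functor_def)
qed

lemma nat_trans_counit_map:
  "nat_trans tame_mspace_cat tame_mspace_cat (comp_functor omega_functor bullet_functor) id_functor counit_map"
proof (intro nat_trans.intro nat_trans_axioms.intro cat_functor_id category_tame_mspace_cat
    cat_functor_comp[OF cat_functor_bullet cat_functor_omega])
  fix W :: "'a mspace" assume "W \<in> ob tame_mspace_cat"
  then show "counit_map W \<in> hom tame_mspace_cat (fob (comp_functor omega_functor bullet_functor) W) (fob id_functor W)"
    using counit_map_hom[of W] by (simp add: id_functor_def comp_functor_def)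
next
  fix V W :: "'a mspace" and \<phi>
  assume "V \<in> ob tame_mspace_cat" "W \<in> ob tame_mspace_cat" "\<phi> \<in> hom tame_mspace_cat V W"
  then show "cmp tame_mspace_cat (fob (comp_functor omega_functor bullet_functor) V)
      (fob (comp_functor omega_functor bullet_functor) W) (fob id_functor W)
      (counit_map W) (farr (comp_functor omega_functor bullet_functor) V W \<phi>) =
    cmp tame_mspace_cat (fob (comp_functor omega_functor bullet_functor) V) (fob id_functor V) (fob id_functor W)
      (farr id_functor V W \<phi>) (counit_map V)"
    using counit_map_natural[of V W \<phi>] by (simp add: id_functor_def comp_functor_def)
qed

text \<open>The unit sends the germ of \<open>x\<close> to the germ of that germ, and the counit
  removes the outer one. The identity is proved apart because it serves twice: in the adjunction,
  and in (ii), where it presents \<eta>_X(\<omega>) as a right inverse of an isomorphism.\<close>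

lemma counit_map_omega_unit_map:
  assumes X: "X \<in> ob ispace_cat"
  shows "cmp tame_mspace_cat (fob omega_functor X) (fob omega_functor (ispace_flat X)) (fob omega_functor X)
      (counit_map (fob omega_functor X)) (farr omega_functor X (ispace_flat X) (unit_map X)) =
    idn tame_mspace_cat (fob omega_functor X)"
proof -
  let ?X = "iset_simplices X"
  note tame = tame_colim_mset[OF ispace_iset[OF X]]
  have "compose (colim_N (?X q)) (counit_map (omega_ob X) q)
      (colim_map (?X q) (bullet_iset (colim_mset (?X q))) (\<lambda>m. unit_map X m q)) = (\<lambda>y\<in>colim_N (?X q). y)" for q
  proof (rule colim_N_extensionalityI[of _ "?X q"])
    fix m x assume x: "x \<in> fob (?X q) m"
    note h = unit_iset_hom[OF ispace_iset[OF X]]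
    have "counit_map (omega_ob X) q (colim_map (?X q) (bullet_iset (colim_mset (?X q)))
        (\<lambda>m. unit_map X m q) (germ (?X q) m x)) = unit_iset (?X q) m x"
      using colim_map_germ[OF h x] counit_mset_germ[OF tame iset_hom_mem[OF h x]]
      by (simp add: unit_map_eq counit_map_eq)
    then show "compose (colim_N (?X q)) (counit_map (omega_ob X) q)
        (colim_map (?X q) (bullet_iset (colim_mset (?X q))) (\<lambda>m. unit_map X m q)) (germ (?X q) m x) =
      (\<lambda>y\<in>colim_N (?X q). y) (germ (?X q) m x)"
      using germ_mem[OF x] x by (simp add: compose_eq unit_iset_def)
  qed simp_all
  then show ?thesis
    by (simp add: cmp_mspace idn_mspace)
qed

lemma adjunction_omega_bullet:
  "adjunction (ispace_cat :: ('u::infinite ispace, 'u imap) cat_data) tame_mspace_cat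
     omega_functor bullet_functor unit_map counit_map"
  unfolding adjunction_def
proof (intro conjI ballI)
  show "cat_functor (ispace_cat :: ('u ispace, 'u imap) cat_data) tame_mspace_cat omega_functor"
    by (rule cat_functor_omega)
  show "cat_functor tame_mspace_cat (ispace_cat :: ('u ispace, 'u imap) cat_data) bullet_functor"
    by (rule cat_functor_bullet)
  show "nat_trans (ispace_cat :: ('u ispace, 'u imap) cat_data) ispace_cat id_functor
      (comp_functor bullet_functor omega_functor) unit_map"
    by (rule nat_trans_unit_map)
  show "nat_trans (tame_mspace_cat :: ('u mspace, 'u smap) cat_data) tame_mspace_cat
      (comp_functor omega_functor bullet_functor) id_functor counit_map"
    by (rule nat_trans_counit_map)
next
  fix X :: "'u ispace" assume "X \<in> ob ispace_cat"
  then show "cmp tame_mspace_cat (fob omega_functor X) (fob omega_functor (ispace_flat X)) (fob omega_functor X)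
      (counit_map (fob omega_functor X)) (farr omega_functor X (ispace_flat X) (unit_map X)) =
    idn tame_mspace_cat (fob omega_functor X)"
    by (rule counit_map_omega_unit_map)
next
  fix W :: "'u mspace" assume W: "W \<in> ob tame_mspace_cat"
  let ?B = "\<lambda>q. bullet_iset (mset_simplices W q)"
  note tame = ob_tame_mspaceD(2)[OF W]
  \<comment> \<open>The other triangle, in one degree: the germ of \<open>x\<close> has its support
    in {1..m}, so the restricted counit is applied inside its domain and returns
    \<open>x\<close>.\<close>
  have "restrict (counit_map W q) (fob (bullet_iset (colim_mset (?B q))) m) (unit_map (bullet_ob W) m q x) = x"
    if x: "x \<in> fob (?B q) m" for m q x
  proof -
    have "germ (?B q) m x \<in> fob (bullet_iset (colim_mset (?B q))) m"
      using germ_mem[OF x] supp_germ[OF bullet_iset_ob[OF tame] x] by simp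
    then show ?thesis
      using x counit_mset_germ[OF tame x] by (simp add: unit_map_def counit_map_eq del: fob_bullet)
  qed
  then have "compose (fob (?B q) m) (restrict (counit_map W q) (fob (bullet_iset (colim_mset (?B q))) m))
      (unit_map (bullet_ob W) m q) = (\<lambda>x\<in>fob (?B q) m. x)" for m q
    unfolding compose_def by (intro restrict_ext)
  then show "cmp ispace_cat (fob bullet_functor W) (ispace_flat (fob bullet_functor W)) (fob bullet_functor W)
      (farr bullet_functor (fob omega_functor (fob bullet_functor W)) W (counit_map W))
      (unit_map (fob bullet_functor W)) = idn ispace_cat (fob bullet_functor W)"
    by (simp add: cmp_ispace idn_ispace del: fob_bullet)
qed

lemma unit_map_N_isomorphism:
  assumes X: "X \<in> ob ispace_cat" shows "N_isomorphism X (ispace_flat X) (unit_map X)"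
proof -
  note K = omega_ob_mspace[OF X]
  note B = bullet_ob_ispace[OF K]
  have "cmp tame_mspace_cat (omega_ob X) (omega_ob (bullet_ob (omega_ob X))) (omega_ob X)
      (counit_map (omega_ob X)) (farr omega_functor X (ispace_flat X) (unit_map X)) =
    idn tame_mspace_cat (omega_ob X)"
    using counit_map_omega_unit_map[OF X] by simp
  moreover have "farr omega_functor X (ispace_flat X) (unit_map X) \<in>
      hom tame_mspace_cat (omega_ob X) (omega_ob (bullet_ob (omega_ob X)))"
    using omega_hom[OF unit_map_hom[OF X]] by simp
  moreover have "is_iso tame_mspace_cat (omega_ob (bullet_ob (omega_ob X))) (omega_ob X) (counit_map (omega_ob X))"
    using counit_map_iso[OF K] by simp
  ultimately have "is_iso tame_mspace_cat (omega_ob X) (omega_ob (bullet_ob (omega_ob X)))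
      (farr omega_functor X (ispace_flat X) (unit_map X))"
    by (intro is_iso_right_inverse[OF category_tame_mspace_cat omega_ob_mspace[OF B] K])
  then show ?thesis
    using unit_map_hom[OF X] by (simp add: N_isomorphism_def)
qed

lemma flat_bullet_ob:
  assumes "W \<in> ob tame_mspace_cat" shows "flat_ispace (bullet_ob W)"
  using flat_bullet_iset[OF ob_tame_mspaceD(2)[OF assms]] by (simp add: flat_ispace_def)

lemma unit_map_iso_iff_flat:
  assumes X: "X \<in> ob ispace_cat"
  shows "is_iso ispace_cat X (ispace_flat X) (unit_map X) \<longleftrightarrow> flat_ispace X"
proof
  assume "is_iso ispace_cat X (ispace_flat X) (unit_map X)"
  then have bij: "bij_betw (unit_map X m q) (fob (fob X m) q) (fob (fob (ispace_flat X) m) q)" for m q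
    by (simp add: is_iso_ispace_iff)
  show "flat_ispace X"
    unfolding flat_ispace_def
  proof
    fix q
    show "flat_iset (iset_simplices X q)"
      using flat_iset_bij[OF unit_iset_hom[OF ispace_iset[OF X]] _ flat_bullet_iset[OF tame_colim_mset[OF ispace_iset[OF X]]], of q]
        bij[of _ q] by (simp add: unit_map_eq)
  qed
next
  assume "flat_ispace X"
  then have "bij_betw (unit_map X m q) (fob (fob X m) q) (fob (fob (ispace_flat X) m) q)" for m q
    using bij_betw_unit_iset[of "iset_simplices X q" m] by (simp add: flat_ispace_def unit_map_eq)
  then show "is_iso ispace_cat X (ispace_flat X) (unit_map X)"
    unfolding is_iso_ispace_iff using unit_map_hom[OF X] by blast
qed

section \<open>Restriction to flat I-spaces\<close>

lemma cat_functor_full_subcat_dom: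
  "cat_functor C D F \<Longrightarrow> cat_functor (full_subcat C P) D F"
  by (simp add: cat_functor_def cat_functor_axioms_def category_full_subcat)

lemma cat_functor_full_subcat_cod:
  "cat_functor C D F \<Longrightarrow> (\<And>x. x \<in> ob C \<Longrightarrow> P (fob F x)) \<Longrightarrow> cat_functor C (full_subcat D P) F"
  by (simp add: cat_functor_def cat_functor_axioms_def category_full_subcat)

lemma nat_trans_full_subcat:
  assumes "nat_trans C C F G t" "\<And>x. x \<in> ob C \<Longrightarrow> P x \<Longrightarrow> P (fob F x) \<and> P (fob G x)"
  shows "nat_trans (full_subcat C P) (full_subcat C P) F G t"
  using assms
  by (simp add: nat_trans_def nat_trans_axioms_def cat_functor_def cat_functor_axioms_def category_full_subcat)

text \<open>A full subcategory keeps the arrows, so unit and counit stay natural and a component is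
  invertible there exactly when it was before. What has to be added is that
  \<open>bullet_functor\<close> takes values in flat I-spaces; invertibility then comes from (iii)
  and (i).\<close>

lemma inverse_equivalences_omega_bullet:
  "inverse_equivalences (flat_ispace_cat :: ('u::infinite ispace, 'u imap) cat_data) tame_mspace_cat
     omega_functor bullet_functor"
  unfolding inverse_equivalences_def nat_iso_def
proof (intro conjI exI ballI)
  note adj = adjunction_omega_bullet[where 'u = 'u, unfolded adjunction_def]
  show "cat_functor (flat_ispace_cat :: ('u ispace, 'u imap) cat_data) tame_mspace_cat omega_functor"
    unfolding flat_ispace_cat_def by (rule cat_functor_full_subcat_dom[OF cat_functor_omega])
  show "cat_functor tame_mspace_cat (flat_ispace_cat :: ('u ispace, 'u imap) cat_data) bullet_functor"
    unfolding flat_ispace_cat_def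
    by (rule cat_functor_full_subcat_cod[OF cat_functor_bullet]) (simp add: flat_bullet_ob)
  show "nat_trans (flat_ispace_cat :: ('u ispace, 'u imap) cat_data) flat_ispace_cat id_functor
      (comp_functor bullet_functor omega_functor) unit_map"
    unfolding flat_ispace_cat_def
  proof (rule nat_trans_full_subcat)
    show "nat_trans (ispace_cat :: ('u ispace, 'u imap) cat_data) ispace_cat id_functor
        (comp_functor bullet_functor omega_functor) unit_map"
      using adj by blast
  qed (simp add: id_functor_def comp_functor_def flat_bullet_ob omega_ob_mspace)
  show "nat_trans (tame_mspace_cat :: ('u mspace, 'u smap) cat_data) tame_mspace_cat
      (comp_functor omega_functor bullet_functor) id_functor counit_map"
    using adj by blast
next
  fix X :: "'u ispace" assume "X \<in> ob flat_ispace_cat"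
  then show "is_iso flat_ispace_cat (fob id_functor X) (fob (comp_functor bullet_functor omega_functor) X)
      (unit_map X)"
    using unit_map_iso_iff_flat[of X]
    by (simp add: flat_ispace_cat_def id_functor_def comp_functor_def)
next
  fix W :: "'u mspace" assume "W \<in> ob tame_mspace_cat"
  then show "is_iso tame_mspace_cat (fob (comp_functor omega_functor bullet_functor) W) (fob id_functor W)
      (counit_map W)"
    using counit_map_iso[of W] by (simp add: id_functor_def comp_functor_def)
qed

theorem corollary5p7:
  shows
    "adjunction (ispace_cat :: ('u::infinite ispace, 'u imap) cat_data) tame_mspace_cat
       omega_functor bullet_functor unit_map counit_map \<and>
     (\<forall>W \<in> ob (tame_mspace_cat :: ('u mspace, 'u smap) cat_data).
       is_iso tame_mspace_cat (fob omega_functor (fob bullet_functor W)) W (counit_map W)) \<and>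
     (\<forall>X \<in> ob (ispace_cat :: ('u ispace, 'u imap) cat_data).
       N_isomorphism X (ispace_flat X) (unit_map X)) \<and>
     (\<forall>X \<in> ob (ispace_cat :: ('u ispace, 'u imap) cat_data).
       is_iso ispace_cat X (ispace_flat X) (unit_map X) \<longleftrightarrow> flat_ispace X) \<and>
     inverse_equivalences (flat_ispace_cat :: ('u ispace, 'u imap) cat_data) tame_mspace_cat
       omega_functor bullet_functor"
  using adjunction_omega_bullet counit_map_iso unit_map_N_isomorphism unit_map_iso_iff_flat
    inverse_equivalences_omega_bullet
  by (intro conjI ballI) simp_all

end
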